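(* For each $d$ let $\mathcal{A}_d$ be a non-negative sublinear operator which is bounded on $L^2(\mathbb{R}^d)$ and is a contraction on $L^\infty(\mathbb{R}^d)$. Fix $k\ge 3$ and assume that there is a constant $C(k,d)$ for which $$|R_k^1f(x)|\le C(k,d)\,\mathcal{A}_d(R_kf)(x)$$ holds for all Schwartz functions $f$ on $\mathbb{R}^d$ and all $x\in\mathbb{R}^d$. Then $C(k,d)\to\infty$ as $d\to\infty$.
   Context: Here $d$ and $k$ are positive integers; $d$ is the dimension and $k$ is the order of the Riesz transform. $\mathcal{H}_k=\mathcal{H}_k^d$ denotes the space of spherical harmonics of degree $k$ on the unit sphere $\mathbb{S}^{d-1}$, with $P\in\mathcal{H}_k$ identified with the corresponding harmonic polynomial on $\mathbb{R}^d$, homogeneous of degree $k$. For $P\in\mathcal{H}_k$ and $t>0$, the truncated Riesz transform is $$R_P^t f(x)=\gamma_{k,d}\int_{|y|>t}\frac{P(y)}{|y|^{d+k}}f(x-y)\,dy,\qquad \gamma_{k,d}=\frac{\Gamma(\frac{k+d}{2})}{\pi^{d/2}\Gamma(\frac k2)},$$ and the higher order Riesz transform of order $k$ corresponding to $P$ is $R_Pf(x)=\lim_{t\to0^+}R_P^tf(x)$. One writes $R_k$ for a higher order Riesz transform $R_P$ of order $k$ corresponding to some $P\in\mathcal{H}_k$, and $R_k^t$ for the corresponding truncated Riesz transform $R_P^t$; thus $R_k^1$ is the truncation at $t=1$. The statement that $\mathcal{A}_d$ is a non-negative sublinear operator, bounded on $L^2(\mathbb{R}^d)$ and a contraction on $L^\infty(\mathbb{R}^d)$,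 means the following. For any $f,g\in L^2(\mathbb{R}^d)+L^\infty(\mathbb{R}^d)$ and $\lambda\in\mathbb{C}$ the relations $$\mathcal{A}_d(f)(x)\ge0,\quad \mathcal{A}_d(\lambda f)(x)=|\lambda|\,\mathcal{A}_d(f)(x),\quad \mathcal{A}_d(f+g)(x)\le\mathcal{A}_d(f)(x)+\mathcal{A}_d(g)(x)$$ hold for a.e. $x\in\mathbb{R}^d$; moreover $\|\mathcal{A}_d(f)\|_{L^\infty(\mathbb{R}^d)}\le\|f\|_{L^\infty(\mathbb{R}^d)}$ for $f\in L^\infty(\mathbb{R}^d)$, and there is a constant $C>0$ such that $\|\mathcal{A}_d(f)\|_{L^2(\mathbb{R}^d)}\le C\|f\|_{L^2(\mathbb{R}^d)}$ for $f\in L^2(\mathbb{R}^d)$. *)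

theory Defs
  imports "HOL-Probability.Essential_Supremum"
begin

text \<open>
  The dimension \<open>d\<close> is a number here and tends to infinity, so it cannot be a type.
  A point of Euclidean \<open>d\<close>-space is a function \<open>x :: nat \<Rightarrow> real\<close> that is
  extensional on \<open>{..<d}\<close>, with coordinates \<open>x 0, \<dots>, x (d - 1)\<close>; these points form the
  space of the product measure below.  Functions on \<open>d\<close>-space have domain \<open>nat \<Rightarrow> real\<close>,
  and their values off \<open>Rd d\<close> play no role.
\<close>

definition Rd :: "nat \<Rightarrow> (nat \<Rightarrow> real) set" where
  "Rd d = {..<d} \<rightarrow>\<^sub>E UNIV"

definition Rd_diff :: "nat \<Rightarrow> (nat \<Rightarrow> real) \<Rightarrow> (nat \<Rightarrow> real) \<Rightarrow> (nat \<Rightarrow> real)" where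
  "Rd_diff d x y = (\<lambda>i\<in>{..<d}. x i - y i)"

definition Rd_norm :: "nat \<Rightarrow> (nat \<Rightarrow> real) \<Rightarrow> real" where
  "Rd_norm d x = L2_set x {..<d}"

definition leb :: "nat \<Rightarrow> (nat \<Rightarrow> real) measure" where
  "leb d = completion (Pi\<^sub>M {..<d} (\<lambda>_. lborel))"

lemma space_leb: "space (leb d) = Rd d"
  by (simp add: leb_def Rd_def space_PiM)


section \<open>Schwartz functions and spherical harmonics\<close>

definition partial :: "nat \<Rightarrow> ((nat \<Rightarrow> real) \<Rightarrow> complex) \<Rightarrow> (nat \<Rightarrow> real) \<Rightarrow> complex" where
  "partial i f x = vector_derivative (\<lambda>t. f (x(i := t))) (at (x i))"

text \<open>\<open>partials [i\<^sub>1, \<dots>, i\<^sub>m] f\<close> is the iterated partial derivative along these coordinates.\<close>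

definition partials :: "nat list \<Rightarrow> ((nat \<Rightarrow> real) \<Rightarrow> complex) \<Rightarrow> (nat \<Rightarrow> real) \<Rightarrow> complex" where
  "partials js f = foldr partial js f"

text \<open>
  Continuity refers to the product topology on \<open>nat \<Rightarrow> real\<close>, which induces the Euclidean
  topology on \<open>Rd d\<close>.
\<close>

definition smooth :: "nat \<Rightarrow> ((nat \<Rightarrow> real) \<Rightarrow> complex) \<Rightarrow> bool" where
  "smooth d f \<longleftrightarrow>
     (\<forall>js. set js \<subseteq> {..<d} \<longrightarrow>
        continuous_on (Rd d) (partials js f) \<and>
        (\<forall>i<d. \<forall>x\<in>Rd d. (\<lambda>t. partials js f (x(i := t))) differentiable at (x i)))"

definition schwartz :: "nat \<Rightarrow> ((nat \<Rightarrow> real) \<Rightarrow> complex) set" where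
  "schwartz d = {f. smooth d f \<and>
     (\<forall>\<alpha> :: nat \<Rightarrow> nat. \<forall>js. set js \<subseteq> {..<d} \<longrightarrow>
        (\<exists>B. \<forall>x\<in>Rd d. norm (of_real (\<Prod>i<d. x i ^ \<alpha> i) * partials js f x) \<le> B))}"

definition homogeneous_polynomial :: "nat \<Rightarrow> nat \<Rightarrow> ((nat \<Rightarrow> real) \<Rightarrow> complex) \<Rightarrow> bool" where
  "homogeneous_polynomial d k P \<longleftrightarrow>
     (\<exists>c :: (nat \<Rightarrow> nat) \<Rightarrow> complex. \<forall>x\<in>Rd d.
        P x = (\<Sum>\<alpha> \<in> {\<alpha> \<in> {..<d} \<rightarrow>\<^sub>E {..k}. (\<Sum>i<d. \<alpha> i) = k}.
                 c \<alpha> * of_real (\<Prod>i<d. x i ^ \<alpha> i)))"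

definition harmonic :: "nat \<Rightarrow> ((nat \<Rightarrow> real) \<Rightarrow> complex) \<Rightarrow> bool" where
  "harmonic d P \<longleftrightarrow> (\<forall>x\<in>Rd d. (\<Sum>i<d. partial i (partial i P) x) = 0)"

text \<open>
  Spherical harmonics of degree \<open>k\<close>, identified with the harmonic polynomials on
  \<open>d\<close>-space that are homogeneous of degree \<open>k\<close>.
\<close>

definition spherical_harmonics :: "nat \<Rightarrow> nat \<Rightarrow> ((nat \<Rightarrow> real) \<Rightarrow> complex) set" where
  "spherical_harmonics d k = {P. homogeneous_polynomial d k P \<and> harmonic d P}"


section \<open>Riesz transforms\<close>

definition riesz_const :: "nat \<Rightarrow> nat \<Rightarrow> real" where
  "riesz_const k d = Gamma (real (k + d) / 2) / (pi powr (real d / 2) * Gamma (real k / 2))"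

definition riesz_trunc :: "nat \<Rightarrow> nat \<Rightarrow> ((nat \<Rightarrow> real) \<Rightarrow> complex) \<Rightarrow> real \<Rightarrow>
    ((nat \<Rightarrow> real) \<Rightarrow> complex) \<Rightarrow> (nat \<Rightarrow> real) \<Rightarrow> complex" where
  "riesz_trunc d k P t f x = of_real (riesz_const k d) *
     (LINT y:{y \<in> Rd d. Rd_norm d y > t}|leb d.
        P y / of_real (Rd_norm d y ^ (d + k)) * f (Rd_diff d x y))"

definition riesz :: "nat \<Rightarrow> nat \<Rightarrow> ((nat \<Rightarrow> real) \<Rightarrow> complex) \<Rightarrow>
    ((nat \<Rightarrow> real) \<Rightarrow> complex) \<Rightarrow> (nat \<Rightarrow> real) \<Rightarrow> complex" where
  "riesz d k P f x = Lim (at_right 0) (\<lambda>t. riesz_trunc d k P t f x)"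


section \<open>Sublinear operators\<close>

definition L2 :: "nat \<Rightarrow> ((nat \<Rightarrow> real) \<Rightarrow> 'b :: {banach, second_countable_topology}) set" where
  "L2 d = {f \<in> borel_measurable (leb d). integrable (leb d) (\<lambda>x. (norm (f x))\<^sup>2)}"

definition L2_norm :: "nat \<Rightarrow> ((nat \<Rightarrow> real) \<Rightarrow> 'b :: {banach, second_countable_topology}) \<Rightarrow> real"
  where "L2_norm d f = sqrt (LINT x|leb d. (norm (f x))\<^sup>2)"

definition Linf_norm ::
    "nat \<Rightarrow> ((nat \<Rightarrow> real) \<Rightarrow> 'b :: {banach, second_countable_topology}) \<Rightarrow> ereal" where
  "Linf_norm d f = esssup (leb d) (\<lambda>x. ereal (norm (f x)))"

definition Linf :: "nat \<Rightarrow> ((nat \<Rightarrow> real) \<Rightarrow> 'b :: {banach, second_countable_topology}) set" where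
  "Linf d = {f \<in> borel_measurable (leb d). Linf_norm d f < \<infinity>}"

definition L2_plus_Linf :: "nat \<Rightarrow> ((nat \<Rightarrow> real) \<Rightarrow> complex) set" where
  "L2_plus_Linf d = {\<lambda>x. g x + h x |g h. g \<in> L2 d \<and> h \<in> Linf d}"

text \<open>
  Operators act on functions rather than on classes modulo null sets.  This costs nothing:
  sublinearity and the contraction property force \<open>A f = A g\<close> almost everywhere
  whenever \<open>f = g\<close> almost everywhere.
\<close>

definition nonneg_sublinear ::
    "nat \<Rightarrow> (((nat \<Rightarrow> real) \<Rightarrow> complex) \<Rightarrow> (nat \<Rightarrow> real) \<Rightarrow> real) \<Rightarrow> bool" where
  "nonneg_sublinear d A \<longleftrightarrow>
     (\<forall>f \<in> L2_plus_Linf d.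
        A f \<in> borel_measurable (leb d) \<and>
        (AE x in leb d. A f x \<ge> 0) \<and>
        (\<forall>c. AE x in leb d. A (\<lambda>y. c * f y) x = norm c * A f x) \<and>
        (\<forall>g \<in> L2_plus_Linf d. AE x in leb d. A (\<lambda>y. f y + g y) x \<le> A f x + A g x))"

definition bounded_on_L2 ::
    "nat \<Rightarrow> (((nat \<Rightarrow> real) \<Rightarrow> complex) \<Rightarrow> (nat \<Rightarrow> real) \<Rightarrow> real) \<Rightarrow> bool" where
  "bounded_on_L2 d A \<longleftrightarrow>
     (\<exists>B>0. \<forall>f \<in> L2 d. A f \<in> L2 d \<and> L2_norm d (A f) \<le> B * L2_norm d f)"

definition contraction_on_Linf ::
    "nat \<Rightarrow> (((nat \<Rightarrow> real) \<Rightarrow> complex) \<Rightarrow> (nat \<Rightarrow> real) \<Rightarrow> real) \<Rightarrow> bool" where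
  "contraction_on_Linf d A \<longleftrightarrow>
     (\<forall>f \<in> Linf d. A f \<in> Linf d \<and> Linf_norm d (A f) \<le> Linf_norm d f)"

end

theory Submission
  imports Defs "HOL-Probability.Probability" "HOL-Real_Asymp.Real_Asymp"
begin

text \<open>
  By dilation, the hypothesis gives \<open>\<bar>R\<^sub>P\<^sup>t f (0)\<bar> \<le> max C 0 * sup \<bar>R\<^sub>P f\<bar>\<close> for every \<open>t > 0\<close>.
  Put \<open>M = (d + k) / 2\<close> and average over \<open>t = sqrt v\<close> with the weight \<open>\<Phi>' v\<close>, where
  \<open>\<Phi> v = v powr M * exp (- \<zeta> * v)\<close> and \<open>\<zeta> = M - \<i> * M\<close>: the kernel of the truncated transforms becomes
  \<open>P y * exp (- \<zeta> * \<bar>y\<bar>\<^sup>2)\<close>, and the total mass of \<open>\<Phi>'\<close> is at most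
  \<open>(1 + sqrt 2) * M * Gamma M * M powr - M\<close>.
  For \<open>R\<^sub>P f\<close> we take (a truncation of) the chirped Gaussian \<open>exp (- z * \<bar>x\<bar>\<^sup>2)\<close> with \<open>z = 1 + \<i> * M\<close>, which is
  bounded by 1; the Fourier transform of \<open>f\<close> is that of the Gaussian divided by the multiplier of
  \<open>R\<^sub>P\<close>.  By Hecke's formula the averaged kernel applied to \<open>f\<close> is a radial Gaussian integral with
  \<open>P\<close> cancelled, and it is evaluated explicitly.  The imaginary parts of \<open>z\<close> and \<open>\<zeta>\<close> cancel in
  \<open>z + \<zeta> = M + 1\<close>, so that \<open>max C 0\<close> is at least a constant depending on \<open>k\<close> times
  \<open>Gamma ((d + k) / 2) / (Gamma (d / 2) * M)\<close>, which grows like \<open>d powr (k / 2 - 1)\<close>.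
\<close>

section \<open>Lebesgue measure on product space\<close>

text \<open>The chirp is what makes the bound grow. For general \<zeta> and z the argument bounds
  \<open>max C 0\<close> from below by \<open>Gamma M / (Gamma (d / 2) * Gamma (k / 2))\<close>
  times (|z| / |\<zeta>|) powr (k / 2) times (|z + \<zeta>| / Re \<zeta>) powr (- M), divided by M *
  (1 + |\<zeta>| / Re \<zeta>). For positive real z and \<zeta> the product of the two powers is at
  most of order M powr (- k / 2), which eats up the growth of the Gamma quotient. Opposite imaginary
  parts decouple the two powers: |z| and |\<zeta>| become comparable, while |z + \<zeta>| exceeds Re
  \<zeta> only by 1, and the price is a constant factor. A second obstacle is that the Gaussian
  divided by the multiplier is singular at the zeros of P and at the origin, so the function with
  this transform need not be Schwartz. The frequencies are therefore cut off and the function is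
  multiplied by a wide Gaussian. This perturbs the frequencies, but as the multiplier is homogeneous
  of degree 0 the resulting error is the same for all dilations, and it vanishes as the Gaussian
  widens.\<close>

abbreviation lb :: "nat \<Rightarrow> (nat \<Rightarrow> real) measure" where
  "lb d \<equiv> Pi\<^sub>M {..<d} (\<lambda>_. lborel)"

interpretation lbp: product_sigma_finite "\<lambda>_::nat. lborel :: real measure"
  by standard

lemma space_lb: "space (lb d) = Rd d"
  by (simp add: Rd_def space_PiM)

lemma sigma_finite_lb: "sigma_finite_measure (lb d)"
  by (rule lbp.sigma_finite) simp

lemma Rd_norm_power2: "(Rd_norm d x)\<^sup>2 = (\<Sum>i<d. (x i)\<^sup>2)"
  by (simp add: Rd_norm_def L2_set_def sum_nonneg)

lemma Rd_norm_nonneg [simp]: "0 \<le> Rd_norm d x"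
  by (simp add: Rd_norm_def)

text \<open>The norm must be positive because of \<open>n = 0\<close>: \<open>0 powr 0\<close> is 0
  while \<open>0 ^ 0\<close> is 1.\<close>

lemma Rd_norm_power2_powr:
  assumes "Rd_norm d y > 0" "M = real n / 2"
  shows "((Rd_norm d y)\<^sup>2) powr M = Rd_norm d y ^ n"
proof -
  have "((Rd_norm d y)\<^sup>2) powr M = (Rd_norm d y powr 2) powr M"
    using powr_numeral[of "Rd_norm d y" "num.Bit0 num.One"] assms(1) by (simp del: powr_numeral powr_powr)
  also have "\<dots> = Rd_norm d y powr real n"
  proof -
    have "2 * M = real n" using assms(2) by simp
    then show ?thesis by (simp only: powr_powr)
  qed
  also have "\<dots> = Rd_norm d y ^ n" using assms(1) by (rule powr_realpow)
  finally show ?thesis .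
qed

lemma measurable_Rd_norm [measurable]: "Rd_norm d \<in> borel_measurable (lb d)"
  unfolding Rd_norm_def[abs_def] L2_set_def by measurable

lemma abs_coord_le_Rd_norm: "i < d \<Longrightarrow> \<bar>x i\<bar> \<le> Rd_norm d x"
  unfolding Rd_norm_def by (rule member_le_L2_set[of _ _ "\<lambda>i. \<bar>x i\<bar>", unfolded L2_set_def, simplified, folded L2_set_def]) auto

text \<open>One map serves for translations (\<open>t = 1\<close>), dilations (\<open>a = 0\<close>)
  and the reflection in a convolution (\<open>t = - 1\<close>), so that a single change of variables
  suffices. The restriction keeps its values in \<open>Rd d\<close> whatever the arguments
  are.\<close>

definition affine_map :: "nat \<Rightarrow> (nat \<Rightarrow> real) \<Rightarrow> real \<Rightarrow> (nat \<Rightarrow> real) \<Rightarrow> (nat \<Rightarrow> real)" where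
  "affine_map d a t x = (\<lambda>i\<in>{..<d}. a i + t * x i)"

lemma affine_map_in_Rd [simp]: "affine_map d a t x \<in> Rd d"
  by (simp add: affine_map_def Rd_def)

lemma measurable_affine_map [measurable]: "affine_map d a t \<in> measurable (lb d) (lb d)"
  unfolding affine_map_def[abs_def] by (rule measurable_restrict) simp

lemma Rd_norm_affine_map: "Rd_norm d (affine_map d (\<lambda>_. 0) t x) = \<bar>t\<bar> * Rd_norm d x"
proof -
  have "(\<Sum>i<d. (affine_map d (\<lambda>_. 0) t x i)\<^sup>2) = t\<^sup>2 * (\<Sum>i<d. (x i)\<^sup>2)"
    by (simp add: affine_map_def power_mult_distrib sum_distrib_left)
  then show ?thesis by (simp add: Rd_norm_def L2_set_def real_sqrt_mult)
qed

text \<open>A product measure is determined by its values on boxes. The preimage of a box is a box,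
  and each side contributes one factor \<open>\<bar>t\<bar>\<close> by the affine rule on the
  line.\<close>

lemma lb_affine:
  assumes t: "t \<noteq> 0"
  shows "lb d = density (distr (lb d) (lb d) (affine_map d a t)) (\<lambda>_. ennreal (\<bar>t\<bar> ^ d))"
proof (rule lbp.PiM_eqI[symmetric])
  fix A :: "nat \<Rightarrow> real set"
  assume A: "\<And>i. i \<in> {..<d} \<Longrightarrow> A i \<in> sets lborel"
  have AE: "Pi\<^sub>E {..<d} A \<in> sets (lb d)"
    using A by (intro sets_PiM_I_finite) auto
  have pre: "affine_map d a t -` Pi\<^sub>E {..<d} A \<inter> space (lb d) = Pi\<^sub>E {..<d} (\<lambda>i. (\<lambda>x. a i + t * x) -` A i)"
    by (auto simp: affine_map_def space_PiM PiE_iff restrict_def extensional_def)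
  have m: "(\<lambda>x. a i + t * x) -` A i \<in> sets lborel" if "i < d" for i
    using measurable_sets[of "\<lambda>x. a i + t * x" borel borel "A i"] A that by auto
  have one: "emeasure lborel (A i) = ennreal \<bar>t\<bar> * emeasure lborel ((\<lambda>x. a i + t * x) -` A i)" if "i < d" for i
  proof -
    have "emeasure lborel (A i) = emeasure (density (distr lborel borel (\<lambda>x. a i + t * x)) (\<lambda>_. ennreal \<bar>t\<bar>)) (A i)"
      using lborel_real_affine[OF t, of "a i"] by simp
    also have "\<dots> = ennreal \<bar>t\<bar> * emeasure lborel ((\<lambda>x. a i + t * x) -` A i)"
      using A[of i] that by (simp add: emeasure_density_const emeasure_distr)
    finally show ?thesis .
  qed
  have "emeasure (density (distr (lb d) (lb d) (affine_map d a t)) (\<lambda>_. ennreal (\<bar>t\<bar> ^ d))) (Pi\<^sub>E {..<d} A)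
      = ennreal (\<bar>t\<bar> ^ d) * emeasure (lb d) (Pi\<^sub>E {..<d} (\<lambda>i. (\<lambda>x. a i + t * x) -` A i))"
    using AE by (simp add: emeasure_density_const emeasure_distr pre)
  also have "\<dots> = ennreal (\<bar>t\<bar> ^ d) * (\<Prod>i<d. emeasure lborel ((\<lambda>x. a i + t * x) -` A i))"
    using m by (subst lbp.emeasure_PiM) auto
  also have "\<dots> = (\<Prod>i<d. emeasure lborel (A i))"
    by (simp add: one prod.distrib ennreal_power)
  finally show "emeasure (density (distr (lb d) (lb d) (affine_map d a t)) (\<lambda>_. ennreal (\<bar>t\<bar> ^ d))) (Pi\<^sub>E {..<d} A)
      = (\<Prod>i\<in>{..<d}. emeasure lborel (A i))" by simp
qed auto

lemma integrable_lb_affine: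
  fixes f :: "(nat \<Rightarrow> real) \<Rightarrow> 'b::{banach, second_countable_topology}"
  assumes t: "t \<noteq> 0" and f: "integrable (lb d) f"
  shows "integrable (lb d) (\<lambda>x. f (affine_map d a t x))"
proof -
  have [measurable]: "f \<in> borel_measurable (lb d)" using f by simp
  have "integrable (density (distr (lb d) (lb d) (affine_map d a t)) (\<lambda>_. ennreal (\<bar>t\<bar> ^ d))) f"
    using f lb_affine[OF t, of d a] by simp
  then have "integrable (lb d) (\<lambda>x. \<bar>t\<bar> ^ d *\<^sub>R f (affine_map d a t x))"
    by (subst (asm) integrable_density) (auto simp: integrable_distr_eq)
  from integrable_scaleR_right[OF this, of "1 / \<bar>t\<bar> ^ d"] show ?thesis using t by simp
qed

lemma integral_lb_affine:
  fixes f :: "(nat \<Rightarrow> real) \<Rightarrow> 'b::{banach, second_countable_topology}"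
  assumes t: "t \<noteq> 0" and [measurable]: "f \<in> borel_measurable (lb d)"
  shows "(\<integral>x. f x \<partial>lb d) = \<bar>t\<bar> ^ d *\<^sub>R (\<integral>x. f (affine_map d a t x) \<partial>lb d)"
proof -
  have "(\<integral>x. f x \<partial>lb d) = (\<integral>x. f x \<partial>density (distr (lb d) (lb d) (affine_map d a t)) (\<lambda>_. ennreal (\<bar>t\<bar> ^ d)))"
    using lb_affine[OF t, of d a] by simp
  also have "\<dots> = \<bar>t\<bar> ^ d *\<^sub>R (\<integral>x. f (affine_map d a t x) \<partial>lb d)"
    by (subst integral_density) (auto simp: integral_distr)
  finally show ?thesis .
qed

lemma nn_integral_lb_affine:
  assumes t: "t \<noteq> 0" and [measurable]: "f \<in> borel_measurable (lb d)"
  shows "(\<integral>\<^sup>+x. f x \<partial>lb d) = ennreal (\<bar>t\<bar> ^ d) * (\<integral>\<^sup>+x. f (affine_map d a t x) \<partial>lb d)"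
proof -
  have "(\<integral>\<^sup>+x. f x \<partial>lb d) = (\<integral>\<^sup>+x. f x \<partial>density (distr (lb d) (lb d) (affine_map d a t)) (\<lambda>_. ennreal (\<bar>t\<bar> ^ d)))"
    using lb_affine[OF t, of d a] by simp
  also have "\<dots> = ennreal (\<bar>t\<bar> ^ d) * (\<integral>\<^sup>+x. f (affine_map d a t x) \<partial>lb d)"
    by (simp add: nn_integral_density nn_integral_distr nn_integral_cmult)
  finally show ?thesis .
qed

section \<open>Gamma and Gaussian integrals\<close>

lemma has_bochner_integral_Gamma:
  fixes \<alpha> s :: real
  assumes "\<alpha> > 0" "s > 0"
  shows "has_bochner_integral lborel (\<lambda>u. indicator {0<..} u * (u powr (\<alpha> - 1) * exp (- s * u)))
           (Gamma \<alpha> / s powr \<alpha>)"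
proof (rule has_bochner_integral_nn_integral)
  let ?f = "\<lambda>t::real. ennreal (indicator {0..} t * t powr (\<alpha> - 1) / exp t)"
  have "ennreal (Gamma \<alpha>) = (\<integral>\<^sup>+t. ?f t \<partial>lborel)"
    using Gamma_conv_nn_integral_real[OF assms(1)] .
  also have "\<dots> = ennreal s * (\<integral>\<^sup>+u. ?f (s * u) \<partial>lborel)"
    using nn_integral_real_affine[of ?f s 0] assms by simp
  also have "(\<integral>\<^sup>+u. ?f (s * u) \<partial>lborel)
     = (\<integral>\<^sup>+u. ennreal (s powr (\<alpha> - 1)) * ennreal (indicator {0<..} u * (u powr (\<alpha> - 1) * exp (- s * u))) \<partial>lborel)"
    using assms by (intro nn_integral_cong_AE AE_I[where N="{0}"])
      (auto simp: indicator_def powr_mult exp_minus divide_simps zero_le_mult_iff ennreal_mult'[symmetric] mult_ac)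
  also have "\<dots> = ennreal (s powr (\<alpha> - 1)) * (\<integral>\<^sup>+u. ennreal (indicator {0<..} u * (u powr (\<alpha> - 1) * exp (- s * u))) \<partial>lborel)"
    by (rule nn_integral_cmult) measurable
  finally have *: "ennreal (Gamma \<alpha>) = ennreal (s powr \<alpha>) * (\<integral>\<^sup>+u. ennreal (indicator {0<..} u * (u powr (\<alpha> - 1) * exp (- s * u))) \<partial>lborel)"
    using assms by (simp add: mult.assoc[symmetric] ennreal_mult'[symmetric] powr_diff)
  have "ennreal (Gamma \<alpha> / s powr \<alpha>) = ennreal (1 / s powr \<alpha>) * ennreal (Gamma \<alpha>)"
    using assms by (simp add: ennreal_mult'[symmetric])
  also have "\<dots> = (\<integral>\<^sup>+u. ennreal (indicator {0<..} u * (u powr (\<alpha> - 1) * exp (- s * u))) \<partial>lborel)"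
    unfolding * using assms by (simp add: mult.assoc[symmetric] ennreal_mult'[symmetric])
  finally show "(\<integral>\<^sup>+u. ennreal (indicator {0<..} u * (u powr (\<alpha> - 1) * exp (- s * u))) \<partial>lborel) = ennreal (Gamma \<alpha> / s powr \<alpha>)"
    by simp
qed (use assms in \<open>auto intro: Gamma_real_nonneg\<close>)

lemma power_times_exp_bound:
  fixes x s :: real
  assumes "s > 0" "x \<ge> 0"
  shows "x ^ n \<le> fact n / s ^ n * exp (s * x)"
proof -
  have "(s * x) ^ n / fact n \<le> exp (s * x)"
  proof -
    have "(s * x) ^ n / fact n = (\<Sum>i\<in>{n}. (s * x) ^ i / fact i)" by simp
    also have "\<dots> \<le> (\<Sum>i\<le>n. (s * x) ^ i / fact i)"
      using assms by (intro sum_mono2) auto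
    also have "\<dots> \<le> exp (s * x)"
      using assms sum_le_suminf[of "\<lambda>i. (s * x) ^ i / fact i" "{..n}"] summable_exp[of "s * x"]
      by (simp add: exp_def scaleR_conv_of_real divide_inverse mult.commute)
    finally show ?thesis .
  qed
  then show ?thesis using assms by (simp add: power_mult_distrib field_simps)
qed

lemma has_bochner_integral_gauss_real:
  fixes s :: real
  assumes "s > 0"
  shows "has_bochner_integral lborel (\<lambda>y. exp (- s * y\<^sup>2)) (sqrt (pi / s))"
proof -
  have "has_bochner_integral lborel (\<lambda>x::real. exp (- x\<^sup>2)) (sqrt pi)"
  proof -
    have "has_bochner_integral lborel (\<lambda>x::real. indicator {0..} x *\<^sub>R exp (- x\<^sup>2)) (sqrt pi / 2)"
      by (rule gaussian_moment_0)
    from has_bochner_integral_even_function[OF this] show ?thesis by simp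
  qed
  from lborel_has_bochner_integral_real_affine_iff[THEN iffD1, OF _ this, of "sqrt s" 0] assms
  show ?thesis by (simp add: power_mult_distrib real_sqrt_divide has_bochner_integral_iff field_simps)
qed

lemma has_bochner_integral_lb_prod:
  fixes f :: "nat \<Rightarrow> real \<Rightarrow> 'b::{real_normed_field, banach, second_countable_topology}"
  assumes "\<And>i. i < d \<Longrightarrow> integrable lborel (f i)"
  shows "has_bochner_integral (lb d) (\<lambda>y. \<Prod>i<d. f i (y i)) (\<Prod>i<d. \<integral>x. f i x \<partial>lborel)"
  using lbp.product_integrable_prod[of "{..<d}" f] lbp.product_integral_prod[of "{..<d}" f] assms
  by (simp add: has_bochner_integral_iff)

lemma has_bochner_integral_gauss_lb:
  fixes s :: real
  assumes "s > 0"
  shows "has_bochner_integral (lb d) (\<lambda>y. exp (- s * (Rd_norm d y)\<^sup>2)) ((pi / s) powr (d / 2))"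
proof -
  have "has_bochner_integral (lb d) (\<lambda>y. \<Prod>i<d. exp (- s * (y i)\<^sup>2)) (\<Prod>i<d. sqrt (pi / s))"
    using has_bochner_integral_lb_prod[of d "\<lambda>_ x. exp (- s * x\<^sup>2)"] has_bochner_integral_gauss_real[OF assms]
    by (simp add: has_bochner_integral_iff)
  moreover have "(\<Prod>i<d. sqrt (pi / s)) = (pi / s) powr (d / 2)"
    using assms by (simp add: powr_half_sqrt[symmetric] powr_power)
  ultimately show ?thesis
    by (simp add: Rd_norm_power2 exp_sum[symmetric] sum_distrib_left)
qed

text \<open>Half of the Gaussian absorbs the power. Replacing \<open>r ^ k\<close> by
  \<open>1 + (r\<^sup>2) ^ k\<close> leaves only powers of \<open>r\<^sup>2\<close>, which the
  exponential series controls.\<close>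

lemma power_gauss_bound:
  fixes r s :: real
  assumes s: "s > 0" and r: "r \<ge> 0"
  shows "r ^ k * exp (- s * r\<^sup>2) \<le> (1 + fact k / (s / 2) ^ k) * exp (- (s / 2) * r\<^sup>2)"
proof -
  let ?K = "fact k / (s / 2) ^ k"
  have "r ^ k \<le> 1 + (r\<^sup>2) ^ k"
  proof (cases "r \<le> 1")
    case True
    then show ?thesis using r power_le_one[of r k] by (simp add: add_increasing2)
  next
    case False
    then have "r ^ k \<le> r ^ (2 * k)" by (intro power_increasing) auto
    then show ?thesis by (simp add: power_mult)
  qed
  also have "\<dots> \<le> exp (s / 2 * r\<^sup>2) + ?K * exp (s / 2 * r\<^sup>2)"
    using power_times_exp_bound[of "s / 2" "r\<^sup>2" k] s by (intro add_mono) auto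
  finally have "r ^ k * exp (- s * r\<^sup>2) \<le> ((1 + ?K) * exp (s / 2 * r\<^sup>2)) * exp (- s * r\<^sup>2)"
    by (intro mult_right_mono) (auto simp: algebra_simps)
  also have "\<dots> = (1 + ?K) * exp (- (s / 2) * r\<^sup>2)"
    by (simp add: mult.assoc exp_add[symmetric] algebra_simps)
  finally show ?thesis .
qed

lemma integrable_norm_power_gauss:
  fixes s :: real
  assumes "s > 0"
  shows "integrable (lb d) (\<lambda>y. Rd_norm d y ^ k * exp (- s * (Rd_norm d y)\<^sup>2))"
proof (rule Bochner_Integration.integrable_bound)
  show "integrable (lb d) (\<lambda>y. (1 + fact k / (s / 2) ^ k) * exp (- (s / 2) * (Rd_norm d y)\<^sup>2))"
    using has_bochner_integral_gauss_lb[of "s / 2" d] assms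
    by (intro integrable_mult_right) (simp add: has_bochner_integral_iff)
  show "AE y in lb d. norm (Rd_norm d y ^ k * exp (- s * (Rd_norm d y)\<^sup>2))
      \<le> norm ((1 + fact k / (s / 2) ^ k) * exp (- (s / 2) * (Rd_norm d y)\<^sup>2))"
  proof (intro always_eventually allI)
    fix y :: "nat \<Rightarrow> real"
    have "norm (Rd_norm d y ^ k * exp (- s * (Rd_norm d y)\<^sup>2)) = Rd_norm d y ^ k * exp (- s * (Rd_norm d y)\<^sup>2)"
      by simp
    also note power_gauss_bound[OF assms Rd_norm_nonneg[of d], of y k]
    finally show "norm (Rd_norm d y ^ k * exp (- s * (Rd_norm d y)\<^sup>2))
        \<le> norm ((1 + fact k / (s / 2) ^ k) * exp (- (s / 2) * (Rd_norm d y)\<^sup>2))"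
      unfolding real_norm_def by (rule order.trans) (rule abs_ge_self)
  qed
qed measurable

text \<open>Layer cake: a radial function is a superposition of indicators of balls, and by homogeneity
  the integral over every ball is a multiple of the one over the unit ball.\<close>

lemma integral_radial_homogeneous:
  fixes F :: "(nat \<Rightarrow> real) \<Rightarrow> 'b::{banach, second_countable_topology}"
  assumes [measurable]: "F \<in> borel_measurable (lb d)" "\<phi> \<in> borel_measurable borel"
    and hom: "\<And>t x. t > 0 \<Longrightarrow> x \<in> Rd d \<Longrightarrow> F (affine_map d (\<lambda>_. 0) t x) = t ^ k *\<^sub>R F x"
    and int_ball: "integrable (lb d) (\<lambda>y. indicator {y. Rd_norm d y < 1} y *\<^sub>R F y)"
    and int_phi: "integrable lborel (\<lambda>u. indicator {0<..} u * (u powr (real (d + k) / 2) * \<phi> u))"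
  shows "(\<integral>y. (\<integral>u. indicator {(Rd_norm d y)\<^sup>2<..} u * \<phi> u \<partial>lborel) *\<^sub>R F y \<partial>lb d)
    = (\<integral>u. indicator {0<..} u * (u powr (real (d + k) / 2) * \<phi> u) \<partial>lborel)
       *\<^sub>R (\<integral>y. indicator {y. Rd_norm d y < 1} y *\<^sub>R F y \<partial>lb d)"
proof -
  interpret lb: sigma_finite_measure "lb d" by (rule sigma_finite_lb)
  interpret pair_sigma_finite lborel "lb d" ..
  let ?M = "real (d + k) / 2"
  let ?g = "\<lambda>u y. (indicator {(Rd_norm d y)\<^sup>2<..} u * \<phi> u) *\<^sub>R F y"
  let ?I = "\<lambda>y. indicator {y. Rd_norm d y < 1} y :: real"
  \<comment> \<open>The indicator of the layer is read in two ways: as a half line in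
    \<open>u\<close> for the weight, and as a dilated unit ball in \<open>y\<close> for the
    homogeneity of \<open>F\<close>.\<close>
  have ind: "(indicator {(Rd_norm d y)\<^sup>2<..} u :: real) = indicator {0<..} u * indicator {y. Rd_norm d y < sqrt u} y" for u y
  proof -
    have "(Rd_norm d y)\<^sup>2 < u \<longleftrightarrow> Rd_norm d y < sqrt u"
      using real_sqrt_less_iff[of "(Rd_norm d y)\<^sup>2" u] by simp
    moreover have "0 < u" if "(Rd_norm d y)\<^sup>2 < u"
      using that zero_le_power2[of "Rd_norm d y"] by linarith
    ultimately show ?thesis by (auto simp: indicator_def)
  qed
  have scal: "?g (u) (affine_map d (\<lambda>_. 0) (sqrt u) y) = (indicator {0<..} u * sqrt u ^ k * \<phi> u) *\<^sub>R (?I y *\<^sub>R F y)"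
    if "y \<in> Rd d" for u y
  proof (cases "u > 0")
    case True
    then have "sqrt u * Rd_norm d y < sqrt u \<longleftrightarrow> Rd_norm d y < 1" by simp
    then show ?thesis using True hom[of "sqrt u" y] that
      unfolding ind by (simp add: Rd_norm_affine_map indicator_def)
  qed (simp add: ind)
  have [measurable]: "case_prod ?g \<in> borel_measurable (lborel \<Otimes>\<^sub>M lb d)"
    unfolding ind by measurable
  have int1: "integrable (lb d) (?g u)" for u
  proof (cases "u > 0")
    case True
    have "integrable (lb d) (\<lambda>y. ?g u (affine_map d (\<lambda>_. 0) (sqrt u) y))"
      by (subst Bochner_Integration.integrable_cong[OF refl, OF scal]) (use integrable_scaleR_right[OF int_ball] in \<open>auto simp: space_lb simp del: scaleR_scaleR\<close>)
    \<comment> \<open>Undoing the dilation carries integrability from the unit ball back to the ball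
      of radius \<open>sqrt u\<close>.\<close>
    then have "integrable (lb d) (\<lambda>y. ?g u (affine_map d (\<lambda>_. 0) (sqrt u) (affine_map d (\<lambda>_. 0) (inverse (sqrt u)) y)))"
      using True by (intro integrable_lb_affine[where f = "\<lambda>y. ?g u (affine_map d (\<lambda>_. 0) (sqrt u) y)"]) auto
    moreover have "affine_map d (\<lambda>_. 0) (sqrt u) (affine_map d (\<lambda>_. 0) (inverse (sqrt u)) y) = y" if "y \<in> Rd d" for y
      using True that by (auto simp: affine_map_def Rd_def fun_eq_iff PiE_iff extensional_def)
    ultimately show ?thesis
      by (subst Bochner_Integration.integrable_cong[OF refl]) (auto simp: space_lb)
  qed (simp add: ind)
  \<comment> \<open>\<open>sqrt u ^ d\<close> is the Jacobian of the dilation and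
    \<open>sqrt u ^ k\<close> comes from the homogeneity of \<open>F\<close>.\<close>
  have sq: "sqrt u ^ d * sqrt u ^ k = u powr ?M" if "u > 0" for u
    using that by (simp add: power_add[symmetric] powr_half_sqrt[symmetric] powr_power add_divide_distrib powr_add)
  have inner: "(\<integral>y. ?g u y \<partial>lb d) = (indicator {0<..} u * (u powr ?M * \<phi> u)) *\<^sub>R (\<integral>y. ?I y *\<^sub>R F y \<partial>lb d)" for u
  proof (cases "u > 0")
    case True
    have "(\<integral>y. ?g u y \<partial>lb d) = sqrt u ^ d *\<^sub>R (\<integral>y. ?g u (affine_map d (\<lambda>_. 0) (sqrt u) y) \<partial>lb d)"
      using True integral_lb_affine[of "sqrt u" "?g u" d "\<lambda>_. 0"] by simp
    also have "\<dots> = sqrt u ^ d *\<^sub>R (\<integral>y. (sqrt u ^ k * \<phi> u) *\<^sub>R (?I y *\<^sub>R F y) \<partial>lb d)"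
      using True by (subst Bochner_Integration.integral_cong[OF refl, OF scal]) (auto simp: space_lb)
    also have "\<dots> = sqrt u ^ d *\<^sub>R (sqrt u ^ k * \<phi> u) *\<^sub>R (\<integral>y. ?I y *\<^sub>R F y \<partial>lb d)"
      by (subst integral_scaleR_right) (auto intro: int_ball)
    finally show ?thesis using True sq[OF True] by (simp add: mult.assoc[symmetric])
  qed (simp add: ind)
  have inner_norm: "(\<integral>y. norm (?g u y) \<partial>lb d) = (indicator {0<..} u * (u powr ?M * \<bar>\<phi> u\<bar>)) * (\<integral>y. norm (?I y *\<^sub>R F y) \<partial>lb d)" for u
  proof (cases "u > 0")
    case True
    have "(\<integral>y. norm (?g u y) \<partial>lb d) = sqrt u ^ d *\<^sub>R (\<integral>y. norm (?g u (affine_map d (\<lambda>_. 0) (sqrt u) y)) \<partial>lb d)"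
      using True integral_lb_affine[OF _ borel_measurable_integrable[OF integrable_norm[OF int1[of u]]], of "sqrt u" "\<lambda>_. 0"]
      by (simp only: abs_of_nonneg real_sqrt_ge_zero less_imp_le real_sqrt_eq_zero_cancel_iff less_irrefl not_False_eq_True)
    also have "\<dots> = sqrt u ^ d *\<^sub>R (\<integral>y. (sqrt u ^ k * \<bar>\<phi> u\<bar>) *\<^sub>R norm (?I y *\<^sub>R F y) \<partial>lb d)"
      using True by (subst Bochner_Integration.integral_cong[OF refl, OF arg_cong[OF scal, of _ norm]])
        (auto simp: space_lb abs_mult mult.assoc)
    also have "\<dots> = sqrt u ^ d *\<^sub>R (sqrt u ^ k * \<bar>\<phi> u\<bar>) *\<^sub>R (\<integral>y. norm (?I y *\<^sub>R F y) \<partial>lb d)"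
      by (simp add: mult.assoc)
    finally show ?thesis using True sq[OF True] by simp
  qed (simp add: ind)
  have "integrable lborel (\<lambda>u. \<integral>y. norm (?g u y) \<partial>lb d)"
    unfolding inner_norm using integrable_norm[OF int_phi]
    by (intro integrable_mult_left) (simp add: abs_mult)
  then have int2: "integrable (lborel \<Otimes>\<^sub>M lb d) (case_prod ?g)"
    using int1 by (intro Fubini_integrable) auto
  have "(\<integral>y. (\<integral>u. indicator {(Rd_norm d y)\<^sup>2<..} u * \<phi> u \<partial>lborel) *\<^sub>R F y \<partial>lb d)
      = (\<integral>y. (\<integral>u. ?g u y \<partial>lborel) \<partial>lb d)"
  proof (rule integral_cong_AE)
    show "AE y in lb d. (\<integral>u. indicator {(Rd_norm d y)\<^sup>2<..} u * \<phi> u \<partial>lborel) *\<^sub>R F y = (\<integral>u. ?g u y \<partial>lborel)"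
      using AE_integrable_snd[OF int2]
    proof eventually_elim
      case (elim y)
      show ?case
      \<comment> \<open>Fubini gives integrability only of the product with \<open>F y\<close>, so
        the scalar factor is recovered by dividing by \<open>norm (F y)\<close>; where
        \<open>F y = 0\<close> both sides vanish.\<close>
      proof (cases "F y = 0")
        case False
        from integrable_norm[OF elim] False
        have "integrable lborel (\<lambda>u. norm (indicator {(Rd_norm d y)\<^sup>2<..} u * \<phi> u) * norm (F y))"
          by simp
        from integrable_mult_left[OF this, of "1 / norm (F y)"] False
        have "integrable lborel (\<lambda>u. norm (indicator {(Rd_norm d y)\<^sup>2<..} u * \<phi> u))" by simp
        then have "integrable lborel (\<lambda>u. indicator {(Rd_norm d y)\<^sup>2<..} u * \<phi> u)"
          by (subst (asm) integrable_norm_iff) auto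
        then show ?thesis by simp
      qed simp
    qed
  qed (auto simp: ind)
  also have "\<dots> = (\<integral>u. (\<integral>y. ?g u y \<partial>lb d) \<partial>lborel)"
    by (rule Fubini_integral[OF int2])
  also have "\<dots> = (\<integral>u. indicator {0<..} u * (u powr ?M * \<phi> u) \<partial>lborel) *\<^sub>R (\<integral>y. ?I y *\<^sub>R F y \<partial>lb d)"
    unfolding inner using int_phi by simp
  finally show ?thesis .
qed

text \<open>With \<open>a = (Rd_norm d y)\<^sup>2\<close> this is the weight that makes the layer
  cake formula produce a Gaussian.\<close>

lemma has_bochner_integral_exp_tail:
  fixes s a :: real
  assumes "s > 0"
  shows "has_bochner_integral lborel (\<lambda>u. indicator {a<..} u * (s * exp (- s * u))) (exp (- s * a))"
proof -
  have "has_bochner_integral lborel (\<lambda>u. indicator {0<..} u * (u powr (1 - 1) * exp (- s * u))) (Gamma 1 / s powr 1)"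
    using has_bochner_integral_Gamma[of 1 s] assms by simp
  also have "(\<lambda>u::real. indicator {0<..} u * (u powr (1 - 1) * exp (- s * u))) = (\<lambda>u. indicator {0<..} u * exp (- s * u))"
    by (auto simp: indicator_def)
  finally have "has_bochner_integral lborel (\<lambda>u::real. indicator {0<..} u * exp (- s * u)) (1 / s)"
    using assms by simp
  from lborel_has_bochner_integral_real_affine_iff[THEN iffD1, OF _ this, of 1 "-a"]
  have "has_bochner_integral lborel (\<lambda>u. indicator {0<..} (u - a) * exp (- s * (u - a))) (1 / s)" by simp
  from has_bochner_integral_mult_right[OF this, of "s * exp (- s * a)"]
  show ?thesis using assms
    by (elim has_bochner_integral_cong[THEN iffD1, rotated -1]) (auto simp: indicator_def exp_add[symmetric] algebra_simps)
qed

text \<open>The layer cake formula with the exponential weight. It takes the place of polar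
  coordinates and serves to pass from Gaussians, where integrals are explicit, to the unit
  ball.\<close>

lemma integral_homogeneous_gauss:
  fixes F :: "(nat \<Rightarrow> real) \<Rightarrow> 'b::{banach, second_countable_topology}"
  assumes [measurable]: "F \<in> borel_measurable (lb d)"
    and hom: "\<And>t x. t > 0 \<Longrightarrow> x \<in> Rd d \<Longrightarrow> F (affine_map d (\<lambda>_. 0) t x) = t ^ k *\<^sub>R F x"
    and int_ball: "integrable (lb d) (\<lambda>y. indicator {y. Rd_norm d y < 1} y *\<^sub>R F y)"
    and s: "s > 0"
  shows "(\<integral>y. exp (- s * (Rd_norm d y)\<^sup>2) *\<^sub>R F y \<partial>lb d)
    = (Gamma (real (d + k) / 2 + 1) / s powr (real (d + k) / 2)) *\<^sub>R (\<integral>y. indicator {y. Rd_norm d y < 1} y *\<^sub>R F y \<partial>lb d)"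
proof -
  let ?M = "real (d + k) / 2"
  have g: "has_bochner_integral lborel (\<lambda>u. indicator {0<..} u * (u powr ?M * (s * exp (- s * u)))) (s * (Gamma (?M + 1) / s powr (?M + 1)))"
    using has_bochner_integral_mult_right[OF has_bochner_integral_Gamma[of "?M + 1" s], of s] s
    by (simp add: mult_ac add_nonneg_pos)
  have "(\<integral>y. (\<integral>u. indicator {(Rd_norm d y)\<^sup>2<..} u * (s * exp (- s * u)) \<partial>lborel) *\<^sub>R F y \<partial>lb d)
      = (\<integral>u. indicator {0<..} u * (u powr ?M * (s * exp (- s * u))) \<partial>lborel) *\<^sub>R (\<integral>y. indicator {y. Rd_norm d y < 1} y *\<^sub>R F y \<partial>lb d)"
    using g by (intro integral_radial_homogeneous hom int_ball) (auto simp: has_bochner_integral_iff)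
  then show ?thesis
    unfolding has_bochner_integral_integral_eq[OF has_bochner_integral_exp_tail[OF s]]
      has_bochner_integral_integral_eq[OF g] using s by (simp add: powr_add)
qed

section \<open>Explicit radial integrals\<close>

lemma integrable_unit_ball: "integrable (lb d) (indicator {y. Rd_norm d y < 1} :: _ \<Rightarrow> real)"
proof (rule Bochner_Integration.integrable_bound)
  show "integrable (lb d) (\<lambda>y. exp 1 * exp (- 1 * (Rd_norm d y)\<^sup>2))"
    using has_bochner_integral_gauss_lb[of 1 d] by (intro integrable_mult_right) (simp add: has_bochner_integral_iff)
  show "AE x in lb d. norm (indicator {y. Rd_norm d y < 1} x :: real) \<le> norm (exp 1 * exp (- 1 * (Rd_norm d x)\<^sup>2))"
  proof (intro always_eventually allI)
    fix x
    have "(Rd_norm d x)\<^sup>2 \<le> 1" if "Rd_norm d x < 1" using that by (intro power_le_one) auto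
    then show "norm (indicator {y. Rd_norm d y < 1} x :: real) \<le> norm (exp 1 * exp (- 1 * (Rd_norm d x)\<^sup>2))"
      by (auto simp: indicator_def exp_add[symmetric])
  qed
qed measurable

lemma integrable_unit_ball_bounded:
  fixes F :: "(nat \<Rightarrow> real) \<Rightarrow> 'b::{banach, second_countable_topology}"
  assumes [measurable]: "F \<in> borel_measurable (lb d)"
    and b: "\<And>x. x \<in> Rd d \<Longrightarrow> norm (F x) \<le> B * Rd_norm d x ^ k"
  shows "integrable (lb d) (\<lambda>y. indicator {y. Rd_norm d y < 1} y *\<^sub>R F y)"
proof (rule Bochner_Integration.integrable_bound)
  show "integrable (lb d) (\<lambda>y. indicator {y. Rd_norm d y < 1} y * \<bar>B\<bar>)"
    using integrable_unit_ball by (rule integrable_mult_left)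
  show "AE x in lb d. norm (indicator {y. Rd_norm d y < 1} x *\<^sub>R F x) \<le> norm (indicator {y. Rd_norm d y < 1} x * \<bar>B\<bar>)"
  proof (rule AE_I2)
    fix x assume x: "x \<in> space (lb d)"
    have "norm (F x) \<le> \<bar>B\<bar>" if "Rd_norm d x < 1"
    proof -
      have "norm (F x) \<le> B * Rd_norm d x ^ k" using b x by (simp add: space_lb)
      also have "\<dots> \<le> \<bar>B\<bar> * 1"
        using that by (intro mult_mono power_le_one) auto
      finally show ?thesis by simp
    qed
    then show "norm (indicator {y. Rd_norm d y < 1} x *\<^sub>R F x) \<le> norm (indicator {y. Rd_norm d y < 1} x * \<bar>B\<bar>)"
      by (auto simp: indicator_def)
  qed
qed measurable

lemma unit_ball_volume:
  "(\<integral>y. indicator {y. Rd_norm d y < 1} y \<partial>lb d) = pi powr (d / 2) / Gamma (d / 2 + 1)"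
proof -
  have "(\<integral>y. exp (- 1 * (Rd_norm d y)\<^sup>2) *\<^sub>R (1::real) \<partial>lb d)
    = (Gamma (real (d + 0) / 2 + 1) / 1 powr (real (d + 0) / 2)) *\<^sub>R (\<integral>y. indicator {y. Rd_norm d y < 1} y *\<^sub>R (1::real) \<partial>lb d)"
    using integrable_unit_ball
    by (intro integral_homogeneous_gauss[where F = "\<lambda>_. 1::real" and k = 0 and s = 1 and d = d]) auto
  moreover have "(\<integral>y. exp (- 1 * (Rd_norm d y)\<^sup>2) *\<^sub>R (1::real) \<partial>lb d) = pi powr (d / 2)"
    using has_bochner_integral_gauss_lb[of 1 d] by (simp add: has_bochner_integral_iff)
  moreover have "Gamma (real d / 2 + 1) \<noteq> 0"
    by (rule less_imp_neq[symmetric, OF Gamma_real_pos]) simp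
  ultimately show ?thesis by (simp add: eq_divide_eq mult.commute)
qed

text \<open>The weight is minus the derivative of \<open>u powr a * exp (- s * u)\<close>. With
  \<open>x = (Rd_norm d y)\<^sup>2\<close> and \<open>a = k / 2\<close> its tails rebuild
  \<open>Rd_norm d y ^ k * exp (- s * (Rd_norm d y)\<^sup>2)\<close>.\<close>

lemma integral_powr_exp_tail:
  fixes a s x :: real
  assumes a: "a > 0" and s: "s > 0" and x: "x \<ge> 0"
  shows "(\<integral>u. indicator {x<..} u * ((s * u powr a - a * u powr (a - 1)) * exp (- s * u)) \<partial>lborel) = x powr a * exp (- s * x)"
proof -
  let ?f = "\<lambda>u. (s * u powr a - a * u powr (a - 1)) * exp (- s * u)"
  let ?F = "\<lambda>u. - (u powr a * exp (- s * u))"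
  have 1: "integrable lborel (\<lambda>u. indicator {0<..} u * ?f u)"
  proof -
    have "integrable lborel (\<lambda>u. s * (indicator {0<..} u * (u powr (a + 1 - 1) * exp (- s * u))) 
        - a * (indicator {0<..} u * (u powr (a - 1) * exp (- s * u))))"
      using has_bochner_integral_Gamma[of "a + 1" s] has_bochner_integral_Gamma[of a s] a s
      by (intro Bochner_Integration.integrable_diff integrable_mult_right) (auto simp: has_bochner_integral_iff)
    also have "(\<lambda>u. s * (indicator {0<..} u * (u powr (a + 1 - 1) * exp (- s * u))) 
        - a * (indicator {0<..} u * (u powr (a - 1) * exp (- s * u)))) = (\<lambda>u. indicator {0<..} u * ?f u)"
      by (auto simp: fun_eq_iff algebra_simps)
    finally show ?thesis .
  qed
  have einter: "einterval (ereal x) \<infinity> = {x<..}" by (auto simp: einterval_def)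
  have "integrable lborel (\<lambda>u. indicator {x<..} u * (indicator {0<..} u * ?f u))"
    using integrable_mult_indicator[OF _ 1, of "{x<..}"] by simp
  then have si: "set_integrable lborel (einterval (ereal x) \<infinity>) ?f"
    unfolding set_integrable_def einter using x
    by (subst Bochner_Integration.integrable_cong[OF refl]) (auto simp: indicator_def)
  have "(LBINT u=ereal x..\<infinity>. ?f u) = 0 - ?F x"
  proof (rule interval_integral_FTC_integrable[where F = ?F and f = ?f, OF _ _ _ si])
    fix u assume "ereal x < ereal u"
    then have u: "u > 0" using x by simp
    show "(?F has_vector_derivative ?f u) (at u)"
      unfolding has_real_derivative_iff_has_vector_derivative[symmetric]
      using u by (auto intro!: derivative_eq_intros simp: algebra_simps powr_diff)
    show "isCont ?f u" using u by (auto intro!: continuous_intros)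
  next
    have "continuous_on {0..} ?F" using a by (intro continuous_intros continuous_on_powr') auto
    then have "(?F \<longlongrightarrow> ?F x) (at x within {0..})" using x by (auto simp: continuous_on_def)
    then have "(?F \<longlongrightarrow> ?F x) (at x within {x<..})"
      by (rule tendsto_within_subset) (use x in auto)
    then show "((?F \<circ> real_of_ereal) \<longlongrightarrow> ?F x) (at_right (ereal x))"
      by (simp add: ereal_tendsto_simps)
    have "(?F \<longlongrightarrow> 0) at_top" using a s by real_asymp
    then show "((?F \<circ> real_of_ereal) \<longlongrightarrow> 0) (at_left \<infinity>)"
      by (simp add: ereal_tendsto_simps)
  qed simp
  then show ?thesis
    by (simp add: interval_lebesgue_integral_def set_lebesgue_integral_def einter)
qed

text \<open>The layer cake formula is applied to the constant function 1 with the weight of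
  \<open>integral_powr_exp_tail\<close>, so that only the volume of the unit ball enters. Dimension
  0 is excluded because \<open>Gamma 0\<close> is 0 by convention.\<close>

lemma integral_norm_power_gauss:
  fixes s :: real
  assumes d: "d > 0" and s: "s > 0"
  shows "(\<integral>y. Rd_norm d y ^ k * exp (- s * (Rd_norm d y)\<^sup>2) \<partial>lb d)
    = pi powr (d / 2) * Gamma (real (d + k) / 2) / (Gamma (d / 2) * s powr (real (d + k) / 2))"
proof (cases "k = 0")
  case True
  have "Gamma (real d / 2) > 0" using d by (intro Gamma_real_pos) simp
  then show ?thesis
    using True has_bochner_integral_gauss_lb[of s d] s by (simp add: has_bochner_integral_iff powr_divide)
next
  case False
  let ?m = "real d / 2" and ?a = "real k / 2" and ?M = "real (d + k) / 2"
  let ?\<phi> = "\<lambda>u. (s * u powr ?a - ?a * u powr (?a - 1)) * exp (- s * u)"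
  have M: "?M = ?m + ?a" by (simp add: add_divide_distrib)
  have pos: "?m > 0" "?a > 0" using d False by auto
  have M1: "?M + 1 > 0" "?M > 0" using pos M by linarith+
  have "has_bochner_integral lborel (\<lambda>u. s * (indicator {0<..} u * (u powr (?M + 1 - 1) * exp (- s * u))) 
        - ?a * (indicator {0<..} u * (u powr (?M - 1) * exp (- s * u)))) 
     (s * (Gamma (?M + 1) / s powr (?M + 1)) - ?a * (Gamma ?M / s powr ?M))"
    using M1 s by (intro has_bochner_integral_diff has_bochner_integral_mult_right has_bochner_integral_Gamma)
  moreover have "s * (indicator {0<..} u * (u powr (?M + 1 - 1) * exp (- s * u))) 
        - ?a * (indicator {0<..} u * (u powr (?M - 1) * exp (- s * u))) 
       = indicator {0<..} u * (u powr ?m * ?\<phi> u)" for u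
    unfolding M powr_add powr_diff by (auto simp: indicator_def algebra_simps)
  \<comment> \<open>With \<open>M = m + a\<close> one has
    \<open>Gamma (M + 1) - a * Gamma M = m * Gamma M\<close>; the factor \<open>m\<close> cancels
    later against \<open>Gamma (m + 1) = m * Gamma m\<close> in the volume of the ball.\<close>
  moreover have "s * (Gamma (?M + 1) / s powr (?M + 1)) - ?a * (Gamma ?M / s powr ?M) = ?m * Gamma ?M / s powr ?M"
  proof -
    have "s * (Gamma (z + 1) / s powr (z + 1)) - b * (Gamma z / s powr z) = c * Gamma z / s powr z"
      if "z = c + b" "z > 0" for z b c :: real
    proof -
      have "z \<notin> \<int>\<^sub>\<le>\<^sub>0" using that nonpos_Ints_nonpos[of z] by (meson not_le)
      then have "Gamma (z + 1) = (c + b) * Gamma z" using Gamma_plus1[of z] that by simp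
      then show ?thesis using s by (simp add: powr_add field_simps)
    qed
    then show ?thesis using M M1 by blast
  qed
  ultimately have g: "has_bochner_integral lborel (\<lambda>u. indicator {0<..} u * (u powr ?m * ?\<phi> u)) (?m * Gamma ?M / s powr ?M)"
    by simp
  have "(\<integral>y. (\<integral>u. indicator {(Rd_norm d y)\<^sup>2<..} u * ?\<phi> u \<partial>lborel) *\<^sub>R (1::real) \<partial>lb d)
    = (\<integral>u. indicator {0<..} u * (u powr (real (d + 0) / 2) * ?\<phi> u) \<partial>lborel)
       *\<^sub>R (\<integral>y. indicator {y. Rd_norm d y < 1} y *\<^sub>R (1::real) \<partial>lb d)"
    by (rule integral_radial_homogeneous) (use integrable_unit_ball g in \<open>auto simp: has_bochner_integral_iff\<close>)
  also have "(\<lambda>y. (\<integral>u. indicator {(Rd_norm d y)\<^sup>2<..} u * ?\<phi> u \<partial>lborel)) = (\<lambda>y. Rd_norm d y ^ k * exp (- s * (Rd_norm d y)\<^sup>2))"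
  proof
    fix y
    have "((Rd_norm d y)\<^sup>2) powr ?a = Rd_norm d y ^ k"
    proof (cases "Rd_norm d y = 0")
      case False
      then have "Rd_norm d y > 0" using Rd_norm_nonneg[of d y] by linarith
      then show ?thesis by (rule Rd_norm_power2_powr) simp
    qed (use \<open>k \<noteq> 0\<close> in simp)
    then show "(\<integral>u. indicator {(Rd_norm d y)\<^sup>2<..} u * ?\<phi> u \<partial>lborel) = Rd_norm d y ^ k * exp (- s * (Rd_norm d y)\<^sup>2)"
      using integral_powr_exp_tail[of ?a s "(Rd_norm d y)\<^sup>2"] pos s by simp
  qed
  finally have "(\<integral>y. Rd_norm d y ^ k * exp (- s * (Rd_norm d y)\<^sup>2) \<partial>lb d) 
     = ?m * Gamma ?M / s powr ?M * (pi powr ?m / Gamma (?m + 1))"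
    using g unit_ball_volume[of d] by (simp add: has_bochner_integral_integral_eq)
  moreover have "Gamma (?m + 1) = ?m * Gamma ?m"
    using pos nonpos_Ints_nonpos[of ?m] by (intro Gamma_plus1) (meson not_le)
  ultimately show ?thesis using pos by (simp only:) (simp add: mult_ac)
qed

section \<open>Gaussian integrals with a complex parameter\<close>

lemma norm_powr_of_real:
  fixes z :: complex
  assumes "z \<noteq> 0"
  shows "norm (z powr of_real x) = norm z powr x"
  using assms by (simp add: powr_def)

lemma exp_sums:
  fixes z :: complex
  shows "(\<lambda>n. z ^ n / fact n) sums exp z"
  using exp_converges[of z] by (simp add: scaleR_conv_of_real divide_inverse mult.commute)

text \<open>The case of real \<open>\<tau>\<close> is continued to the right half plane by one power series: for
  real \<open>r = |\<tau>|\<^sup>2 / Re \<tau>\<close> the disc around \<open>r\<close> of radius \<open>r\<close> contains \<open>\<tau>\<close>, and expanding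
  \<open>exp ((r - \<tau>) q)\<close> produces the binomial series of \<open>\<tau> powr - M\<close>.\<close>

lemma norm_integral_norm_power_gauss_complex:
  fixes \<tau> :: complex
  assumes d: "d > 0" and \<tau>: "Re \<tau> > 0"
  shows "norm (\<integral>y. of_real (Rd_norm d y ^ k) * exp (- \<tau> * of_real ((Rd_norm d y)\<^sup>2)) \<partial>lb d)
    = pi powr (d / 2) * Gamma (real (d + k) / 2) / Gamma (d / 2) * norm \<tau> powr (- (real (d + k) / 2))"
proof -
  define r where "r = (norm \<tau>)\<^sup>2 / Re \<tau>"
  define \<kappa> where "\<kappa> = pi powr (d / 2) / Gamma (d / 2)"
  define M where "M = real (d + k) / 2"
  have \<tau>0: "\<tau> \<noteq> 0" using \<tau> by auto
  have r: "r > 0" using \<tau> \<tau>0 by (simp add: r_def)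
  have M: "M > 0" using d by (simp add: M_def)
  have close: "norm (of_real r - \<tau>) < r"
  proof -
    have "(norm (of_real r - \<tau>))\<^sup>2 = r\<^sup>2 - 2 * r * Re \<tau> + (norm \<tau>)\<^sup>2"
      unfolding cmod_power2 by (simp add: power2_eq_square algebra_simps)
    also have "\<dots> = r\<^sup>2 - (norm \<tau>)\<^sup>2" using \<tau> by (simp add: r_def)
    also have "\<dots> < r\<^sup>2" using \<tau>0 by simp
    finally show ?thesis using r by (simp add: power2_less_imp_less)
  qed
  define t where "t n y = of_real (Rd_norm d y ^ k * exp (- r * (Rd_norm d y)\<^sup>2))
     * (((of_real r - \<tau>) * of_real ((Rd_norm d y)\<^sup>2)) ^ n / fact n)" for n y
  have t_eq: "t n y = (of_real r - \<tau>) ^ n / fact n * of_real (Rd_norm d y ^ (k + 2 * n) * exp (- r * (Rd_norm d y)\<^sup>2))" for n y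
    by (simp add: t_def power_mult_distrib power_mult power_add)
  have t_int: "integrable (lb d) (t n)" for n
    unfolding t_eq[abs_def] using integrable_norm_power_gauss[OF r, of d "k + 2 * n"]
    by (intro integrable_mult_right integrable_of_real)
  \<comment> \<open>The moments of order \<open>k + 2 * n\<close> at the real parameter
    \<open>r\<close> produce \<open>pochhammer M n / fact n\<close>, which up to sign is the
    generalised binomial coefficient of \<open>- M\<close>.\<close>
  have t_val: "(\<integral>y. t n y \<partial>lb d) = of_real \<kappa> * of_real (Gamma M * r powr (- M)) * ((of_real (- M) gchoose n) * ((\<tau> - of_real r) / of_real r) ^ n)" for n
  proof -
    have "(\<integral>y. t n y \<partial>lb d) = (of_real r - \<tau>) ^ n / fact n * of_real (\<kappa> * Gamma (M + n) / r powr (M + n))"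
      unfolding t_eq[abs_def] integral_mult_right_zero integral_complex_of_real integral_norm_power_gauss[OF d r, of "k + 2 * n"]
      by (simp add: \<kappa>_def M_def add_divide_distrib algebra_simps)
    also have "Gamma (M + n) = pochhammer M n * Gamma M"
    proof -
      have "M \<notin> \<int>\<^sub>\<le>\<^sub>0" using M nonpos_Ints_nonpos[of M] by (meson not_le)
      moreover have "Gamma M > 0" using M by (rule Gamma_real_pos)
      ultimately show ?thesis by (simp add: pochhammer_Gamma)
    qed
    also have "of_real (\<kappa> * (pochhammer M n * Gamma M) / r powr (M + n)) = 
      (of_real \<kappa> * of_real (Gamma M * r powr (- M))) * (of_real (pochhammer M n) / of_real r ^ n :: complex)"
      using r by (simp add: powr_add powr_minus powr_realpow divide_simps)
    also have "(of_real r - \<tau>) ^ n = (-1) ^ n * (\<tau> - of_real r) ^ n"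
      by (simp add: power_mult_distrib[symmetric])
    also have "(-1) ^ n * (\<tau> - of_real r) ^ n / fact n * (of_real \<kappa> * of_real (Gamma M * r powr (- M)) * (of_real (pochhammer M n) / of_real r ^ n))
      = of_real \<kappa> * of_real (Gamma M * r powr (- M)) * (((-1) ^ n * of_real (pochhammer M n) / fact n) * ((\<tau> - of_real r) / of_real r) ^ n)"
      by (simp add: power_divide)
    also have "(-1) ^ n * of_real (pochhammer M n) / fact n = (of_real (- M) gchoose n :: complex)"
      by (simp add: gbinomial_pochhammer pochhammer_of_real)
    finally show ?thesis .
  qed
  have sums_t: "(\<lambda>n. t n y) sums (of_real (Rd_norm d y ^ k) * exp (- \<tau> * of_real ((Rd_norm d y)\<^sup>2)))" for y
  proof -
    let ?q = "of_real ((Rd_norm d y)\<^sup>2) :: complex"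
    have "(\<lambda>n. ((of_real r - \<tau>) * ?q) ^ n / fact n) sums exp ((of_real r - \<tau>) * ?q)"
      by (rule exp_sums)
    then have "(\<lambda>n. t n y) sums (of_real (Rd_norm d y ^ k * exp (- r * (Rd_norm d y)\<^sup>2)) * exp ((of_real r - \<tau>) * ?q))"
      unfolding t_def by (rule sums_mult)
    also have "of_real (Rd_norm d y ^ k * exp (- r * (Rd_norm d y)\<^sup>2)) * exp ((of_real r - \<tau>) * ?q)
      = of_real (Rd_norm d y ^ k) * (exp (of_real (- r * (Rd_norm d y)\<^sup>2)) * exp ((of_real r - \<tau>) * ?q))"
      unfolding exp_of_real by (simp only: of_real_mult mult.assoc)
    also have "\<dots> = of_real (Rd_norm d y ^ k) * exp (- \<tau> * ?q)"
      by (simp add: exp_add[symmetric] algebra_simps)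
    finally show ?thesis .
  qed
  \<comment> \<open>The partial sums are dominated by replacing \<open>r - \<tau>\<close> with its
    norm; since \<open>\<rho> < r\<close>, a Gaussian with the positive parameter
    \<open>r - \<rho>\<close> is left over.\<close>
  define \<rho> where "\<rho> = norm (of_real r - \<tau>)"
  have lim: "(\<lambda>N. \<integral>y. (\<Sum>n<N. t n y) \<partial>lb d) \<longlonglongrightarrow> (\<integral>y. of_real (Rd_norm d y ^ k) * exp (- \<tau> * of_real ((Rd_norm d y)\<^sup>2)) \<partial>lb d)"
  proof (rule integral_dominated_convergence[where w = "\<lambda>y. Rd_norm d y ^ k * exp (- (r - \<rho>) * (Rd_norm d y)\<^sup>2)"])
    show "integrable (lb d) (\<lambda>y. Rd_norm d y ^ k * exp (- (r - \<rho>) * (Rd_norm d y)\<^sup>2))"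
      using close by (intro integrable_norm_power_gauss) (simp add: \<rho>_def)
    show "AE y in lb d. (\<lambda>N. \<Sum>n<N. t n y) \<longlonglongrightarrow> of_real (Rd_norm d y ^ k) * exp (- \<tau> * of_real ((Rd_norm d y)\<^sup>2))"
      using sums_t by (simp add: sums_def)
    fix N
    show "AE y in lb d. norm (\<Sum>n<N. t n y) \<le> Rd_norm d y ^ k * exp (- (r - \<rho>) * (Rd_norm d y)\<^sup>2)"
    proof (intro always_eventually allI)
      fix y
      define q where "q = (Rd_norm d y)\<^sup>2"
      have "(\<Sum>n<N. (\<rho> * q) ^ n / fact n) \<le> exp (\<rho> * q)"
        using sum_le_suminf[of "\<lambda>i. (\<rho> * q) ^ i / fact i" "{..<N}"] summable_exp[of "\<rho> * q"]
        by (simp add: exp_def scaleR_conv_of_real divide_inverse mult.commute \<rho>_def q_def)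
      have "norm (\<Sum>n<N. t n y) \<le> (\<Sum>n<N. Rd_norm d y ^ k * exp (- r * q) * ((\<rho> * q) ^ n / fact n))"
        unfolding t_def by (intro order.trans[OF norm_sum] sum_mono)
          (simp add: norm_mult norm_divide norm_power \<rho>_def q_def)
      also have "\<dots> = Rd_norm d y ^ k * exp (- r * q) * (\<Sum>n<N. (\<rho> * q) ^ n / fact n)"
        by (simp add: sum_distrib_left)
      also have "\<dots> \<le> Rd_norm d y ^ k * exp (- r * q) * exp (\<rho> * q)"
        by (intro mult_left_mono) (use \<open>_ \<le> exp (\<rho> * q)\<close> in auto)
      also have "\<dots> = Rd_norm d y ^ k * exp (- (r - \<rho>) * q)"
        by (simp add: exp_add[symmetric] algebra_simps)
      finally show "norm (\<Sum>n<N. t n y) \<le> Rd_norm d y ^ k * exp (- (r - \<rho>) * (Rd_norm d y)\<^sup>2)"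
        by (simp add: q_def)
    qed
  qed (use t_int in \<open>auto simp: t_def[abs_def]\<close>)
  have "norm ((\<tau> - of_real r) / of_real r) < 1"
    using close r by (simp add: norm_divide norm_minus_commute)
  from gen_binomial_complex[OF this, of "of_real (- M)"]
  have "(\<lambda>n. (of_real (- M) gchoose n) * ((\<tau> - of_real r) / of_real r) ^ n) sums ((\<tau> / of_real r) powr of_real (- M))"
    using r by (simp add: diff_divide_distrib)
  from sums_mult[OF this, of "of_real \<kappa> * of_real (Gamma M * r powr (- M))"]
  have "(\<lambda>n. \<integral>y. t n y \<partial>lb d) sums (of_real \<kappa> * of_real (Gamma M * r powr (- M)) * (\<tau> / of_real r) powr of_real (- M))"
    unfolding t_val .
  then have "(\<lambda>N. \<integral>y. (\<Sum>n<N. t n y) \<partial>lb d) \<longlonglongrightarrow> (of_real \<kappa> * of_real (Gamma M * r powr (- M)) * (\<tau> / of_real r) powr of_real (- M))"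
    using t_int by (simp add: sums_def integral_sum)
  from LIMSEQ_unique[OF lim this]
  have "norm (\<integral>y. of_real (Rd_norm d y ^ k) * exp (- \<tau> * of_real ((Rd_norm d y)\<^sup>2)) \<partial>lb d)
    = norm (of_real \<kappa> :: complex) * norm (of_real (Gamma M * r powr (- M)) :: complex) * norm ((\<tau> / of_real r) powr of_real (- M))"
    by (simp only: norm_mult)
  also have "norm ((\<tau> / of_real r) powr of_real (- M)) = (norm \<tau> / r) powr (- M)"
    using r \<tau>0 by (subst norm_powr_of_real) (auto simp: norm_divide)
  also have "norm (of_real (Gamma M * r powr (- M)) :: complex) = Gamma M * r powr (- M)"
    unfolding norm_of_real abs_mult abs_of_pos[OF Gamma_real_pos[OF M]] by simp
  also have "norm (of_real \<kappa> :: complex) = \<kappa>"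
    unfolding norm_of_real \<kappa>_def using d by (intro abs_of_nonneg divide_nonneg_pos Gamma_real_pos) auto
  also have "\<kappa> * (Gamma M * r powr (- M)) * (norm \<tau> / r) powr (- M) = \<kappa> * Gamma M * norm \<tau> powr (- M)"
    using r by (simp add: powr_divide)
  finally show ?thesis by (simp only: \<kappa>_def M_def times_divide_eq_left)
qed

text \<open>This is the square root of \<open>pi / s\<close> with positive real part when
  \<open>Re s > 0\<close>. Leaving it as an integral avoids a choice of branch: only its norm and
  its values at positive reals are needed.\<close>

definition gauss_const :: "complex \<Rightarrow> complex" where
  "gauss_const s = (\<integral>y. exp (- s * of_real (y\<^sup>2)) \<partial>lborel)"

text \<open>The radial formula in dimension 1 with \<open>k = 0\<close>.\<close>

lemma norm_gauss_const:
  assumes "Re s > 0"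
  shows "norm (gauss_const s) = sqrt (pi / norm s)"
proof -
  have int: "integrable lborel (\<lambda>y. exp (- s * of_real (y\<^sup>2)))"
  proof (rule Bochner_Integration.integrable_bound)
    show "integrable lborel (\<lambda>y. exp (- Re s * y\<^sup>2))"
      using has_bochner_integral_gauss_real[OF assms] by (simp add: has_bochner_integral_iff)
    show "AE y in lborel. norm (exp (- s * of_real (y\<^sup>2))) \<le> norm (exp (- Re s * y\<^sup>2))"
      unfolding norm_exp_eq_Re by simp
  qed measurable
  have "s \<noteq> 0" using assms by auto
  have "has_bochner_integral (lb 1) (\<lambda>y. \<Prod>i<1. exp (- s * of_real ((y i)\<^sup>2))) (\<Prod>i<(1::nat). gauss_const s)"
    unfolding gauss_const_def by (rule has_bochner_integral_lb_prod) (rule int)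
  also have "(\<lambda>y. \<Prod>i<(1::nat). exp (- s * of_real ((y i)\<^sup>2))) = (\<lambda>y. of_real (Rd_norm 1 y ^ 0) * exp (- s * of_real ((Rd_norm 1 y)\<^sup>2)))"
    unfolding Rd_norm_power2 by (simp add: fun_eq_iff)
  finally have "norm (gauss_const s) = norm (\<integral>y. of_real (Rd_norm 1 y ^ 0) * exp (- s * of_real ((Rd_norm 1 y)\<^sup>2)) \<partial>lb 1)"
    by (simp only: has_bochner_integral_integral_eq) simp
  also have "\<dots> = pi powr (real 1 / 2) * Gamma (real (1 + 0) / 2) / Gamma (real 1 / 2) * norm s powr (- (real (1 + 0) / 2))"
    by (rule norm_integral_norm_power_gauss_complex) (use assms in auto)
  also have "\<dots> = pi powr (1 / 2) * norm s powr (- (1 / 2))"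
    by (simp add: Gamma_one_half_real)
  also have "\<dots> = sqrt (pi / norm s)"
    using \<open>s \<noteq> 0\<close> by (simp add: powr_minus_divide powr_half_sqrt real_sqrt_divide)
  finally show ?thesis .
qed

section \<open>Gaussian moments\<close>

definition gauss_moment :: "nat \<Rightarrow> complex \<Rightarrow> real \<Rightarrow> complex" where
  "gauss_moment n s w = (\<integral>y. of_real y ^ n * exp (- s * of_real (y\<^sup>2) + \<i> * of_real (w * y)) \<partial>lborel)"

lemma norm_gauss_wave_real:
  "norm (of_real y ^ n * exp (- s * of_real (y\<^sup>2) + \<i> * of_real (w * y))) = \<bar>y\<bar> ^ n * exp (- Re s * \<bar>y\<bar>\<^sup>2)"
  by (simp add: norm_mult norm_power)

lemma integrable_gauss_moment:
  assumes "Re s > 0"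
  shows "integrable lborel (\<lambda>y. of_real y ^ n * exp (- s * of_real (y\<^sup>2) + \<i> * of_real (w * y)))"
proof (rule Bochner_Integration.integrable_bound)
  show "integrable lborel (\<lambda>y. (1 + fact n / (Re s / 2) ^ n) * exp (- (Re s / 2) * y\<^sup>2))"
    using has_bochner_integral_gauss_real[of "Re s / 2"] assms
    by (intro integrable_mult_right) (simp add: has_bochner_integral_iff)
  show "AE y in lborel. norm (of_real y ^ n * exp (- s * of_real (y\<^sup>2) + \<i> * of_real (w * y)))
      \<le> norm ((1 + fact n / (Re s / 2) ^ n) * exp (- (Re s / 2) * y\<^sup>2))"
  proof (intro always_eventually allI)
    fix y :: real
    show "norm (of_real y ^ n * exp (- s * of_real (y\<^sup>2) + \<i> * of_real (w * y)))
      \<le> norm ((1 + fact n / (Re s / 2) ^ n) * exp (- (Re s / 2) * y\<^sup>2))"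
      unfolding norm_gauss_wave_real real_norm_def
      using order.trans[OF power_gauss_bound[OF assms abs_ge_zero, of y n] abs_ge_self] by (simp only: power2_abs)
  qed
qed measurable

text \<open>Integration by parts: the derivative of
  \<open>y ^ n * exp (- s * y\<^sup>2 + \<i> * w * y)\<close> has integral 0 over the line. For
  \<open>n = 0\<close> the truncated index \<open>n - 1\<close> is harmless, its coefficient being
  0.\<close>

lemma gauss_moment_Suc:
  assumes s: "Re s > 0"
  shows "2 * s * gauss_moment (Suc n) s w = \<i> * of_real w * gauss_moment n s w + of_nat n * gauss_moment (n - 1) s w"
proof -
  let ?E = "\<lambda>y::real. exp (- s * of_real (y\<^sup>2) + \<i> * of_real (w * y))"
  let ?F = "\<lambda>y::real. of_real y ^ n * ?E y"
  let ?f = "\<lambda>y::real. \<i> * of_real w * (of_real y ^ n * ?E y) + of_nat n * (of_real y ^ (n - 1) * ?E y) - 2 * s * (of_real y ^ Suc n * ?E y)"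
  have int: "integrable lborel ?f"
    by (intro Bochner_Integration.integrable_diff Bochner_Integration.integrable_add integrable_mult_right integrable_gauss_moment s)
  have lim0: "(?F \<longlongrightarrow> 0) F" if "filterlim (\<lambda>y::real. \<bar>y\<bar>) at_top F" for F
  proof (rule Lim_null_comparison)
    have "((\<lambda>y. (1 + fact n / (Re s / 2) ^ n) * exp (- (Re s / 2) * y\<^sup>2)) \<longlongrightarrow> 0) at_top"
      using s by real_asymp
    from filterlim_compose[OF this that]
    show "((\<lambda>y. (1 + fact n / (Re s / 2) ^ n) * exp (- (Re s / 2) * \<bar>y\<bar>\<^sup>2)) \<longlongrightarrow> 0) F" .
    show "\<forall>\<^sub>F y in F. norm (?F y) \<le> (1 + fact n / (Re s / 2) ^ n) * exp (- (Re s / 2) * \<bar>y\<bar>\<^sup>2)"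
      unfolding norm_gauss_wave_real using power_gauss_bound[OF s abs_ge_zero, of _ n]
      by (intro always_eventually allI)
  qed
  have "(LBINT y=-\<infinity>..\<infinity>. ?f y) = 0 - 0"
  proof (rule interval_integral_FTC_integrable[where F = ?F])
    fix x :: real
    have "((\<lambda>z. z ^ n * exp (- s * z\<^sup>2 + \<i> * (of_real w * z))) has_field_derivative ?f x) (at (of_real x))"
      by (auto intro!: derivative_eq_intros simp: algebra_simps power2_eq_square)
    from has_vector_derivative_real_field[OF this]
    show "(?F has_vector_derivative ?f x) (at x)" by simp
    show "isCont ?f x" by (intro continuous_intros)
  next
    show "set_integrable lborel (einterval (-\<infinity>) \<infinity>) ?f"
      using int by (simp add: set_integrable_def)
    have "filterlim (\<lambda>y::real. \<bar>y\<bar>) at_top at_bot" "filterlim (\<lambda>y::real. \<bar>y\<bar>) at_top at_top" by real_asymp+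
    then show "((?F \<circ> real_of_ereal) \<longlongrightarrow> 0) (at_right (-\<infinity>))" "((?F \<circ> real_of_ereal) \<longlongrightarrow> 0) (at_left \<infinity>)"
      using lim0 by (simp_all only: ereal_tendsto_simps)
  qed simp
  then have "(\<integral>y. ?f y \<partial>lborel) = 0"
    by (simp add: interval_lebesgue_integral_def set_lebesgue_integral_def)
  moreover have "(\<integral>y. ?f y \<partial>lborel) = \<i> * of_real w * gauss_moment n s w + of_nat n * gauss_moment (n - 1) s w - 2 * s * gauss_moment (Suc n) s w"
  proof -
    have J: "has_bochner_integral lborel (\<lambda>y. of_real y ^ j * ?E y) (gauss_moment j s w)" for j
      using integrable_gauss_moment[OF s] by (simp only: has_bochner_integral_iff gauss_moment_def)
    have "has_bochner_integral lborel ?f (\<i> * of_real w * gauss_moment n s w + of_nat n * gauss_moment (n - 1) s w - 2 * s * gauss_moment (Suc n) s w)"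
      by (intro has_bochner_integral_diff has_bochner_integral_add has_bochner_integral_mult_right J)
    then show ?thesis by (rule has_bochner_integral_integral_eq)
  qed
  ultimately show ?thesis by simp
qed

text \<open>Expanding the wave in powers of \<open>w\<close> reduces the Fourier transform of the
  Gaussian to its moments at \<open>w = 0\<close>, which the recursion yields. No contour has to be
  shifted, so a complex \<open>s\<close> is treated like a real one.\<close>

lemma gauss_moment_0:
  assumes s: "Re s > 0"
  shows "gauss_moment 0 s w = gauss_const s * exp (- of_real (w\<^sup>2) / (4 * s))"
proof -
  have s0: "s \<noteq> 0" using s by auto
  define t where "t n y = (\<i> * of_real w) ^ n / fact n * (of_real y ^ n * exp (- s * of_real (y\<^sup>2) + \<i> * of_real (0 * y)))" for n and y :: real
  have t_int: "integrable lborel (t n)" for n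
    unfolding t_def[abs_def] by (intro integrable_mult_right integrable_gauss_moment s)
  have t_val: "(\<integral>y. t n y \<partial>lborel) = (\<i> * of_real w) ^ n / fact n * gauss_moment n s 0" for n
    unfolding t_def gauss_moment_def by simp
  have m1: "gauss_moment (Suc 0) s 0 = 0" using gauss_moment_Suc[OF s, of 0 0] s0 by simp
  have m2: "gauss_moment (Suc (Suc n)) s 0 = of_nat (Suc n) / (2 * s) * gauss_moment n s 0" for n
    using gauss_moment_Suc[OF s, of "Suc n" 0] s0 by (simp add: field_simps)
  have odd: "gauss_moment (Suc (2 * j)) s 0 = 0" for j
    by (induction j) (simp_all add: m1 m2)
  have even: "gauss_moment (2 * j) s 0 = gauss_const s * fact (2 * j) / (fact j * (4 * s) ^ j)" for j
  proof (induction j)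
    case 0
    then show ?case by (simp add: gauss_moment_def gauss_const_def)
  next
    case (Suc j)
    have "gauss_moment (2 * Suc j) s 0 = of_nat (Suc (2 * j)) / (2 * s) * (gauss_const s * fact (2 * j) / (fact j * (4 * s) ^ j))"
      using m2[of "2 * j"] Suc by simp
    also have "\<dots> = gauss_const s * fact (2 * Suc j) / (fact (Suc j) * (4 * s) ^ Suc j)"
    proof -
      have f: "(fact (2 * Suc j) :: complex) = (2 * (of_nat j + 1)) * (of_nat (Suc (2 * j)) * fact (2 * j))"
        by (simp add: algebra_simps)
      have g: "(fact (Suc j) :: complex) * (4 * s) ^ Suc j = (2 * (of_nat j + 1)) * (2 * s * (fact j * (4 * s) ^ j))"
        by (simp add: algebra_simps)
      have "a / (2 * s) * (c * F / H) = c * (u * (a * F)) / (u * (2 * s * H))" if "u \<noteq> 0" for a c F H u :: complex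
        using that by (simp add: mult_ac)
      moreover have "2 * (of_nat j + 1 :: complex) \<noteq> 0" by (metis of_nat_Suc of_nat_neq_0 add.commute mult_eq_0_iff zero_neq_numeral)
      ultimately show ?thesis unfolding f g by blast
    qed
    finally show ?case .
  qed
  have sums_t: "(\<lambda>n. t n y) sums (of_real y ^ 0 * exp (- s * of_real (y\<^sup>2) + \<i> * of_real (w * y)))" for y
  proof -
    have "(\<lambda>n. (\<i> * of_real w * of_real y) ^ n / fact n) sums exp (\<i> * of_real w * of_real y)"
      by (rule exp_sums)
    from sums_mult[OF this, of "exp (- s * of_real (y\<^sup>2))"]
    have "(\<lambda>n. t n y) sums (exp (- s * of_real (y\<^sup>2)) * exp (\<i> * of_real w * of_real y))"
      by (simp add: t_def power_mult_distrib mult_ac)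
    also have "exp (- s * of_real (y\<^sup>2)) * exp (\<i> * of_real w * of_real y) = of_real y ^ 0 * exp (- s * of_real (y\<^sup>2) + \<i> * of_real (w * y))"
      by (simp add: exp_add[symmetric] mult_ac)
    finally show ?thesis .
  qed
  have lim: "(\<lambda>N. \<integral>y. (\<Sum>n<N. t n y) \<partial>lborel) \<longlonglongrightarrow> gauss_moment 0 s w"
    unfolding gauss_moment_def
  proof (rule integral_dominated_convergence[where w = "\<lambda>y. exp (w\<^sup>2 / (2 * Re s)) * exp (- (Re s / 2) * y\<^sup>2)"])
    show "integrable lborel (\<lambda>y. exp (w\<^sup>2 / (2 * Re s)) * exp (- (Re s / 2) * y\<^sup>2))"
      using has_bochner_integral_gauss_real[of "Re s / 2"] s
      by (intro integrable_mult_right) (simp add: has_bochner_integral_iff)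
    show "AE y in lborel. (\<lambda>N. \<Sum>n<N. t n y) \<longlonglongrightarrow> of_real y ^ 0 * exp (- s * of_real (y\<^sup>2) + \<i> * of_real (w * y))"
      using sums_t by (simp only: sums_def) simp
    fix N
    show "AE y in lborel. norm (\<Sum>n<N. t n y) \<le> exp (w\<^sup>2 / (2 * Re s)) * exp (- (Re s / 2) * y\<^sup>2)"
    proof (intro always_eventually allI)
      fix y :: real
      have le: "(\<Sum>n<N. (\<bar>w\<bar> * \<bar>y\<bar>) ^ n / fact n) \<le> exp (\<bar>w\<bar> * \<bar>y\<bar>)"
        using sum_le_suminf[of "\<lambda>i. (\<bar>w\<bar> * \<bar>y\<bar>) ^ i / fact i" "{..<N}"] summable_exp[of "\<bar>w\<bar> * \<bar>y\<bar>"]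
        by (simp add: exp_def scaleR_conv_of_real divide_inverse mult.commute)
      have "norm (t n y) = exp (- Re s * \<bar>y\<bar>\<^sup>2) * ((\<bar>w\<bar> * \<bar>y\<bar>) ^ n / fact n)" for n
        unfolding t_def norm_mult[of "_ / _"] norm_gauss_wave_real
        by (simp add: norm_divide norm_power norm_mult power_mult_distrib)
      then have "norm (\<Sum>n<N. t n y) \<le> (\<Sum>n<N. exp (- Re s * \<bar>y\<bar>\<^sup>2) * ((\<bar>w\<bar> * \<bar>y\<bar>) ^ n / fact n))"
        by (intro order.trans[OF norm_sum] sum_mono) simp
      also have "\<dots> \<le> exp (- Re s * \<bar>y\<bar>\<^sup>2) * exp (\<bar>w\<bar> * \<bar>y\<bar>)"
        unfolding sum_distrib_left[symmetric] using le by simp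
      also have "\<dots> = exp (- Re s * y\<^sup>2 + \<bar>w\<bar> * \<bar>y\<bar>)" by (simp add: exp_add[symmetric])
      \<comment> \<open>By completing the square, \<open>\<bar>w\<bar> * \<bar>y\<bar>\<close> is
        split so that half of the Gaussian survives as an integrable bound.\<close>
      also have "\<dots> \<le> exp (w\<^sup>2 / (2 * Re s) + - (Re s / 2) * y\<^sup>2)"
      proof -
        have "0 \<le> (\<bar>w\<bar> - Re s * \<bar>y\<bar>)\<^sup>2" by simp
        then have "2 * Re s * (\<bar>w\<bar> * \<bar>y\<bar>) \<le> w\<^sup>2 + (Re s)\<^sup>2 * y\<^sup>2"
          by (simp add: power2_diff power_mult_distrib algebra_simps)
        then have "\<bar>w\<bar> * \<bar>y\<bar> \<le> (w\<^sup>2 + (Re s)\<^sup>2 * y\<^sup>2) / (2 * Re s)"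
          using s by (simp add: pos_le_divide_eq mult.commute)
        also have "\<dots> = w\<^sup>2 / (2 * Re s) + Re s / 2 * y\<^sup>2"
          using s by (simp add: add_divide_distrib power2_eq_square)
        finally show ?thesis by simp
      qed
      finally show "norm (\<Sum>n<N. t n y) \<le> exp (w\<^sup>2 / (2 * Re s)) * exp (- (Re s / 2) * y\<^sup>2)"
        by (simp only: exp_add)
    qed
  qed (use t_int in \<open>auto simp: t_def[abs_def]\<close>)
  \<comment> \<open>The odd moments vanish, so the first \<open>2 * M\<close> terms in powers of
    \<open>w\<close> are the first \<open>M\<close> terms of the exponential series in
    \<open>w\<^sup>2\<close>.\<close>
  have "strict_mono (\<lambda>M::nat. 2 * M)" by (simp add: strict_mono_def)
  from LIMSEQ_subseq_LIMSEQ[OF lim this]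
  have "(\<lambda>M. \<integral>y. (\<Sum>n<2 * M. t n y) \<partial>lborel) \<longlonglongrightarrow> gauss_moment 0 s w" by (simp add: o_def)
  moreover have "(\<integral>y. (\<Sum>n<2 * M. t n y) \<partial>lborel) = (\<Sum>j<M. gauss_const s * ((- of_real (w\<^sup>2) / (4 * s)) ^ j / fact j))" for M
  proof -
    have "(\<integral>y. (\<Sum>n<2 * M. t n y) \<partial>lborel) = (\<Sum>n<2 * M. (\<i> * of_real w) ^ n / fact n * gauss_moment n s 0)"
      using t_int by (simp add: Bochner_Integration.integral_sum t_val)
    also have "\<dots> = (\<Sum>j<M. (\<i> * of_real w) ^ (2 * j) / fact (2 * j) * gauss_moment (2 * j) s 0)"
      by (induction M) (simp_all add: odd)
    also have "\<dots> = (\<Sum>j<M. gauss_const s * ((- of_real (w\<^sup>2) / (4 * s)) ^ j / fact j))"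
    proof (rule sum.cong[OF refl])
      fix j
      have "(\<i> * of_real w) ^ (2 * j) = (- of_real (w\<^sup>2)) ^ j"
        unfolding power_mult by (simp add: power_mult_distrib)
      then show "(\<i> * of_real w) ^ (2 * j) / fact (2 * j) * gauss_moment (2 * j) s 0 = gauss_const s * ((- of_real (w\<^sup>2) / (4 * s)) ^ j / fact j)"
        unfolding even power_divide by (simp add: mult_ac)
    qed
    finally show ?thesis .
  qed
  ultimately have "(\<lambda>M. \<Sum>j<M. gauss_const s * ((- of_real (w\<^sup>2) / (4 * s)) ^ j / fact j)) \<longlonglongrightarrow> gauss_moment 0 s w"
    by simp
  moreover have "(\<lambda>j. gauss_const s * ((- of_real (w\<^sup>2) / (4 * s)) ^ j / fact j)) sums (gauss_const s * exp (- of_real (w\<^sup>2) / (4 * s)))"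
    by (intro sums_mult exp_sums)
  ultimately show ?thesis unfolding sums_def using LIMSEQ_unique by blast
qed

section \<open>Homogeneous polynomials\<close>

definition Rd_dot :: "nat \<Rightarrow> (nat \<Rightarrow> real) \<Rightarrow> (nat \<Rightarrow> real) \<Rightarrow> real" where
  "Rd_dot d w x = (\<Sum>i<d. w i * x i)"

lemma measurable_Rd_dot [measurable]: "Rd_dot d w \<in> borel_measurable (lb d)"
  unfolding Rd_dot_def[abs_def] by measurable

definition Rd_monomial :: "nat \<Rightarrow> (nat \<Rightarrow> nat) \<Rightarrow> (nat \<Rightarrow> real) \<Rightarrow> complex" where
  "Rd_monomial d \<alpha> x = (\<Prod>i<d. of_real (x i) ^ \<alpha> i)"

text \<open>Adding one monomial at a time gives an induction principle for derivatives, bounds,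
  continuity and integrals. Unlike \<open>homogeneous_polynomial\<close>, it fixes the function on
  the whole type and not only on \<open>Rd d\<close>, so that derivatives can be rewritten as
  functions.\<close>

inductive hom_poly :: "nat \<Rightarrow> nat \<Rightarrow> ((nat \<Rightarrow> real) \<Rightarrow> complex) \<Rightarrow> bool" for d k where
  zero: "hom_poly d k (\<lambda>_. 0)"
| add: "hom_poly d k f \<Longrightarrow> (\<Sum>i<d. \<alpha> i) = k \<Longrightarrow> hom_poly d k (\<lambda>x. f x + c * Rd_monomial d \<alpha> x)"

lemma homogeneous_polynomial_hom_poly:
  assumes "homogeneous_polynomial d k P"
  obtains Q where "hom_poly d k Q" "\<And>x. x \<in> Rd d \<Longrightarrow> P x = Q x"
proof -
  from assms obtain c where c: "\<And>x. x \<in> Rd d \<Longrightarrow> P x = (\<Sum>\<alpha> \<in> {\<alpha> \<in> {..<d} \<rightarrow>\<^sub>E {..k}. (\<Sum>i<d. \<alpha> i) = k}.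
                 c \<alpha> * of_real (\<Prod>i<d. x i ^ \<alpha> i))"
    unfolding homogeneous_polynomial_def by blast
  have "hom_poly d k (\<lambda>x. \<Sum>\<alpha>\<in>S. c \<alpha> * of_real (\<Prod>i<d. x i ^ \<alpha> i))"
    if "finite S" "S \<subseteq> {\<alpha>. (\<Sum>i<d. \<alpha> i) = k}" for S
    using that
  proof (induction S rule: finite_induct)
    case (insert \<alpha> S)
    then have "hom_poly d k (\<lambda>x. (\<Sum>\<alpha>\<in>S. c \<alpha> * of_real (\<Prod>i<d. x i ^ \<alpha> i)) + c \<alpha> * Rd_monomial d \<alpha> x)"
      by (intro hom_poly.add) auto
    then show ?case using insert by (simp add: Rd_monomial_def add.commute)
  qed (simp add: hom_poly.zero)
  moreover have "finite {\<alpha> \<in> {..<d} \<rightarrow>\<^sub>E {..k}. (\<Sum>i<d. \<alpha> i) = k}"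
    by (rule finite_subset[OF _ finite_PiE[of "{..<d}" "\<lambda>_. {..k}"]]) auto
  ultimately show ?thesis using c by (intro that) auto
qed

lemma Rd_monomial_split:
  "i < d \<Longrightarrow> Rd_monomial d \<alpha> x = of_real (x i) ^ \<alpha> i * (\<Prod>j\<in>{..<d} - {i}. of_real (x j) ^ \<alpha> j)"
  unfolding Rd_monomial_def by (subst prod.remove[of _ i]) auto

lemma Rd_monomial_upd:
  "i < d \<Longrightarrow> Rd_monomial d (\<alpha>(i := n)) (x(i := t)) = of_real t ^ n * (\<Prod>j\<in>{..<d} - {i}. of_real (x j) ^ \<alpha> j)"
  by (subst Rd_monomial_split) auto

lemma Rd_monomial_has_partial:
  assumes i: "i < d"
  shows "((\<lambda>t. Rd_monomial d \<alpha> (x(i := t))) has_vector_derivative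
     of_nat (\<alpha> i) * Rd_monomial d (\<alpha>(i := \<alpha> i - 1)) (x(i := t))) (at t)"
proof -
  let ?R = "\<Prod>j\<in>{..<d} - {i}. of_real (x j) ^ \<alpha> j :: complex"
  have "((\<lambda>z. z ^ \<alpha> i * ?R) has_field_derivative of_nat (\<alpha> i) * of_real t ^ (\<alpha> i - 1) * ?R) (at (of_real t))"
    by (auto intro!: derivative_eq_intros)
  from has_vector_derivative_real_field[OF this]
  have "((\<lambda>t. of_real t ^ \<alpha> i * ?R) has_vector_derivative of_nat (\<alpha> i) * of_real t ^ (\<alpha> i - 1) * ?R) (at t)" .
  moreover have "Rd_monomial d \<alpha> (x(i := t)) = of_real t ^ \<alpha> i * ?R" for t
    using Rd_monomial_upd[OF i, of \<alpha> "\<alpha> i" x t] by simp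
  ultimately show ?thesis
    by (simp add: Rd_monomial_upd[OF i] mult.assoc)
qed

text \<open>The derivative is required at all points of the type, so that \<open>partial i f\<close>
  equals \<open>f'\<close> as a function and can be differentiated again by rewriting.\<close>

definition has_partial :: "nat \<Rightarrow> ((nat \<Rightarrow> real) \<Rightarrow> complex) \<Rightarrow> ((nat \<Rightarrow> real) \<Rightarrow> complex) \<Rightarrow> bool" where
  "has_partial i f f' \<longleftrightarrow> (\<forall>x t. ((\<lambda>t. f (x(i := t))) has_vector_derivative f' (x(i := t))) (at t))"

lemma has_partialD: "has_partial i f f' \<Longrightarrow> ((\<lambda>t. f (x(i := t))) has_vector_derivative f' x) (at (x i))"
  unfolding has_partial_def by (metis fun_upd_triv)

lemma has_partial_partial: "has_partial i f f' \<Longrightarrow> partial i f = f'"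
  unfolding partial_def using has_partialD vector_derivative_at by fast

lemma has_partial_add_monomial:
  assumes "i < d" "has_partial i f f'"
  shows "has_partial i (\<lambda>x. f x + c * Rd_monomial d \<alpha> x)
     (\<lambda>x. f' x + c * of_nat (\<alpha> i) * Rd_monomial d (\<alpha>(i := \<alpha> i - 1)) x)"
  using assms(2) unfolding has_partial_def mult.assoc
  by (intro allI has_vector_derivative_add has_vector_derivative_mult_right Rd_monomial_has_partial assms(1)) blast

lemma hom_poly_has_partial:
  assumes "hom_poly d k f" and i: "i < d"
  shows "has_partial i f (partial i f)" "hom_poly d (k - 1) (partial i f)"
proof -
  have "\<exists>f'. has_partial i f f' \<and> hom_poly d (k - 1) f'"
    using assms(1)
  proof induction
    case zero
    show ?case by (rule exI[of _ "\<lambda>_. 0"]) (auto simp: has_partial_def intro: hom_poly.zero)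
  next
    case (add f \<alpha> c)
    then obtain f' where f': "has_partial i f f'" "hom_poly d (k - 1) f'" by blast
    let ?f' = "\<lambda>x. f' x + c * of_nat (\<alpha> i) * Rd_monomial d (\<alpha>(i := \<alpha> i - 1)) x"
    have "hom_poly d (k - 1) ?f'"
    \<comment> \<open>For \<open>\<alpha> i = 0\<close> the new term has coefficient 0. Otherwise
      \<open>k > 0\<close>, and the truncated difference \<open>k - 1\<close> is the true
      degree.\<close>
    proof (cases "\<alpha> i = 0")
      case False
      have "(\<Sum>j<d. \<alpha> j) = \<alpha> i + (\<Sum>j\<in>{..<d} - {i}. \<alpha> j)"
        "(\<Sum>j<d. (\<alpha>(i := \<alpha> i - 1)) j) = \<alpha> i - 1 + (\<Sum>j\<in>{..<d} - {i}. \<alpha> j)"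
        using i by (subst sum.remove[of _ i]; simp)+
      then have "(\<Sum>j<d. (\<alpha>(i := \<alpha> i - 1)) j) = k - 1" using add False by simp
      with f'(2) show ?thesis by (rule hom_poly.add)
    qed (use f' in simp)
    with has_partial_add_monomial[OF i f'(1)] show ?case by blast
  qed
  then show "has_partial i f (partial i f)" "hom_poly d (k - 1) (partial i f)"
    using has_partial_partial by auto
qed

lemma partial_add_monomial:
  assumes "i < d" "hom_poly d k f"
  shows "partial i (\<lambda>x. f x + c * Rd_monomial d \<alpha> x)
     = (\<lambda>x. partial i f x + c * of_nat (\<alpha> i) * Rd_monomial d (\<alpha>(i := \<alpha> i - 1)) x)"
  by (rule has_partial_partial[OF has_partial_add_monomial[OF assms(1) hom_poly_has_partial(1)[OF assms(2,1)]]])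

lemma partial_zero: "partial i (\<lambda>_. 0) = (\<lambda>_. 0)"
  by (rule has_partial_partial) (simp add: has_partial_def)

lemma hom_poly_partial_commute:
  assumes "hom_poly d k f" "i < d" "j < d"
  shows "partial i (partial j f) = partial j (partial i f)"
  using assms(1)
proof induction
  case (add f \<alpha> c)
  have two: "partial i (partial j (\<lambda>x. f x + c * Rd_monomial d \<alpha> x))
      = (\<lambda>x. partial i (partial j f) x + c * of_nat (\<alpha> j) * of_nat ((\<alpha>(j := \<alpha> j - 1)) i) *
          Rd_monomial d (\<alpha>(j := \<alpha> j - 1, i := (\<alpha>(j := \<alpha> j - 1)) i - 1)) x)"
    if "i < d" "j < d" for i j
    unfolding partial_add_monomial[OF that(2) add(1)]
    by (rule partial_add_monomial[OF that(1) hom_poly_has_partial(2)[OF add(1) that(2)]])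
  show ?case
  proof (cases "i = j")
    case False
    then show ?thesis
      unfolding two[OF assms(2,3)] two[OF assms(3,2)] add.IH by (simp add: fun_upd_twist mult_ac)
  qed simp
qed (simp add: partial_zero)

lemma hom_poly_Euler:
  assumes "hom_poly d k f"
  shows "(\<Sum>i<d. of_real (x i) * partial i f x) = of_nat k * f x"
  using assms
proof induction
  case (add f \<alpha> c)
  have one: "of_real (x i) * (c * of_nat (\<alpha> i) * Rd_monomial d (\<alpha>(i := \<alpha> i - 1)) x) = of_nat (\<alpha> i) * (c * Rd_monomial d \<alpha> x)" if "i < d" for i
  proof (cases "\<alpha> i")
    case (Suc n)
    then show ?thesis using Rd_monomial_upd[OF that, of \<alpha> "\<alpha> i - 1" x "x i"] by (simp add: Rd_monomial_split[OF that, of \<alpha>] mult_ac)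
  qed simp
  have "(\<Sum>i<d. of_real (x i) * partial i (\<lambda>x. f x + c * Rd_monomial d \<alpha> x) x)
      = (\<Sum>i<d. of_real (x i) * partial i f x) + (\<Sum>i<d. of_nat (\<alpha> i) * (c * Rd_monomial d \<alpha> x))"
    unfolding sum.distrib[symmetric]
    by (rule sum.cong[OF refl]) (simp only: partial_add_monomial[OF _ add(1)] distrib_left one lessThan_iff)
  also have "\<dots> = of_nat k * f x + of_nat k * (c * Rd_monomial d \<alpha> x)"
    using add by (simp add: sum_distrib_right[symmetric] flip: of_nat_sum)
  finally show ?case by (simp add: distrib_left)
qed (simp add: partial_zero)

lemma hom_poly_scale:
  assumes "hom_poly d k f"
  shows "f (affine_map d (\<lambda>_. 0) t x) = of_real t ^ k * f x"
  using assms
proof induction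
  case (add f \<alpha> c)
  have "Rd_monomial d \<alpha> (affine_map d (\<lambda>_. 0) t x) = of_real t ^ k * Rd_monomial d \<alpha> x"
    unfolding Rd_monomial_def add(2)[symmetric]
    by (simp add: affine_map_def power_mult_distrib prod.distrib power_sum)
  then show ?case using add by (simp add: algebra_simps)
qed simp

lemma Rd_monomial_norm_le: "norm (Rd_monomial d \<alpha> x) \<le> Rd_norm d x ^ (\<Sum>i<d. \<alpha> i)"
proof -
  have "norm (Rd_monomial d \<alpha> x) \<le> (\<Prod>i<d. Rd_norm d x ^ \<alpha> i)"
    unfolding Rd_monomial_def prod_norm[symmetric]
    by (rule prod_mono) (simp add: norm_power power_mono abs_coord_le_Rd_norm)
  then show ?thesis by (simp add: power_sum[symmetric])
qed

lemma hom_poly_bound: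
  assumes "hom_poly d k f"
  obtains B where "B \<ge> 0" "\<And>x. norm (f x) \<le> B * Rd_norm d x ^ k"
proof -
  have "\<exists>B\<ge>0. \<forall>x. norm (f x) \<le> B * Rd_norm d x ^ k"
    using assms
  proof induction
    case zero
    then show ?case by (intro exI[of _ 0]) auto
  next
    case (add f \<alpha> c)
    then obtain B where B: "B \<ge> 0" "\<And>x. norm (f x) \<le> B * Rd_norm d x ^ k" by blast
    have "norm (Rd_monomial d \<alpha> x) \<le> Rd_norm d x ^ k" for x
      using Rd_monomial_norm_le[of d \<alpha> x] add.hyps(2) by simp
    then have "norm (f x + c * Rd_monomial d \<alpha> x) \<le> (B + norm c) * Rd_norm d x ^ k" for x
      using B(2)[of x] by (intro order.trans[OF norm_triangle_ineq]) (simp add: distrib_right norm_mult add_mono mult_left_mono)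
    with B(1) show ?case by (intro exI[of _ "B + norm c"]) auto
  qed
  then show ?thesis using that by blast
qed

lemma continuous_on_Rd_monomial: "continuous_on UNIV (Rd_monomial d \<alpha>)"
  unfolding Rd_monomial_def[abs_def]
  by (intro continuous_intros continuous_on_product_coordinates)

lemma hom_poly_continuous: "hom_poly d k f \<Longrightarrow> continuous_on UNIV f"
  by (induction rule: hom_poly.induct) (auto intro!: continuous_intros continuous_on_Rd_monomial)

lemma measurable_Rd_monomial [measurable]: "Rd_monomial d \<alpha> \<in> borel_measurable (lb d)"
  unfolding Rd_monomial_def[abs_def] by measurable

lemma hom_poly_measurable: "hom_poly d k f \<Longrightarrow> f \<in> borel_measurable (lb d)"
  by (induction rule: hom_poly.induct) auto

lemma hom_poly_line:
  assumes "hom_poly d k f"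
  shows "\<exists>p. \<forall>t. f (\<lambda>i\<in>{..<d}. y i + t * z i) = poly p (of_real t)"
  using assms
proof induction
  case zero
  show ?case by (intro exI[of _ 0]) simp
next
  case (add f \<alpha> c)
  then obtain p where p: "\<forall>t. f (\<lambda>i\<in>{..<d}. y i + t * z i) = poly p (of_real t)" by blast
  have "Rd_monomial d \<alpha> (\<lambda>i\<in>{..<d}. y i + t * z i) = poly (\<Prod>i<d. [:of_real (y i), of_real (z i):] ^ \<alpha> i) (of_real t)" for t
    unfolding Rd_monomial_def poly_prod by (simp add: poly_power mult.commute)
  with p show ?case
    by (intro exI[of _ "p + smult c (\<Prod>i<d. [:of_real (y i), of_real (z i):] ^ \<alpha> i)"] allI) (simp only: poly_add poly_smult)
qed

section \<open>Hecke's formula\<close>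

text \<open>Integrating \<open>f\<close> against it gives the Fourier transform at \<open>w\<close>
  of \<open>f\<close> times a complex Gaussian.\<close>

definition gauss_wave :: "nat \<Rightarrow> complex \<Rightarrow> (nat \<Rightarrow> real) \<Rightarrow> (nat \<Rightarrow> real) \<Rightarrow> complex" where
  "gauss_wave d s w y = exp (- s * of_real ((Rd_norm d y)\<^sup>2) - \<i> * of_real (Rd_dot d w y))"

lemma measurable_gauss_wave [measurable]: "gauss_wave d s w \<in> borel_measurable (lb d)"
  unfolding gauss_wave_def[abs_def] by measurable

lemma gauss_wave_prod: "gauss_wave d s w y = (\<Prod>i<d. exp (- s * of_real ((y i)\<^sup>2) + \<i> * of_real (- w i * y i)))"
  by (simp add: gauss_wave_def Rd_norm_power2 Rd_dot_def exp_sum[symmetric] sum.distrib sum_distrib_left sum_negf sum_subtractf)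

lemma has_bochner_integral_monomial_gauss:
  assumes "Re s > 0"
  shows "has_bochner_integral (lb d) (\<lambda>y. Rd_monomial d \<alpha> y * gauss_wave d s w y) (\<Prod>i<d. gauss_moment (\<alpha> i) s (- w i))"
proof -
  have "has_bochner_integral (lb d) (\<lambda>y. \<Prod>i<d. of_real (y i) ^ \<alpha> i * exp (- s * of_real ((y i)\<^sup>2) + \<i> * of_real (- w i * y i)))
     (\<Prod>i<d. \<integral>x. of_real x ^ \<alpha> i * exp (- s * of_real (x\<^sup>2) + \<i> * of_real (- w i * x)) \<partial>lborel)"
    by (rule has_bochner_integral_lb_prod) (rule integrable_gauss_moment[OF assms])
  then show ?thesis
    by (simp only: gauss_wave_prod Rd_monomial_def prod.distrib gauss_moment_def)
qed

lemma hom_poly_gauss_integrable: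
  assumes "hom_poly d k f" "Re s > 0"
  shows "integrable (lb d) (\<lambda>y. f y * gauss_wave d s w y)"
  using assms(1)
proof induction
  case (add f \<alpha> c)
  have "integrable (lb d) (\<lambda>y. f y * gauss_wave d s w y + c * (Rd_monomial d \<alpha> y * gauss_wave d s w y))"
    using add has_bochner_integral_monomial_gauss[OF assms(2)]
    by (intro Bochner_Integration.integrable_add integrable_mult_right) (auto simp: has_bochner_integral_iff)
  then show ?case by (simp add: algebra_simps)
qed simp

text \<open>All terms are linear in \<open>f\<close>, and for a monomial the integrals factor over
  the coordinates; the identity is then \<open>gauss_moment_Suc\<close> in the factor with index
  \<open>i\<close>.\<close>

lemma hom_poly_gauss_by_parts:
  assumes "hom_poly d k f" and s: "Re s > 0" and i: "i < d"
  shows "integrable (lb d) (\<lambda>y. of_real (y i) * f y * gauss_wave d s w y)"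
    "2 * s * (\<integral>y. of_real (y i) * f y * gauss_wave d s w y \<partial>lb d)
      = (\<integral>y. partial i f y * gauss_wave d s w y \<partial>lb d) - \<i> * of_real (w i) * (\<integral>y. f y * gauss_wave d s w y \<partial>lb d)"
proof -
  let ?G = "gauss_wave d s w"
  let ?goal = "\<lambda>f. integrable (lb d) (\<lambda>y. of_real (y i) * f y * ?G y) \<and>
    2 * s * (\<integral>y. of_real (y i) * f y * ?G y \<partial>lb d)
      = (\<integral>y. partial i f y * ?G y \<partial>lb d) - \<i> * of_real (w i) * (\<integral>y. f y * ?G y \<partial>lb d)"
  have "?goal f" using assms(1)
  proof induction
    case zero
    show ?case by (simp add: partial_zero)
  next
    case (add f \<alpha> c)
    let ?I = "\<lambda>\<alpha>. \<Prod>j<d. gauss_moment (\<alpha> j) s (- w j)"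
    let ?R = "\<Prod>j\<in>{..<d} - {i}. gauss_moment (\<alpha> j) s (- w j)"
    have split: "?I (\<alpha>(i := n)) = gauss_moment n s (- w i) * ?R" for n
      using i by (subst prod.remove[of _ i]) auto
    have m: "has_bochner_integral (lb d) (\<lambda>y. Rd_monomial d (\<alpha>(i := n)) y * ?G y) (gauss_moment n s (- w i) * ?R)" for n
      using has_bochner_integral_monomial_gauss[OF s, of d "\<alpha>(i := n)" w] unfolding split .
    have xm: "of_real (y i) * Rd_monomial d \<alpha> y = Rd_monomial d (\<alpha>(i := Suc (\<alpha> i))) y" for y
      using i by (simp add: Rd_monomial_split[of i] mult_ac)
    note F = hom_poly_gauss_integrable[OF add(1) s, of w, THEN has_bochner_integral_integrable]
    note F' = hom_poly_gauss_integrable[OF hom_poly_has_partial(2)[OF add(1) i] s, of w, THEN has_bochner_integral_integrable]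
    have IH1: "has_bochner_integral (lb d) (\<lambda>y. of_real (y i) * f y * ?G y) (\<integral>y. of_real (y i) * f y * ?G y \<partial>lb d)"
      using add by (auto intro: has_bochner_integral_integrable)
    have 1: "has_bochner_integral (lb d) (\<lambda>y. of_real (y i) * (f y + c * Rd_monomial d \<alpha> y) * ?G y)
       ((\<integral>y. of_real (y i) * f y * ?G y \<partial>lb d) + c * (gauss_moment (Suc (\<alpha> i)) s (- w i) * ?R))"
      using has_bochner_integral_add[OF IH1 has_bochner_integral_mult_right[OF m[of "Suc (\<alpha> i)", folded xm], of c]]
      by (simp add: algebra_simps)
    have 2: "has_bochner_integral (lb d) (\<lambda>y. (f y + c * Rd_monomial d \<alpha> y) * ?G y)
       ((\<integral>y. f y * ?G y \<partial>lb d) + c * (gauss_moment (\<alpha> i) s (- w i) * ?R))"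
      using has_bochner_integral_add[OF F has_bochner_integral_mult_right[OF m[of "\<alpha> i"], of c]]
      by (simp add: algebra_simps)
    have 3: "has_bochner_integral (lb d) (\<lambda>y. partial i (\<lambda>x. f x + c * Rd_monomial d \<alpha> x) y * ?G y)
       ((\<integral>y. partial i f y * ?G y \<partial>lb d) + c * of_nat (\<alpha> i) * (gauss_moment (\<alpha> i - 1) s (- w i) * ?R))"
      using has_bochner_integral_add[OF F' has_bochner_integral_mult_right[OF m[of "\<alpha> i - 1"], of "c * of_nat (\<alpha> i)"]]
      by (simp add: partial_add_monomial[OF i add(1)] algebra_simps)
    have "2 * s * (c * (gauss_moment (Suc (\<alpha> i)) s (- w i) * ?R)) = c * ?R * (2 * s * gauss_moment (Suc (\<alpha> i)) s (- w i))"
      by (simp add: mult_ac)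
    also have "\<dots> = c * of_nat (\<alpha> i) * (gauss_moment (\<alpha> i - 1) s (- w i) * ?R) - \<i> * of_real (w i) * (c * (gauss_moment (\<alpha> i) s (- w i) * ?R))"
      unfolding gauss_moment_Suc[OF s] by (simp add: algebra_simps)
    finally have "2 * s * (c * (gauss_moment (Suc (\<alpha> i)) s (- w i) * ?R)) = \<dots>" .
    then show ?case
      using 1 add.IH
      unfolding has_bochner_integral_integral_eq[OF 1] has_bochner_integral_integral_eq[OF 2] has_bochner_integral_integral_eq[OF 3]
      by (simp add: has_bochner_integral_iff distrib_left)
  qed
  then show "integrable (lb d) (\<lambda>y. of_real (y i) * f y * ?G y)"
    "2 * s * (\<integral>y. of_real (y i) * f y * ?G y \<partial>lb d)
      = (\<integral>y. partial i f y * ?G y \<partial>lb d) - \<i> * of_real (w i) * (\<integral>y. f y * ?G y \<partial>lb d)" by blast+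
qed

lemma Rd_upd: "x \<in> Rd d \<Longrightarrow> i < d \<Longrightarrow> x(i := t) \<in> Rd d"
  by (auto simp: Rd_def PiE_iff extensional_def)

lemma partial_cong_Rd:
  assumes "\<And>x. x \<in> Rd d \<Longrightarrow> f x = g x" "x \<in> Rd d" "i < d"
  shows "partial i f x = partial i g x"
  unfolding partial_def using assms by (simp add: Rd_upd)

text \<open>Partial derivatives of a polynomial commute with each other, hence with the Laplacian.
  This feeds the induction on the degree in Hecke's formula.\<close>

lemma hom_poly_harmonic_partial:
  assumes f: "hom_poly d k f" and harm: "harmonic d f" and i: "i < d"
  shows "harmonic d (partial i f)"
  unfolding harmonic_def
proof
  fix x assume x: "x \<in> Rd d"
  note hp = hom_poly_has_partial[OF f]
  note hp2 = hom_poly_has_partial[OF hp(2)]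
  have "(\<Sum>j<d. partial j (partial j (partial i f)) x) = (\<Sum>j<d. partial i (partial j (partial j f)) x)"
    by (rule sum.cong[OF refl])
      (simp add: hom_poly_partial_commute[OF f _ i] hom_poly_partial_commute[OF hp(2) _ i])
  also have "\<dots> = partial i (\<lambda>x. \<Sum>j<d. partial j (partial j f) x) x"
  proof -
    have "has_partial i (\<lambda>x. \<Sum>j<d. partial j (partial j f) x) (\<lambda>x. \<Sum>j<d. partial i (partial j (partial j f)) x)"
      unfolding has_partial_def
      by (intro allI has_vector_derivative_sum) 
        (use hom_poly_has_partial(1)[OF hp2(2) i] in \<open>auto simp: has_partial_def\<close>)
    then show ?thesis by (simp add: has_partial_partial)
  qed
  \<comment> \<open>The Laplacian is known to vanish only on \<open>Rd d\<close>; this determines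
    its derivative because \<open>Rd d\<close> is closed under changing a coordinate below
    \<open>d\<close>.\<close>
  also have "\<dots> = partial i (\<lambda>x. 0) x"
    by (rule partial_cong_Rd[OF _ x i]) (use harm in \<open>auto simp: harmonic_def\<close>)
  finally show "(\<Sum>j<d. partial j (partial j (partial i f)) x) = 0"
    by (simp add: partial_zero)
qed

lemma hom_poly_0_const:
  assumes "hom_poly d 0 f"
  obtains c where "f = (\<lambda>_. c)"
proof -
  have "\<exists>c. f = (\<lambda>_. c)" using assms
  proof induction
    case (add f \<alpha> c)
    then have "Rd_monomial d \<alpha> x = 1" for x by (simp add: Rd_monomial_def)
    then show ?case using add by auto
  qed auto
  then show ?thesis using that by blast
qed

text \<open>By Euler's identity and an integration by parts, the transform of \<open>f\<close> reduces to those of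
  its derivatives, which are harmonic of degree \<open>k - 1\<close>.\<close>

theorem Hecke:
  assumes "hom_poly d k f" "harmonic d f" and s: "Re s > 0" and w: "w \<in> Rd d"
  shows "(\<integral>y. f y * gauss_wave d s w y \<partial>lb d)
    = gauss_const s ^ d * exp (- of_real ((Rd_norm d w)\<^sup>2) / (4 * s)) * (- \<i> / (2 * s)) ^ k * f w"
  using assms(1,2)
proof (induction k arbitrary: f)
  case 0
  then obtain c where f: "f = (\<lambda>_. c)" using hom_poly_0_const by blast
  have "(\<integral>y. Rd_monomial d (\<lambda>_. 0) y * gauss_wave d s w y \<partial>lb d) = (\<Prod>i<d. gauss_moment 0 s (- w i))"
    using has_bochner_integral_monomial_gauss[OF s, of d "\<lambda>_. 0" w] by (simp add: has_bochner_integral_iff)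
  also have "\<dots> = gauss_const s ^ d * exp (- of_real ((Rd_norm d w)\<^sup>2) / (4 * s))"
    unfolding gauss_moment_0[OF s]
    by (simp add: prod.distrib exp_sum[symmetric] Rd_norm_power2 sum_divide_distrib sum_negf)
  finally show ?case by (simp add: f Rd_monomial_def mult.commute)
next
  case (Suc k)
  let ?G = "gauss_wave d s w"
  let ?H = "gauss_const s ^ d * exp (- of_real ((Rd_norm d w)\<^sup>2) / (4 * s)) * (- \<i> / (2 * s)) ^ k"
  note hp = hom_poly_has_partial[OF Suc.prems(1), simplified]
  note hp2 = hom_poly_has_partial[OF hp(2)]
  note parts = hom_poly_gauss_by_parts[OF hp(2) s, of _ _ w]
  have s0: "s \<noteq> 0" using s by auto
  have IH: "(\<integral>y. partial i f y * ?G y \<partial>lb d) = ?H * partial i f w" if "i < d" for i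
    using Suc.IH[OF hp(2)[OF that] hom_poly_harmonic_partial[OF Suc.prems that]] .
  \<comment> \<open>Here harmonicity enters: the second derivatives left by the integrations by
    parts add up to the Laplacian.\<close>
  have lap: "(\<Sum>i<d. \<integral>y. partial i (partial i f) y * ?G y \<partial>lb d) = 0"
  proof -
    have "(\<Sum>i<d. \<integral>y. partial i (partial i f) y * ?G y \<partial>lb d) = (\<integral>y. (\<Sum>i<d. partial i (partial i f) y * ?G y) \<partial>lb d)"
      by (rule Bochner_Integration.integral_sum[symmetric]) (auto intro: hom_poly_gauss_integrable[OF hp2(2) s])
    also have "\<dots> = (\<integral>y. 0 \<partial>lb d)"
      by (rule Bochner_Integration.integral_cong) (use Suc.prems in \<open>auto simp: space_lb harmonic_def sum_distrib_right[symmetric]\<close>)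
    finally show ?thesis by simp
  qed
  have "of_nat (Suc k) * (\<integral>y. f y * ?G y \<partial>lb d) = (\<integral>y. (\<Sum>i<d. of_real (y i) * partial i f y * ?G y) \<partial>lb d)"
  proof -
    have "(\<Sum>i<d. of_real (y i) * partial i f y * ?G y) = of_nat (Suc k) * (f y * ?G y)" for y
      unfolding sum_distrib_right[symmetric] hom_poly_Euler[OF Suc.prems(1)] by (rule mult.assoc)
    then show ?thesis by (simp only: integral_mult_right_zero)
  qed
  also have "\<dots> = (\<Sum>i<d. \<integral>y. of_real (y i) * partial i f y * ?G y \<partial>lb d)"
    by (rule Bochner_Integration.integral_sum) (use parts(1) in auto)
  finally have "2 * s * (of_nat (Suc k) * (\<integral>y. f y * ?G y \<partial>lb d))
     = (\<Sum>i<d. 2 * s * (\<integral>y. of_real (y i) * partial i f y * ?G y \<partial>lb d))" by (simp add: sum_distrib_left)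
  also have "\<dots> = (\<Sum>i<d. (\<integral>y. partial i (partial i f) y * ?G y \<partial>lb d) - \<i> * of_real (w i) * (?H * partial i f w))"
    by (rule sum.cong[OF refl]) (simp only: parts(2) IH lessThan_iff)
  also have "\<dots> = - \<i> * ?H * (\<Sum>i<d. of_real (w i) * partial i f w)"
  proof -
    have "0 - (\<Sum>i<d. \<i> * of_real (w i) * (h * p i)) = - \<i> * h * (\<Sum>i<d. of_real (w i) * p i)" for h :: complex and p
      by (simp add: sum_distrib_left sum_negf[symmetric] mult_ac)
    then show ?thesis by (simp only: sum_subtractf lap)
  qed
  \<comment> \<open>Euler's identity is used a second time, now at the frequency \<open>w\<close>;
    the factor \<open>Suc k\<close> then cancels.\<close>
  also have "\<dots> = - \<i> * ?H * (of_nat (Suc k) * f w)"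
    unfolding hom_poly_Euler[OF Suc.prems(1)] ..
  finally have "of_nat (Suc k) * (2 * s * (\<integral>y. f y * ?G y \<partial>lb d)) = of_nat (Suc k) * (- \<i> * ?H * f w)"
    by (simp only: mult_ac)
  then have "2 * s * (\<integral>y. f y * ?G y \<partial>lb d) = - \<i> * ?H * f w"
    by (rule mult_left_cancel[THEN iffD1, OF of_nat_neq_0])
  moreover have "I = g * (z * (- \<i> / (2 * s))) * v" if "2 * s * I = - \<i> * (g * z) * v" for I g z v :: complex
  proof -
    have "I = (2 * s * I) / (2 * s)" using s0 by simp
    then show ?thesis unfolding that by simp
  qed
  ultimately show ?case by (simp only: power_Suc2)
qed

section \<open>Zero mean and zero sets of spherical harmonics\<close>

lemma hom_poly_integrable_ball:
  assumes "hom_poly d k f"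
  shows "integrable (lb d) (\<lambda>y. indicator {y. Rd_norm d y \<le> r} y *\<^sub>R f y)"
proof -
  obtain B where B: "B \<ge> 0" "\<And>x. norm (f x) \<le> B * Rd_norm d x ^ k" using hom_poly_bound[OF assms] by blast
  note [measurable] = hom_poly_measurable[OF assms]
  show ?thesis
  proof (rule Bochner_Integration.integrable_bound)
    show "integrable (lb d) (\<lambda>y. B * exp (r\<^sup>2) * (Rd_norm d y ^ k * exp (- 1 * (Rd_norm d y)\<^sup>2)))"
      by (intro integrable_mult_right integrable_norm_power_gauss) simp
    show "AE y in lb d. norm (indicator {y. Rd_norm d y \<le> r} y *\<^sub>R f y) \<le> norm (B * exp (r\<^sup>2) * (Rd_norm d y ^ k * exp (- 1 * (Rd_norm d y)\<^sup>2)))"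
    proof (intro always_eventually allI)
      fix y
      show "norm (indicator {y. Rd_norm d y \<le> r} y *\<^sub>R f y) \<le> norm (B * exp (r\<^sup>2) * (Rd_norm d y ^ k * exp (- 1 * (Rd_norm d y)\<^sup>2)))"
      proof (cases "Rd_norm d y \<le> r")
        case True
        then have "(Rd_norm d y)\<^sup>2 \<le> r\<^sup>2" by (intro power_mono) auto
        then have "1 \<le> exp (r\<^sup>2) * exp (- 1 * (Rd_norm d y)\<^sup>2)" by (simp add: exp_add[symmetric])
        then have "B * Rd_norm d y ^ k * 1 \<le> B * Rd_norm d y ^ k * (exp (r\<^sup>2) * exp (- 1 * (Rd_norm d y)\<^sup>2))"
          using B(1) by (intro mult_left_mono) auto
        with B(2)[of y] B(1) True show ?thesis by (simp add: abs_mult mult_ac)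
      qed simp
    qed
  qed measurable
qed

text \<open>Hecke's formula at frequency 0, where \<open>f\<close> vanishes because its degree is
  positive.\<close>

lemma harmonic_mean_zero_gauss:
  assumes f: "hom_poly d k f" "harmonic d f" "k \<ge> 1" and s: "s > (0::real)"
  shows "(\<integral>y. exp (- s * (Rd_norm d y)\<^sup>2) *\<^sub>R f y \<partial>lb d) = 0"
proof -
  let ?z = "\<lambda>i\<in>{..<d}. 0::real"
  have z: "?z \<in> Rd d" by (simp add: Rd_def)
  have "(\<integral>y. f y * gauss_wave d (of_real s) ?z y \<partial>lb d) = 0"
  proof -
    obtain B where B: "\<And>x. norm (f x) \<le> B * Rd_norm d x ^ k" using hom_poly_bound[OF f(1)] by blast
    have "f ?z = 0" using B[of ?z] f(3) by (simp add: Rd_norm_def L2_set_def power_0_left Suc_le_eq)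
    then show ?thesis using Hecke[OF f(1,2) _ z, of "of_real s"] s by simp
  qed
  moreover have "f y * gauss_wave d (of_real s) ?z y = exp (- s * (Rd_norm d y)\<^sup>2) *\<^sub>R f y" for y
    by (simp add: gauss_wave_def Rd_dot_def scaleR_conv_of_real exp_of_real[symmetric])
  ultimately show ?thesis by simp
qed

text \<open>The Gaussian integral, which vanishes, is a nonzero Gamma factor times the integral over
  the ball.\<close>

lemma harmonic_mean_zero_open_ball:
  assumes f: "hom_poly d k f" "harmonic d f" "k \<ge> 1"
  shows "(\<integral>y. indicator {y. Rd_norm d y < 1} y *\<^sub>R f y \<partial>lb d) = 0"
    "integrable (lb d) (\<lambda>y. indicator {y. Rd_norm d y < 1} y *\<^sub>R f y)"
proof -
  note [measurable] = hom_poly_measurable[OF f(1)]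
  obtain B where B: "\<And>x. norm (f x) \<le> B * Rd_norm d x ^ k" using hom_poly_bound[OF f(1)] by blast
  show int: "integrable (lb d) (\<lambda>y. indicator {y. Rd_norm d y < 1} y *\<^sub>R f y)"
    by (rule integrable_unit_ball_bounded) (use B in auto)
  have "Gamma (real (d + k) / 2 + 1) > 0" by (intro Gamma_real_pos) (simp add: add_nonneg_pos)
  moreover have "(\<integral>y. exp (- 1 * (Rd_norm d y)\<^sup>2) *\<^sub>R f y \<partial>lb d) = (Gamma (real (d + k) / 2 + 1) / 1 powr (real (d + k) / 2)) *\<^sub>R (\<integral>y. indicator {y. Rd_norm d y < 1} y *\<^sub>R f y \<partial>lb d)"
    by (rule integral_homogeneous_gauss) (use hom_poly_scale[OF f(1)] int in \<open>auto simp: scaleR_conv_of_real\<close>)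
  ultimately show "(\<integral>y. indicator {y. Rd_norm d y < 1} y *\<^sub>R f y \<partial>lb d) = 0"
    unfolding harmonic_mean_zero_gauss[OF f zero_less_one] by simp
qed

text \<open>Open balls follow by dilation, closed balls as their decreasing limits. The closed ball
  matters because it is the complement of the truncation \<open>Rd_norm d y > t\<close>.\<close>

lemma harmonic_mean_zero_ball:
  assumes f: "hom_poly d k f" "harmonic d f" "k \<ge> 1" and r: "r \<ge> 0"
  shows "(\<integral>y. indicator {y. Rd_norm d y \<le> r} y *\<^sub>R f y \<partial>lb d) = 0"
proof -
  note [measurable] = hom_poly_measurable[OF f(1)]
  have open0: "(\<integral>y. indicator {y. Rd_norm d y < \<rho>} y *\<^sub>R f y \<partial>lb d) = 0" if \<rho>: "\<rho> > 0" for \<rho>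
  proof -
    have "(\<integral>y. indicator {y. Rd_norm d y < \<rho>} y *\<^sub>R f y \<partial>lb d)
      = \<rho> ^ d *\<^sub>R (\<integral>y. indicator {y. Rd_norm d y < \<rho>} (affine_map d (\<lambda>_. 0) \<rho> y) *\<^sub>R f (affine_map d (\<lambda>_. 0) \<rho> y) \<partial>lb d)"
      using \<rho> integral_lb_affine[of \<rho> "\<lambda>y. indicator {y. Rd_norm d y < \<rho>} y *\<^sub>R f y" d "\<lambda>_. 0"] by simp
    also have "(\<lambda>y. indicator {y. Rd_norm d y < \<rho>} (affine_map d (\<lambda>_. 0) \<rho> y) *\<^sub>R f (affine_map d (\<lambda>_. 0) \<rho> y))
      = (\<lambda>y. of_real (\<rho> ^ k) * (indicator {y. Rd_norm d y < 1} y *\<^sub>R f y))"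
      using \<rho> by (auto simp: fun_eq_iff indicator_def Rd_norm_affine_map hom_poly_scale[OF f(1)])
    finally show ?thesis unfolding integral_mult_right_zero harmonic_mean_zero_open_ball(1)[OF f] by simp
  qed
  let ?\<rho> = "\<lambda>n. r + 1 / real (Suc n)"
  have "(\<lambda>n. \<integral>y. indicator {y. Rd_norm d y < ?\<rho> n} y *\<^sub>R f y \<partial>lb d) \<longlonglongrightarrow> (\<integral>y. indicator {y. Rd_norm d y \<le> r} y *\<^sub>R f y \<partial>lb d)"
  proof (rule integral_dominated_convergence[where w = "\<lambda>y. norm (indicator {y. Rd_norm d y \<le> r + 1} y *\<^sub>R f y)"])
    show "integrable (lb d) (\<lambda>y. norm (indicator {y. Rd_norm d y \<le> r + 1} y *\<^sub>R f y))"
      by (intro integrable_norm hom_poly_integrable_ball[OF f(1)])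
    show "AE y in lb d. norm (indicator {y. Rd_norm d y < ?\<rho> n} y *\<^sub>R f y) \<le> norm (indicator {y. Rd_norm d y \<le> r + 1} y *\<^sub>R f y)" for n
    proof (intro always_eventually allI)
      fix y
      have "1 / real (Suc n) \<le> 1" by simp
      then have "Rd_norm d y < ?\<rho> n \<Longrightarrow> Rd_norm d y \<le> r + 1" by linarith
      then show "norm (indicator {y. Rd_norm d y < ?\<rho> n} y *\<^sub>R f y) \<le> norm (indicator {y. Rd_norm d y \<le> r + 1} y *\<^sub>R f y)"
        by (auto simp: indicator_def)
    qed
    show "AE y in lb d. (\<lambda>n. indicator {y. Rd_norm d y < ?\<rho> n} y *\<^sub>R f y) \<longlonglongrightarrow> indicator {y. Rd_norm d y \<le> r} y *\<^sub>R f y"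
    proof (intro always_eventually allI)
      fix y
      have lim: "?\<rho> \<longlonglongrightarrow> r + 0" by (intro tendsto_intros LIMSEQ_Suc[OF lim_1_over_n])
      have "\<forall>\<^sub>F n in sequentially. indicator {y. Rd_norm d y < ?\<rho> n} y *\<^sub>R f y = indicator {y. Rd_norm d y \<le> r} y *\<^sub>R f y"
      proof (cases "Rd_norm d y \<le> r")
        case True
        have "Rd_norm d y < ?\<rho> n" for n using True by (simp add: add_strict_increasing2 le_less_trans)
        then show ?thesis using True by simp
      next
        case False
        then have "\<forall>\<^sub>F n in sequentially. ?\<rho> n < Rd_norm d y" using order_tendstoD(2)[OF lim] by simp
        then show ?thesis by eventually_elim (use False in auto)
      qed
      then show "(\<lambda>n. indicator {y. Rd_norm d y < ?\<rho> n} y *\<^sub>R f y) \<longlonglongrightarrow> indicator {y. Rd_norm d y \<le> r} y *\<^sub>R f y"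
        by (rule tendsto_eventually)
    qed
  qed measurable
  moreover have "(\<integral>y. indicator {y. Rd_norm d y < ?\<rho> n} y *\<^sub>R f y \<partial>lb d) = 0" for n
    using r by (intro open0) (simp add: add_nonneg_pos)
  ultimately have "(\<lambda>n::nat. 0) \<longlonglongrightarrow> (\<integral>y. indicator {y. Rd_norm d y \<le> r} y *\<^sub>R f y \<partial>lb d)"
    by (simp only:)
  then show ?thesis by (rule LIMSEQ_unique[OF _ tendsto_const])
qed

text \<open>Cutting the exponential weight off below \<open>t\<^sup>2\<close> makes the layer cake
  function constant on the ball of radius \<open>t\<close>. It is then the truncated Gaussian plus a
  multiple of the indicator of the closed ball, over which the mean is already known to
  vanish.\<close>

lemma harmonic_mean_zero_gauss_trunc:
  assumes f: "hom_poly d k f" "harmonic d f" "k \<ge> 1" and s: "s > (0::real)" and t: "t \<ge> 0"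
  shows "(\<integral>y. (indicator {y. Rd_norm d y > t} y * exp (- s * (Rd_norm d y)\<^sup>2)) *\<^sub>R f y \<partial>lb d) = 0"
    "integrable (lb d) (\<lambda>y. (indicator {y. Rd_norm d y > t} y * exp (- s * (Rd_norm d y)\<^sup>2)) *\<^sub>R f y)"
proof -
  note [measurable] = hom_poly_measurable[OF f(1)]
  obtain B where B: "\<And>x. norm (f x) \<le> B * Rd_norm d x ^ k" using hom_poly_bound[OF f(1)] by blast
  have I: "integrable (lb d) (\<lambda>y. exp (- s * (Rd_norm d y)\<^sup>2) *\<^sub>R f y)"
  proof -
    have "integrable (lb d) (\<lambda>y. f y * gauss_wave d (of_real s) (\<lambda>_. 0) y)"
      using s by (intro hom_poly_gauss_integrable[OF f(1)]) simp
    moreover have "f y * gauss_wave d (of_real s) (\<lambda>_. 0) y = exp (- s * (Rd_norm d y)\<^sup>2) *\<^sub>R f y" for y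
      by (simp add: gauss_wave_def Rd_dot_def scaleR_conv_of_real exp_of_real[symmetric])
    ultimately show ?thesis by simp
  qed
  have "integrable (lb d) (\<lambda>y. indicator {y \<in> space (lb d). Rd_norm d y > t} y *\<^sub>R (exp (- s * (Rd_norm d y)\<^sup>2) *\<^sub>R f y))"
    by (rule integrable_mult_indicator[OF _ I]) measurable
  then show int: "integrable (lb d) (\<lambda>y. (indicator {y. Rd_norm d y > t} y * exp (- s * (Rd_norm d y)\<^sup>2)) *\<^sub>R f y)"
    by (rule Bochner_Integration.integrable_cong[THEN iffD1, OF refl, rotated]) (auto simp: indicator_def)
  let ?\<phi> = "\<lambda>u. s * exp (- s * u) * indicator {t\<^sup>2<..} u :: real"
  have tail: "has_bochner_integral lborel (\<lambda>u. indicator {x<..} u * ?\<phi> u) (exp (- s * max x (t\<^sup>2)))" for x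
  proof -
    have eq: "(\<lambda>u. indicator {x<..} u * ?\<phi> u) = (\<lambda>u. indicator {max x (t\<^sup>2)<..} u * (s * exp (- s * u)))"
      by (auto simp: indicator_def)
    show ?thesis unfolding eq by (rule has_bochner_integral_exp_tail[OF s])
  qed
  have "(\<integral>y. (\<integral>u. indicator {(Rd_norm d y)\<^sup>2<..} u * ?\<phi> u \<partial>lborel) *\<^sub>R f y \<partial>lb d)
    = (\<integral>u. indicator {0<..} u * (u powr (real (d + k) / 2) * ?\<phi> u) \<partial>lborel)
       *\<^sub>R (\<integral>y. indicator {y. Rd_norm d y < 1} y *\<^sub>R f y \<partial>lb d)"
  proof (rule integral_radial_homogeneous)
    have "integrable lborel (\<lambda>u. s * (indicator {0<..} u * (u powr (real (d + k) / 2 + 1 - 1) * exp (- s * u))))"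
      using has_bochner_integral_Gamma[of "real (d + k) / 2 + 1" s] s
      by (intro integrable_mult_right) (simp add: has_bochner_integral_iff add_nonneg_pos)
    from integrable_mult_indicator[OF _ this, of "{t\<^sup>2<..}"]
    show "integrable lborel (\<lambda>u. indicator {0<..} u * (u powr (real (d + k) / 2) * ?\<phi> u))"
      by (simp add: mult_ac)
  qed (use hom_poly_scale[OF f(1)] harmonic_mean_zero_open_ball[OF f] in \<open>auto simp: scaleR_conv_of_real\<close>)
  then have "0 = (\<integral>y. exp (- s * max ((Rd_norm d y)\<^sup>2) (t\<^sup>2)) *\<^sub>R f y \<partial>lb d)"
    unfolding has_bochner_integral_integral_eq[OF tail] harmonic_mean_zero_open_ball(1)[OF f] by simp
  also have "(\<lambda>y. exp (- s * max ((Rd_norm d y)\<^sup>2) (t\<^sup>2)) *\<^sub>R f y)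
     = (\<lambda>y. (indicator {y. Rd_norm d y > t} y * exp (- s * (Rd_norm d y)\<^sup>2)) *\<^sub>R f y
         + exp (- s * t\<^sup>2) *\<^sub>R (indicator {y. Rd_norm d y \<le> t} y *\<^sub>R f y))"
  proof
    fix y
    have "(Rd_norm d y)\<^sup>2 \<le> t\<^sup>2 \<longleftrightarrow> Rd_norm d y \<le> t" using t by (simp add: power2_le_iff_abs_le)
    then show "exp (- s * max ((Rd_norm d y)\<^sup>2) (t\<^sup>2)) *\<^sub>R f y = (indicator {y. Rd_norm d y > t} y * exp (- s * (Rd_norm d y)\<^sup>2)) *\<^sub>R f y
         + exp (- s * t\<^sup>2) *\<^sub>R (indicator {y. Rd_norm d y \<le> t} y *\<^sub>R f y)"
      by (auto simp: indicator_def max_def)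
  qed
  also have "(\<integral>y. (indicator {y. Rd_norm d y > t} y * exp (- s * (Rd_norm d y)\<^sup>2)) *\<^sub>R f y
         + exp (- s * t\<^sup>2) *\<^sub>R (indicator {y. Rd_norm d y \<le> t} y *\<^sub>R f y) \<partial>lb d)
     = (\<integral>y. (indicator {y. Rd_norm d y > t} y * exp (- s * (Rd_norm d y)\<^sup>2)) *\<^sub>R f y \<partial>lb d)
      + exp (- s * t\<^sup>2) *\<^sub>R (\<integral>y. indicator {y. Rd_norm d y \<le> t} y *\<^sub>R f y \<partial>lb d)"
    by (subst Bochner_Integration.integral_add[OF int integrable_scaleR_right[OF hom_poly_integrable_ball[OF f(1)]]])
      (simp only: integral_scaleR_right)
  finally show "(\<integral>y. (indicator {y. Rd_norm d y > t} y * exp (- s * (Rd_norm d y)\<^sup>2)) *\<^sub>R f y \<partial>lb d) = 0"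
    by (simp add: harmonic_mean_zero_ball[OF f t])
qed

text \<open>On every line in a direction where \<open>f\<close> does not vanish, \<open>f\<close> is a nonzero polynomial, so that
  Fubini's theorem and translation invariance apply.\<close>

lemma hom_poly_AE_nonzero:
  assumes f: "hom_poly d k f" and z: "z \<in> Rd d" "f z \<noteq> 0"
  shows "AE x in lb d. f x \<noteq> 0"
proof -
  note [measurable] = hom_poly_measurable[OF f]
  interpret lb: sigma_finite_measure "lb d" by (rule sigma_finite_lb)
  interpret pair_sigma_finite lborel "lb d" ..
  let ?T = "\<lambda>t x. affine_map d (\<lambda>i. t * z i) 1 x"
  let ?Z = "{x \<in> space (lb d). f x = 0}"
  have T_eq: "?T t x = (\<lambda>i\<in>{..<d}. x i + t * z i)" for t x by (auto simp: affine_map_def)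
  have [measurable]: "(\<lambda>p. ?T (fst p) (snd p)) \<in> measurable (lborel \<Otimes>\<^sub>M lb d) (lb d)"
    unfolding T_eq by (rule measurable_restrict) (simp add: measurable_compose[OF measurable_snd])
  have fin: "finite {t. f (?T t x) = 0}" for x
  proof -
    obtain p where p: "\<And>t. f (?T t x) = poly p (of_real t)"
      using hom_poly_line[OF f, of x z] unfolding T_eq by blast
    obtain q where q: "\<And>t. f (\<lambda>i\<in>{..<d}. z i + t * x i) = poly q (of_real t)"
      using hom_poly_line[OF f, of z x] by blast
    have "p \<noteq> 0"
    proof
      assume "p = 0"
      \<comment> \<open>\<open>z + e * x\<close> is \<open>e\<close> times \<open>x + z / e\<close>,
        so by homogeneity a polynomial \<open>f\<close> vanishing along the line through
        \<open>x\<close> also vanishes along the line through \<open>z\<close> wherever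
        \<open>e \<noteq> 0\<close>. Then \<open>q\<close> is the zero polynomial, and
        \<open>e = 0\<close> gives \<open>f z = 0\<close>.\<close>
      have "poly q (of_real e) = 0" if "e \<noteq> 0" for e :: real
      proof -
        have "(\<lambda>i\<in>{..<d}. z i + e * x i) = affine_map d (\<lambda>_. 0) e (?T (1 / e) x)"
          using that by (auto simp: affine_map_def fun_eq_iff field_simps)
        then show ?thesis using p[of "1 / e"] \<open>p = 0\<close> by (simp add: q[symmetric] hom_poly_scale[OF f])
      qed
      then have "of_real ` (UNIV - {0::real}) \<subseteq> {x. poly q x = 0}" by auto
      moreover have "infinite (of_real ` (UNIV - {0::real}) :: complex set)"
        by (subst finite_image_iff) (auto simp: inj_on_def infinite_UNIV_char_0)
      ultimately have "q = 0" using poly_roots_finite finite_subset by blast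
      then have "f (\<lambda>i\<in>{..<d}. z i + 0 * x i) = 0" using q[of 0] by simp
      moreover have "(\<lambda>i\<in>{..<d}. z i + 0 * x i) = z" using z(1) by (auto simp: Rd_def PiE_iff extensional_def fun_eq_iff)
      ultimately show False using z(2) by simp
    qed
    then have "finite (of_real -` {x. poly p x = 0} :: real set)"
      by (intro finite_vimageI poly_roots_finite) (auto simp: inj_on_def)
    then show ?thesis by (simp add: p vimage_def)
  qed
  \<comment> \<open>The zero set is averaged over translations by \<open>t * z\<close> with
    \<open>t\<close> in the unit interval, which do not change its measure; after Fubini, each line
    in the direction \<open>z\<close> meets it in finitely many points.\<close>
  have "emeasure (lb d) ?Z = (\<integral>\<^sup>+t. indicator {0..1} t * emeasure (lb d) ?Z \<partial>(lborel :: real measure))"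
    by (simp add: nn_integral_multc)
  also have "\<dots> = (\<integral>\<^sup>+t. (\<integral>\<^sup>+x. indicator {0..1} t * indicator ?Z (?T t x) \<partial>lb d) \<partial>(lborel :: real measure))"
  proof (rule nn_integral_cong)
    fix t :: real
    have "emeasure (lb d) ?Z = (\<integral>\<^sup>+x. indicator ?Z x \<partial>lb d)" by (subst nn_integral_indicator) auto
    also have "\<dots> = (\<integral>\<^sup>+x. indicator ?Z (?T t x) \<partial>lb d)"
      using nn_integral_lb_affine[of 1 "indicator ?Z" d "\<lambda>i. t * z i"] by simp
    finally show "indicator {0..1} t * emeasure (lb d) ?Z = (\<integral>\<^sup>+x. indicator {0..1} t * indicator ?Z (?T t x) \<partial>lb d)"
      by (subst nn_integral_cmult) auto
  qed
  also have "\<dots> = (\<integral>\<^sup>+x. (\<integral>\<^sup>+t. indicator {0..1} t * indicator ?Z (?T t x) \<partial>(lborel :: real measure)) \<partial>lb d)"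
    by (rule Fubini'[symmetric]) measurable
  also have "\<dots> = (\<integral>\<^sup>+x. 0 \<partial>lb d)"
  proof (rule nn_integral_cong)
    fix x
    have null: "{t. f (?T t x) = 0} \<in> null_sets lborel"
      using fin[of x] by (rule finite_imp_null_set_lborel)
    have "AE t in lborel. indicator {0..1} t * indicator ?Z (?T t x) = (0::ennreal)"
      using AE_not_in[OF null] by eventually_elim (auto simp: indicator_def)
    then show "(\<integral>\<^sup>+t. indicator {0..1} t * indicator ?Z (?T t x) \<partial>(lborel :: real measure)) = 0"
      by (subst nn_integral_cong_AE[where v = "\<lambda>_. 0"]) auto
  qed
  finally have "emeasure (lb d) ?Z = 0" by simp
  then show ?thesis by (subst AE_iff_measurable[where N = ?Z]) auto
qed

section \<open>The Riesz transform of a superposition of plane waves\<close>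

lemma norm_integral_le:
  fixes f :: "'a \<Rightarrow> 'b::{banach, second_countable_topology}"
  assumes "integrable M f" "integrable M g" "\<And>x. x \<in> space M \<Longrightarrow> norm (f x) \<le> g x"
  shows "norm (\<integral>x. f x \<partial>M) \<le> (\<integral>x. g x \<partial>M)"
  by (rule order.trans[OF integral_norm_bound integral_mono]) (use assms in auto)

text \<open>Substitution of \<open>- q / v\<close> with negative \<open>v\<close> in Euler's
  integral; the sign makes the map increasing, as the substitution rule requires. With
  \<open>q\<close> a quarter of the squared frequency, this integral is the source of the
  denominator of the multiplier.\<close>

lemma has_bochner_integral_inverse_Gamma:
  fixes a q :: real
  assumes a: "a > 0" and q: "q > 0"
  shows "has_bochner_integral lborel (\<lambda>s. indicator {0<..} s * (s powr (- a - 1) * exp (- q / s))) (Gamma a * q powr (- a))"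
proof -
  let ?f = "\<lambda>s. s powr (- a - 1) * exp (- q / s)"
  let ?g = "\<lambda>v::real. - q / v" and ?g' = "\<lambda>v::real. q / v\<^sup>2"
  have "has_bochner_integral lborel (\<lambda>u. q powr (- a) * (indicator {0<..} u * (u powr (a - 1) * exp (- 1 * u)))) (q powr (- a) * (Gamma a / 1 powr a))"
    by (intro has_bochner_integral_mult_right has_bochner_integral_Gamma a) simp
  from lborel_has_bochner_integral_real_affine_iff[THEN iffD1, OF _ this, of "-1" 0]
  have G: "has_bochner_integral lborel (\<lambda>v. q powr (- a) * (indicator {0<..} (- v) * ((- v) powr (a - 1) * exp v))) (q powr (- a) * Gamma a)"
    by simp
  have fg: "?f (?g v) * ?g' v = q powr (- a) * ((- v) powr (a - 1) * exp v)" if "v < 0" for v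
  proof -
    have "- q / v = q / (- v)" by simp
    then have "(- q / v) powr (- a - 1) = q powr (- a - 1) / (- v) powr (- a - 1)"
      using that q by (simp only: powr_divide) 
    also have "\<dots> = (q powr (- a) / q) * ((- v) powr (a - 1) * v\<^sup>2)"
    proof -
      have "(- v) powr (a - 1) * v\<^sup>2 = (- v) powr (a - 1) * (- v) powr 2" using that by (simp add: powr_numeral)
      also have "\<dots> = (- v) powr (a + 1)" by (simp only: powr_add[symmetric]) (simp add: add.commute)
      also have "\<dots> = 1 / (- v) powr (- a - 1)"
        using powr_minus_divide[of "- v" "- a - 1"] by (simp add: add.commute)
      finally show ?thesis using q by (simp add: powr_diff)
    qed
    finally show ?thesis using that q by (simp add: field_simps)
  qed
  have e1: "einterval (-\<infinity>) 0 = {..<0::real}" and e2: "einterval 0 \<infinity> = {0<..}"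
    by (auto simp: einterval_def zero_ereal_def)
  have ind: "indicator {..<0::real} v *\<^sub>R (?f (?g v) * ?g' v) = q powr (- a) * (indicator {0<..} (- v) * ((- v) powr (a - 1) * exp v))" for v :: real
    by (cases "v < 0") (simp_all only: fg indicator_simps, auto simp: indicator_def)
  have int: "set_integrable lborel (einterval (-\<infinity>) 0) (\<lambda>v. ?f (?g v) * ?g' v)"
    using G unfolding set_integrable_def e1 ind by (simp add: has_bochner_integral_iff)
  have val: "(LBINT v=-\<infinity>..0. ?f (?g v) * ?g' v) = q powr (- a) * Gamma a"
    using G unfolding interval_lebesgue_integral_def set_lebesgue_integral_def e1 ind by (simp add: has_bochner_integral_iff)
  have D: "DERIV ?g v :> ?g' v" "isCont ?f (?g v)" "isCont ?g' v" "0 \<le> ?f (?g v)"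
    if "- \<infinity> < ereal v" "ereal v < 0" for v
  proof -
    have v: "v < 0" using that by simp
    show "DERIV ?g v :> ?g' v" using v by (auto intro!: derivative_eq_intros simp: power2_eq_square)
    show "isCont ?f (?g v)" using v q by (intro continuous_intros) (auto simp: divide_less_0_iff)
    show "isCont ?g' v" using v by (intro continuous_intros) auto
    show "0 \<le> ?f (?g v)" using q by auto
  qed
  have D': "0 \<le> ?g' v" for v using q by simp
  have "(?g \<longlongrightarrow> 0) at_bot" using q by real_asymp
  then have A: "((ereal \<circ> ?g \<circ> real_of_ereal) \<longlongrightarrow> 0) (at_right (-\<infinity>))"
    unfolding zero_ereal_def ereal_tendsto_simps .
  have "filterlim ?g at_top (at_left 0)" using q by real_asymp
  then have B: "((ereal \<circ> ?g \<circ> real_of_ereal) \<longlongrightarrow> \<infinity>) (at_left 0)"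
    unfolding zero_ereal_def ereal_tendsto_simps .
  have less: "- \<infinity> < (0::ereal)" by simp
  note s = interval_integral_substitution_nonneg[of "-\<infinity>" 0 ?g ?g' ?f, OF less D D' A B int]
  show ?thesis
    using s unfolding val unfolding set_integrable_def interval_lebesgue_integral_def set_lebesgue_integral_def e2
    by (simp add: has_bochner_integral_iff mult.commute)
qed

text \<open>The exponent is what the tail estimate for the scale parameter leaves:
  \<open>(M - 1) + (- M - 1 / 2)\<close>.\<close>

lemma integrable_powr_tail: "integrable lborel (\<lambda>s::real. indicator {1<..} s * s powr (- 3 / 2))"
proof (rule Bochner_Integration.integrable_bound)
  show "integrable lborel (\<lambda>s::real. exp 1 * (indicator {0<..} s * (s powr (- (1 / 2) - 1) * exp (- 1 / s))))"
    using has_bochner_integral_inverse_Gamma[of "1 / 2" 1] by (intro integrable_mult_right) (simp add: has_bochner_integral_iff)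
  show "AE s::real in lborel. norm (indicator {1<..} s * s powr (- 3 / 2)) \<le> norm (exp 1 * (indicator {0<..} s * (s powr (- (1 / 2) - 1) * exp (- 1 / s))))"
  proof (intro always_eventually allI)
    fix s :: real
    show "norm (indicator {1<..} s * s powr (- 3 / 2)) \<le> norm (exp 1 * (indicator {0<..} s * (s powr (- (1 / 2) - 1) * exp (- 1 / s))))"
    proof (cases "s > 1")
      case True
      then have "1 \<le> exp 1 * exp (- 1 / s)" by (simp add: exp_add[symmetric])
      from mult_left_mono[OF this, of "s powr (- 3 / 2)"] True show ?thesis by (simp add: mult_ac abs_mult)
    qed simp
  qed
qed measurable

lemma integrable_powr_head:
  assumes "M > 0"
  shows "integrable lborel (\<lambda>s::real. indicator {0<..1} s * s powr (M - 1))"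
proof (rule Bochner_Integration.integrable_bound)
  show "integrable lborel (\<lambda>s::real. exp 1 * (indicator {0<..} s * (s powr (M - 1) * exp (- 1 * s))))"
    using has_bochner_integral_Gamma[OF assms, of 1] by (intro integrable_mult_right) (simp add: has_bochner_integral_iff)
  show "AE s in lborel. norm (indicator {0<..1} s * s powr (M - 1)) \<le> norm (exp 1 * (indicator {0<..} s * (s powr (M - 1) * exp (- 1 * s))))"
  proof (intro always_eventually allI)
    fix s :: real
    show "norm (indicator {0<..1} s * s powr (M - 1)) \<le> norm (exp 1 * (indicator {0<..} s * (s powr (M - 1) * exp (- 1 * s))))"
    proof (cases "0 < s \<and> s \<le> 1")
      case True
      then have "1 \<le> exp 1 * exp (- 1 * s)" by (simp add: exp_add[symmetric])
      from mult_left_mono[OF this, of "s powr (M - 1)"] True show ?thesis by (simp add: mult_ac abs_mult)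
    qed (auto simp: indicator_def)
  qed
qed measurable

section \<open>Removing the truncation of the kernel\<close>

lemma Rd_diff_affine: "Rd_diff d x y = affine_map d x (- 1) y"
  by (auto simp: Rd_diff_def affine_map_def)

lemma measurable_Rd_diff [measurable]: "Rd_diff d x \<in> measurable (lb d) (lb d)"
  unfolding Rd_diff_affine[abs_def] by measurable

text \<open>The definition integrates over the completion \<open>leb d\<close>. For an integrand
  measurable with respect to the product measure both integrals agree, and on the product measure
  Fubini's theorem is directly available.\<close>

lemma riesz_trunc_lb:
  assumes [measurable]: "P \<in> borel_measurable (lb d)" "(\<lambda>y. f (Rd_diff d x y)) \<in> borel_measurable (lb d)"
  shows "riesz_trunc d k P t f x = of_real (riesz_const k d) *
     (\<integral>y. indicator {y. Rd_norm d y > t} y *\<^sub>R (P y / of_real (Rd_norm d y ^ (d + k)) * f (Rd_diff d x y)) \<partial>lb d)"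
proof -
  have "(LINT y:{y \<in> Rd d. Rd_norm d y > t}|leb d. P y / of_real (Rd_norm d y ^ (d + k)) * f (Rd_diff d x y))
     = (\<integral>y. indicator {y \<in> space (lb d). Rd_norm d y > t} y *\<^sub>R (P y / of_real (Rd_norm d y ^ (d + k)) * f (Rd_diff d x y)) \<partial>lb d)"
    unfolding set_lebesgue_integral_def leb_def space_lb[symmetric] by (rule integral_completion) measurable
  also have "\<dots> = (\<integral>y. indicator {y. Rd_norm d y > t} y *\<^sub>R (P y / of_real (Rd_norm d y ^ (d + k)) * f (Rd_diff d x y)) \<partial>lb d)"
    by (rule Bochner_Integration.integral_cong) (auto simp: indicator_def)
  finally show ?thesis by (simp add: riesz_trunc_def)
qed

text \<open>Writing \<open>|y| powr - (d + k)\<close> as a superposition of Gaussians \<open>exp (- s |y|\<^sup>2)\<close> gives absolute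
  convergence: for \<open>s > 1\<close> the constant \<open>b = g 0\<close> may be subtracted from \<open>g\<close>, as \<open>P\<close> has mean zero.\<close>

lemma harmonic_kernel_trunc_tendsto:
  fixes g :: "(nat \<Rightarrow> real) \<Rightarrow> complex"
  assumes M_def: "M = real (d + k) / 2"
    and P: "hom_poly d k P" "harmonic d P" "k \<ge> 1"
    and [measurable]: "g \<in> borel_measurable (lb d)"
    and int: "integrable (lb d) (\<lambda>y. P y * g y)"
    and lip: "\<And>y. y \<in> Rd d \<Longrightarrow> norm (g y - b) \<le> L * Rd_norm d y"
  shows "((\<lambda>t. \<integral>y. indicator {y. Rd_norm d y > t} y *\<^sub>R (P y / of_real (Rd_norm d y ^ (d + k)) * g y) \<partial>lb d)
    \<longlongrightarrow> of_real (1 / Gamma M) * (\<integral>s. (indicator {0<..} s * s powr (M - 1)) *\<^sub>R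
       (\<integral>y. exp (- s * (Rd_norm d y)\<^sup>2) *\<^sub>R (P y * g y) \<partial>lb d) \<partial>lborel)) (at_right 0)"
proof -
  define A where "A = (\<lambda>t s. \<integral>y. (indicator {y. Rd_norm d y > t} y * exp (- s * (Rd_norm d y)\<^sup>2)) *\<^sub>R (P y * g y) \<partial>lb d)"
  interpret lb: sigma_finite_measure "lb d" by (rule sigma_finite_lb)
  interpret pair_sigma_finite "lb d" lborel ..
  note [measurable] = hom_poly_measurable[OF P(1)]
  obtain B where B: "B \<ge> 0" "\<And>x. norm (P x) \<le> B * Rd_norm d x ^ k" using hom_poly_bound[OF P(1)] by blast
  have M: "M > 0" using P(3) by (simp add: M_def)
  have GM: "Gamma M > 0" using M by (rule Gamma_real_pos)
  have rM: "((Rd_norm d y)\<^sup>2) powr M = Rd_norm d y ^ (d + k)" if "Rd_norm d y > 0" for y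
    by (rule Rd_norm_power2_powr[OF that]) (simp add: M_def)
  let ?w = "\<lambda>s. indicator {0<..} s * s powr (M - 1)"
  \<comment> \<open>For fixed \<open>t > 0\<close> the kernel is bounded on the domain, so Fubini
    needs no cancellation; uniformity in \<open>t\<close> is left to the bounds on
    \<open>A t s\<close>.\<close>
  have swap: "(\<integral>y. indicator {y. Rd_norm d y > t} y *\<^sub>R (P y / of_real (Rd_norm d y ^ (d + k)) * g y) \<partial>lb d)
      = of_real (1 / Gamma M) * (\<integral>s. ?w s *\<^sub>R A t s \<partial>lborel)" if t: "t > 0" for t
  proof -
    let ?h = "\<lambda>y s. (?w s * (indicator {y. Rd_norm d y > t} y * exp (- s * (Rd_norm d y)\<^sup>2))) *\<^sub>R (P y * g y)"
    have G: "has_bochner_integral lborel (\<lambda>s. ?w s * (indicator {y. Rd_norm d y > t} y * exp (- s * (Rd_norm d y)\<^sup>2)))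
        (indicator {y. Rd_norm d y > t} y * (Gamma M / Rd_norm d y ^ (d + k)))" for y
    proof (cases "Rd_norm d y > t")
      case True
      then have "Rd_norm d y > 0" using t by linarith
      then show ?thesis
        using True has_bochner_integral_Gamma[OF M, of "(Rd_norm d y)\<^sup>2"] rM[of y] by (simp add: mult_ac)
    qed (simp add: has_bochner_integral_iff)
    have [measurable]: "(\<lambda>(y, s). ?h y s) \<in> borel_measurable (lb d \<Otimes>\<^sub>M lborel)"
      by measurable
    have inner: "(\<integral>s. ?h y s \<partial>lborel) = of_real (Gamma M) * (indicator {y. Rd_norm d y > t} y *\<^sub>R (P y / of_real (Rd_norm d y ^ (d + k)) * g y))" for y
    proof -
      have "(\<integral>s. ?h y s \<partial>lborel) = (indicator {y. Rd_norm d y > t} y * (Gamma M / Rd_norm d y ^ (d + k))) *\<^sub>R (P y * g y)"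
        using has_bochner_integral_scaleR_left[OF G[of y], of "P y * g y"] by (rule has_bochner_integral_integral_eq)
      also have "\<dots> = of_real (Gamma M) * (indicator {y. Rd_norm d y > t} y *\<^sub>R (P y / of_real (Rd_norm d y ^ (d + k)) * g y))"
        by (simp add: scaleR_conv_of_real mult_ac)
      finally show ?thesis .
    qed
    have "integrable (lb d \<Otimes>\<^sub>M lborel) (\<lambda>(y, s). ?h y s)"
    proof (rule Fubini_integrable)
      have "(\<integral>s. norm (?h y s) \<partial>lborel) = indicator {y. Rd_norm d y > t} y * (Gamma M / Rd_norm d y ^ (d + k)) * norm (P y * g y)" for y
      proof -
        have "norm (?h y s) = (?w s * (indicator {y. Rd_norm d y > t} y * exp (- s * (Rd_norm d y)\<^sup>2))) *\<^sub>R norm (P y * g y)" for s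
          by (simp add: abs_mult)
        then show ?thesis
          using has_bochner_integral_integral_eq[OF has_bochner_integral_scaleR_left[OF G[of y], of "norm (P y * g y)"]] by simp
      qed
      then have eq: "(\<integral>s. norm (case (y, s) of (y, s) \<Rightarrow> ?h y s) \<partial>lborel) = indicator {y. Rd_norm d y > t} y * (Gamma M / Rd_norm d y ^ (d + k)) * norm (P y * g y)" for y
        by simp
      show "integrable (lb d) (\<lambda>y. \<integral>s. norm (case (y, s) of (y, s) \<Rightarrow> ?h y s) \<partial>lborel)"
        unfolding eq
      proof (rule Bochner_Integration.integrable_bound)
        show "integrable (lb d) (\<lambda>y. Gamma M / t ^ (d + k) * norm (P y * g y))"
          using int by (intro integrable_mult_right integrable_norm)
        show "AE y in lb d. norm (indicator {y. Rd_norm d y > t} y * (Gamma M / Rd_norm d y ^ (d + k)) * norm (P y * g y)) \<le> norm (Gamma M / t ^ (d + k) * norm (P y * g y))"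
        proof (intro always_eventually allI)
          fix y
          show "norm (indicator {y. Rd_norm d y > t} y * (Gamma M / Rd_norm d y ^ (d + k)) * norm (P y * g y)) \<le> norm (Gamma M / t ^ (d + k) * norm (P y * g y))"
          proof (cases "Rd_norm d y > t")
            case True
            then have "Gamma M / Rd_norm d y ^ (d + k) \<le> Gamma M / t ^ (d + k)"
              using t GM by (intro divide_left_mono power_mono mult_pos_pos zero_less_power) auto
            from mult_right_mono[OF this, of "norm (P y * g y)"] True t GM show ?thesis by (simp add: abs_mult)
          qed simp
        qed
      qed measurable
      show "AE y in lb d. integrable lborel (\<lambda>s. case (y, s) of (y, s) \<Rightarrow> ?h y s)"
        unfolding split_conv
        by (intro always_eventually allI integrable.intros[OF has_bochner_integral_scaleR_left[OF G]])
    qed measurable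
    note I = this
    have "(\<integral>s. ?w s *\<^sub>R A t s \<partial>lborel) = (\<integral>s. (\<integral>y. ?h y s \<partial>lb d) \<partial>lborel)"
      by (simp only: A_def integral_scaleR_right[symmetric] scaleR_scaleR)
    also have "\<dots> = (\<integral>y. (\<integral>s. ?h y s \<partial>lborel) \<partial>lb d)"
      using Fubini_integral[OF I] by simp
    also have "\<dots> = of_real (Gamma M) * (\<integral>y. indicator {y. Rd_norm d y > t} y *\<^sub>R (P y / of_real (Rd_norm d y ^ (d + k)) * g y) \<partial>lb d)"
      unfolding inner by (rule integral_mult_right_zero)
    finally show ?thesis using GM by (simp add: field_simps)
  qed
  define K where "K = (\<integral>y. norm (P y * g y) \<partial>lb d)"
  define K' where "K' = \<bar>L\<bar> * B * (pi powr (d / 2) * Gamma (real (d + (k + 1)) / 2) / Gamma (d / 2))"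
  \<comment> \<open>\<open>integral_norm_power_gauss\<close> needs positive dimension; in dimension
    0 the norm is 0, so that \<open>P\<close> vanishes.\<close>
  have d: "d > 0 \<or> (\<forall>x. P x = 0)"
  proof (cases "d > 0")
    case False
    then have "P x = 0" for x using B(2)[of x] P(3) by (simp add: power_0_left Rd_norm_def)
    then show ?thesis by simp
  qed simp
  have A_head: "norm (A t s) \<le> K" if "s > 0" for t s
    unfolding A_def K_def
  proof (rule norm_integral_le)
    show "integrable (lb d) (\<lambda>y. norm (P y * g y))" using int by simp
    have "integrable (lb d) (\<lambda>y. (indicator {y. Rd_norm d y > t} y * exp (- s * (Rd_norm d y)\<^sup>2)) *\<^sub>R (P y * g y))"
      by (rule Bochner_Integration.integrable_bound[OF int])
        (measurable, use that in \<open>auto simp: indicator_def mult_left_le_one_le\<close>)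
    then show "integrable (lb d) (\<lambda>y. (indicator {y. Rd_norm d y > t} y * exp (- s * (Rd_norm d y)\<^sup>2)) *\<^sub>R (P y * g y))" .
    show "norm ((indicator {y. Rd_norm d y > t} y * exp (- s * (Rd_norm d y)\<^sup>2)) *\<^sub>R (P y * g y)) \<le> norm (P y * g y)" for y
      using that by (auto simp: indicator_def mult_left_le_one_le)
  qed
  \<comment> \<open>A direct estimate would give \<open>s powr (- M)\<close>, and the integral over
    \<open>s\<close> would diverge logarithmically. Subtracting \<open>b\<close> gains one factor
    \<open>Rd_norm d y\<close>, that is \<open>s powr (- 1 / 2)\<close>.\<close>
  have A_tail: "norm (A t s) \<le> K' * s powr (- M - 1 / 2)" if s: "s > 0" and t: "t \<ge> 0" for t s
  proof (cases "d > 0")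
    case True
    have int_t: "integrable (lb d) (\<lambda>y. (indicator {y. Rd_norm d y > t} y * exp (- s * (Rd_norm d y)\<^sup>2)) *\<^sub>R (P y * g y))"
      by (rule Bochner_Integration.integrable_bound[OF int])
        (measurable, use s in \<open>auto simp: indicator_def mult_left_le_one_le\<close>)
    note Z = harmonic_mean_zero_gauss_trunc[OF P s t]
    have Zb: "integrable (lb d) (\<lambda>y. b * ((indicator {y. Rd_norm d y > t} y * exp (- s * (Rd_norm d y)\<^sup>2)) *\<^sub>R P y))"
      using Z(2) by (rule integrable_mult_right)
    have "A t s = A t s - b * (\<integral>y. (indicator {y. Rd_norm d y > t} y * exp (- s * (Rd_norm d y)\<^sup>2)) *\<^sub>R P y \<partial>lb d)"
      unfolding Z(1) by simp
    also have "\<dots> = (\<integral>y. (indicator {y. Rd_norm d y > t} y * exp (- s * (Rd_norm d y)\<^sup>2)) *\<^sub>R (P y * g y)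
        - b * ((indicator {y. Rd_norm d y > t} y * exp (- s * (Rd_norm d y)\<^sup>2)) *\<^sub>R P y) \<partial>lb d)"
      unfolding A_def by (subst Bochner_Integration.integral_diff[OF int_t Zb]) (simp only: integral_mult_right_zero)
    finally have "norm (A t s) = norm (\<integral>y. (indicator {y. Rd_norm d y > t} y * exp (- s * (Rd_norm d y)\<^sup>2)) *\<^sub>R (P y * g y)
        - b * ((indicator {y. Rd_norm d y > t} y * exp (- s * (Rd_norm d y)\<^sup>2)) *\<^sub>R P y) \<partial>lb d)" by simp
    also have "\<dots> \<le> (\<integral>y. \<bar>L\<bar> * B * (Rd_norm d y ^ (k + 1) * exp (- s * (Rd_norm d y)\<^sup>2)) \<partial>lb d)"
    proof (rule norm_integral_le)
      show "integrable (lb d) (\<lambda>y. (indicator {y. Rd_norm d y > t} y * exp (- s * (Rd_norm d y)\<^sup>2)) *\<^sub>R (P y * g y)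
        - b * ((indicator {y. Rd_norm d y > t} y * exp (- s * (Rd_norm d y)\<^sup>2)) *\<^sub>R P y))"
        by (intro Bochner_Integration.integrable_diff int_t Zb)
      show "integrable (lb d) (\<lambda>y. \<bar>L\<bar> * B * (Rd_norm d y ^ (k + 1) * exp (- s * (Rd_norm d y)\<^sup>2)))"
        by (intro integrable_mult_right integrable_norm_power_gauss s)
      fix y assume "y \<in> space (lb d)"
      then have y: "y \<in> Rd d" by (simp add: space_lb)
      have "(indicator {y. Rd_norm d y > t} y * exp (- s * (Rd_norm d y)\<^sup>2)) *\<^sub>R (P y * g y)
        - b * ((indicator {y. Rd_norm d y > t} y * exp (- s * (Rd_norm d y)\<^sup>2)) *\<^sub>R P y)
        = (indicator {y. Rd_norm d y > t} y * exp (- s * (Rd_norm d y)\<^sup>2)) *\<^sub>R (P y * (g y - b))"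
        by (simp add: scaleR_conv_of_real algebra_simps)
      also have "norm \<dots> \<le> exp (- s * (Rd_norm d y)\<^sup>2) * norm (P y * (g y - b))"
        by (auto simp: indicator_def)
      also have "\<dots> \<le> exp (- s * (Rd_norm d y)\<^sup>2) * ((B * Rd_norm d y ^ k) * (\<bar>L\<bar> * Rd_norm d y))"
      proof (intro mult_left_mono)
        have "norm (g y - b) \<le> \<bar>L\<bar> * Rd_norm d y"
          using lip[OF y] by (rule order.trans) (intro mult_right_mono, auto)
        then show "norm (P y * (g y - b)) \<le> (B * Rd_norm d y ^ k) * (\<bar>L\<bar> * Rd_norm d y)"
          unfolding norm_mult using B by (intro mult_mono) auto
      qed simp
      finally show "norm ((indicator {y. Rd_norm d y > t} y * exp (- s * (Rd_norm d y)\<^sup>2)) *\<^sub>R (P y * g y)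
        - b * ((indicator {y. Rd_norm d y > t} y * exp (- s * (Rd_norm d y)\<^sup>2)) *\<^sub>R P y)) \<le> \<bar>L\<bar> * B * (Rd_norm d y ^ (k + 1) * exp (- s * (Rd_norm d y)\<^sup>2))"
        by (simp add: mult_ac)
    qed
    also have "\<dots> = K' * s powr (- M - 1 / 2)"
    proof -
      have "- M - 1 / 2 = - (real (d + (k + 1)) / 2)" by (simp add: M_def field_simps)
      then have e: "s powr (- M - 1 / 2) = 1 / s powr (real (d + (k + 1)) / 2)"
        by (simp only: powr_minus_divide)
      show ?thesis
        unfolding integral_mult_right_zero integral_norm_power_gauss[OF True s] e K'_def by (simp add: mult_ac)
    qed
    finally show ?thesis .
  next
    case False
    then have "P x = 0" for x using d by simp
    then have "A t s = 0" by (simp add: A_def)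
    moreover have "K' * s powr (- M - 1 / 2) \<ge> 0"
      unfolding K'_def using B(1) False by simp
    ultimately show ?thesis by simp
  qed
  have w_head: "?w s = indicator {0<..1} s * s powr (M - 1) + indicator {1<..} s * s powr (M - 1)" for s
    by (auto simp: indicator_def)
  let ?D = "\<lambda>s. K * (indicator {0<..1} s * s powr (M - 1)) + K' * (indicator {1<..} s * s powr (- 3 / 2))"
  have D_int: "integrable lborel ?D"
    by (intro Bochner_Integration.integrable_add integrable_mult_right integrable_powr_head integrable_powr_tail M)
  have D_bd: "norm (?w s *\<^sub>R A t s) \<le> ?D s" if t: "t \<ge> 0" for t s
  proof -
    consider "s \<le> 0" | "0 < s" "s \<le> 1" | "1 < s" by linarith
    then show ?thesis
    proof cases
      case 2
      then show ?thesis using mult_left_mono[OF A_head[of s t], of "s powr (M - 1)"] by (simp add: mult_ac)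
    next
      case 3
      have "s powr (M - 1) * norm (A t s) \<le> s powr (M - 1) * (K' * s powr (- M - 1 / 2))"
        by (intro mult_left_mono A_tail) (use 3 t in auto)
      also have "\<dots> = K' * s powr ((M - 1) + (- M - 1 / 2))" by (simp only: powr_add mult_ac)
      also have "(M - 1) + (- M - 1 / 2) = - 3 / 2" by simp
      finally show ?thesis using 3 by simp
    qed simp
  qed
  have A_lim: "(\<lambda>n. A (S n) s) \<longlonglongrightarrow> (\<integral>y. exp (- s * (Rd_norm d y)\<^sup>2) *\<^sub>R (P y * g y) \<partial>lb d)"
    if S: "S \<longlonglongrightarrow> 0" "\<And>n. S n > 0" and s: "s > 0" for S s
    unfolding A_def
  proof (rule integral_dominated_convergence[where w = "\<lambda>y. norm (P y * g y)"])
    show "integrable (lb d) (\<lambda>y. norm (P y * g y))" using int by simp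
    show "AE y in lb d. norm ((indicator {y. Rd_norm d y > S n} y * exp (- s * (Rd_norm d y)\<^sup>2)) *\<^sub>R (P y * g y)) \<le> norm (P y * g y)" for n
      using s by (auto simp: indicator_def mult_left_le_one_le)
    show "AE y in lb d. (\<lambda>n. (indicator {y. Rd_norm d y > S n} y * exp (- s * (Rd_norm d y)\<^sup>2)) *\<^sub>R (P y * g y))
       \<longlonglongrightarrow> exp (- s * (Rd_norm d y)\<^sup>2) *\<^sub>R (P y * g y)"
    proof (intro always_eventually allI)
      fix y
      show "(\<lambda>n. (indicator {y. Rd_norm d y > S n} y * exp (- s * (Rd_norm d y)\<^sup>2)) *\<^sub>R (P y * g y))
       \<longlonglongrightarrow> exp (- s * (Rd_norm d y)\<^sup>2) *\<^sub>R (P y * g y)"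
      proof (cases "Rd_norm d y > 0")
        case True
        then have "\<forall>\<^sub>F n in sequentially. S n < Rd_norm d y" using order_tendstoD(2)[OF S(1)] by simp
        then have "\<forall>\<^sub>F n in sequentially. (indicator {y. Rd_norm d y > S n} y * exp (- s * (Rd_norm d y)\<^sup>2)) *\<^sub>R (P y * g y)
            = exp (- s * (Rd_norm d y)\<^sup>2) *\<^sub>R (P y * g y)"
          by eventually_elim simp
        then show ?thesis by (rule tendsto_eventually)
      next
        case False
        then have "Rd_norm d y = 0" using Rd_norm_nonneg[of d y] by linarith
        then have "P y = 0" using B(2)[of y] P(3) by (simp add: power_0_left)
        then show ?thesis by simp
      qed
    qed
  qed measurable
  have A_meas: "A t \<in> borel_measurable borel" for t
    unfolding A_def by (rule lb.borel_measurable_lebesgue_integral) measurable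
  have A0_meas: "(\<lambda>s. \<integral>y. exp (- s * (Rd_norm d y)\<^sup>2) *\<^sub>R (P y * g y) \<partial>lb d) \<in> borel_measurable borel"
    by (rule lb.borel_measurable_lebesgue_integral) measurable
  show ?thesis
  proof (rule tendsto_at_right_sequentially[of 0 1])
    fix S :: "nat \<Rightarrow> real"
    assume S: "\<And>n. 0 < S n" "S \<longlonglongrightarrow> 0"
    have "(\<lambda>n. \<integral>s. ?w s *\<^sub>R A (S n) s \<partial>lborel) \<longlonglongrightarrow> (\<integral>s. ?w s *\<^sub>R (\<integral>y. exp (- s * (Rd_norm d y)\<^sup>2) *\<^sub>R (P y * g y) \<partial>lb d) \<partial>lborel)"
    proof (rule integral_dominated_convergence[OF _ _ D_int])
      show "AE s in lborel. (\<lambda>n. ?w s *\<^sub>R A (S n) s) \<longlonglongrightarrow> ?w s *\<^sub>R (\<integral>y. exp (- s * (Rd_norm d y)\<^sup>2) *\<^sub>R (P y * g y) \<partial>lb d)"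
      proof (intro always_eventually allI)
        fix s :: real
        show "(\<lambda>n. ?w s *\<^sub>R A (S n) s) \<longlonglongrightarrow> ?w s *\<^sub>R (\<integral>y. exp (- s * (Rd_norm d y)\<^sup>2) *\<^sub>R (P y * g y) \<partial>lb d)"
        proof (cases "s > 0")
          case True
          show ?thesis by (intro tendsto_scaleR tendsto_const A_lim S True)
        qed simp
      qed
      show "AE s in lborel. norm (?w s *\<^sub>R A (S n) s) \<le> ?D s" for n
        using D_bd[of "S n"] S(1)[of n] by (intro always_eventually allI) simp
    qed (use A_meas A0_meas in measurable)
    then show "(\<lambda>n. \<integral>y. indicator {y. Rd_norm d y > S n} y *\<^sub>R (P y / of_real (Rd_norm d y ^ (d + k)) * g y) \<partial>lb d)
      \<longlonglongrightarrow> of_real (1 / Gamma M) * (\<integral>s. ?w s *\<^sub>R (\<integral>y. exp (- s * (Rd_norm d y)\<^sup>2) *\<^sub>R (P y * g y) \<partial>lb d) \<partial>lborel)"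
      unfolding swap[OF S(1)] by (intro tendsto_mult tendsto_const)
  qed simp
qed

text \<open>The Fourier multiplier of the Riztransform \<open>riesz d k P\<close> for
  \<open>k \<ge> 1\<close>; at the origin division by zero gives the value 0.\<close>

definition riesz_mult :: "nat \<Rightarrow> nat \<Rightarrow> ((nat \<Rightarrow> real) \<Rightarrow> complex) \<Rightarrow> (nat \<Rightarrow> real) \<Rightarrow> complex" where
  "riesz_mult d k P \<xi> = (- \<i>) ^ k * P \<xi> / of_real (Rd_norm d \<xi> ^ k)"

section \<open>Plane waves under the Riesz transform\<close>

definition plane_wave :: "nat \<Rightarrow> (nat \<Rightarrow> real) \<Rightarrow> (nat \<Rightarrow> real) \<Rightarrow> complex" where
  "plane_wave d \<xi> x = exp (\<i> * of_real (Rd_dot d \<xi> x))"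

lemma norm_plane_wave [simp]: "norm (plane_wave d \<xi> x) = 1"
  by (simp add: plane_wave_def)

lemma abs_Rd_dot_le: "\<bar>Rd_dot d x y\<bar> \<le> Rd_norm d x * Rd_norm d y"
proof -
  have "\<bar>Rd_dot d x y\<bar> \<le> (\<Sum>i<d. \<bar>x i\<bar> * \<bar>y i\<bar>)"
    unfolding Rd_dot_def abs_mult[symmetric] by (rule sum_abs)
  also have "\<dots> \<le> L2_set x {..<d} * L2_set y {..<d}" by (rule L2_set_mult_ineq)
  finally show ?thesis by (simp add: Rd_norm_def)
qed

lemma Rd_dot_Rd_diff: "Rd_dot d \<xi> (Rd_diff d x y) = Rd_dot d \<xi> x - Rd_dot d \<xi> y"
  by (simp add: Rd_dot_def Rd_diff_def sum_subtractf right_diff_distrib)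

lemma plane_wave_Rd_diff: "plane_wave d \<xi> (Rd_diff d x y) = plane_wave d \<xi> x * exp (- \<i> * of_real (Rd_dot d \<xi> y))"
  by (simp add: plane_wave_def Rd_dot_Rd_diff exp_add[symmetric] right_diff_distrib)

lemma plane_wave_lipschitz: "norm (plane_wave d \<xi> (Rd_diff d x y) - plane_wave d \<xi> x) \<le> Rd_norm d \<xi> * Rd_norm d y"
proof -
  have "plane_wave d \<xi> (Rd_diff d x y) - plane_wave d \<xi> x = plane_wave d \<xi> x * (exp (\<i> * of_real (- Rd_dot d \<xi> y)) - 1)"
    by (simp add: plane_wave_Rd_diff algebra_simps)
  then have "norm (plane_wave d \<xi> (Rd_diff d x y) - plane_wave d \<xi> x) = norm (exp (\<i> * of_real (- Rd_dot d \<xi> y)) - 1)"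
    by (simp add: norm_mult)
  also have "\<dots> \<le> \<bar>- Rd_dot d \<xi> y\<bar>"
    unfolding dist_exp_i_1 using abs_sin_x_le_abs_x[of "- Rd_dot d \<xi> y / 2"] by simp
  also have "\<dots> \<le> Rd_norm d \<xi> * Rd_norm d y" using abs_Rd_dot_le by simp
  finally show ?thesis .
qed

lemma Rd_norm_zero_hom_poly:
  assumes "hom_poly d k P" "k \<ge> 1" "Rd_norm d x = 0"
  shows "P x = 0"
proof -
  obtain B where "norm (P x) \<le> B * Rd_norm d x ^ k" using hom_poly_bound[OF assms(1)] by blast
  then show ?thesis using assms(2,3) by (simp add: power_0_left)
qed

lemma gauss_const_of_real:
  assumes "s > 0"
  shows "gauss_const (of_real s) = of_real (sqrt (pi / s))"
proof -
  have "exp (- of_real s * of_real (y\<^sup>2)) = (of_real (exp (- s * y\<^sup>2)) :: complex)" for y :: real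
    unfolding exp_of_real[symmetric] by simp
  then have "gauss_const (of_real s) = of_real (\<integral>y. exp (- s * y\<^sup>2) \<partial>lborel)"
    unfolding gauss_const_def by (simp only: integral_complex_of_real)
  then show ?thesis using has_bochner_integral_gauss_real[OF assms] by (simp add: has_bochner_integral_iff)
qed

text \<open>Hecke's formula for a real Gaussian: \<open>gauss_const s ^ d\<close> contributes
  \<open>s powr (- d / 2)\<close> and the factor of degree \<open>k\<close> contributes
  \<open>s powr (- k)\<close>.\<close>

lemma plane_wave_gauss_transform:
  fixes s :: real
  assumes P: "hom_poly d k P" "harmonic d P" and s: "s > 0" and \<xi>: "\<xi> \<in> Rd d"
  shows "(\<integral>y. exp (- s * (Rd_norm d y)\<^sup>2) *\<^sub>R (P y * plane_wave d \<xi> (Rd_diff d x y)) \<partial>lb d)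
    = of_real (pi powr (d / 2) / 2 ^ k * (s powr (- (real d / 2) - k) * exp (- ((Rd_norm d \<xi>)\<^sup>2 / 4) / s))) * ((- \<i>) ^ k * P \<xi> * plane_wave d \<xi> x)"
proof -
  have e: "exp (- s * (Rd_norm d y)\<^sup>2) *\<^sub>R (P y * plane_wave d \<xi> (Rd_diff d x y)) = plane_wave d \<xi> x * (P y * gauss_wave d (of_real s) \<xi> y)" for y
  proof -
    have "gauss_wave d (of_real s) \<xi> y = of_real (exp (- s * (Rd_norm d y)\<^sup>2)) * exp (- \<i> * of_real (Rd_dot d \<xi> y))"
      unfolding exp_of_real[symmetric] exp_add[symmetric] gauss_wave_def by simp
    then show ?thesis unfolding plane_wave_Rd_diff scaleR_conv_of_real by (simp only: mult_ac)
  qed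
  have "gauss_const (of_real s) ^ d = of_real (pi powr (d / 2) * s powr (- (real d / 2)))"
  proof -
    have "sqrt (pi / s) ^ d = (pi / s) powr (d / 2)"
      using s by (simp add: powr_half_sqrt[symmetric] powr_power)
    also have "\<dots> = pi powr (d / 2) * s powr (- (real d / 2))"
      using s by (simp add: powr_divide powr_minus_divide)
    finally show ?thesis unfolding gauss_const_of_real[OF s] of_real_power[symmetric] by simp
  qed
  moreover have "exp (- of_real ((Rd_norm d \<xi>)\<^sup>2) / (4 * of_real s)) = (of_real (exp (- ((Rd_norm d \<xi>)\<^sup>2 / 4) / s)) :: complex)"
    unfolding exp_of_real[symmetric] by simp
  moreover have "(- \<i> / (2 * of_real s)) ^ k = of_real (s powr (- real k) / 2 ^ k) * (- \<i>) ^ k"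
    unfolding power_divide power_mult_distrib using s by (simp add: powr_minus_divide powr_realpow)
  moreover have "s powr (- (real d / 2) - k) = s powr (- (real d / 2)) * s powr (- real k)"
    by (simp add: powr_add[symmetric])
  ultimately show ?thesis
    unfolding e integral_mult_right_zero Hecke[OF P, of "of_real s", simplified, OF s \<xi>]
    by (simp add: mult_ac)
qed

text \<open>The kernel is a superposition of Gaussians of scale \<open>s\<close>; Hecke's formula
  evaluates each of them on each wave, and the integral over \<open>s\<close> produces the
  multiplier. The measure space of frequencies is left abstract because it will consist of pairs of
  a frequency and a Gaussian perturbation of it.\<close>

theorem riesz_plane_waves:
  fixes N :: "'j measure" and c :: "'j \<Rightarrow> complex" and \<xi> :: "'j \<Rightarrow> nat \<Rightarrow> real"
  assumes P: "hom_poly d k P" "harmonic d P" "k \<ge> 1" and d: "d > 0"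
    and N: "sigma_finite_measure N" and [measurable]: "\<xi> \<in> measurable N (lb d)"
    and c: "integrable N c" "integrable N (\<lambda>j. Rd_norm d (\<xi> j) * norm (c j))"
    and f: "\<And>z. z \<in> Rd d \<Longrightarrow> f z = (\<integral>j. c j * plane_wave d (\<xi> j) z \<partial>N)"
    and x: "x \<in> Rd d"
    and int: "integrable (lb d) (\<lambda>y. P y * f (Rd_diff d x y))"
    and meas: "(\<lambda>y. f (Rd_diff d x y)) \<in> borel_measurable (lb d)"
  shows "riesz d k P f x = (\<integral>j. c j * riesz_mult d k P (\<xi> j) * plane_wave d (\<xi> j) x \<partial>N)"
proof -
  interpret lb: sigma_finite_measure "lb d" by (rule sigma_finite_lb)
  interpret N: sigma_finite_measure N by (rule N)
  interpret NL: pair_sigma_finite N "lb d" ..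
  interpret NR: pair_sigma_finite N lborel ..
  note [measurable] = hom_poly_measurable[OF P(1)] borel_measurable_integrable[OF c(1)] meas
  have xi_coord [measurable]: "(\<lambda>j. \<xi> j i) \<in> borel_measurable N" if "i < d" for i
    using measurable_compose[OF \<open>\<xi> \<in> measurable N (lb d)\<close> measurable_component_singleton[of i "{..<d}"]] that by simp
  have [measurable]: "(\<lambda>p. Rd_dot d (\<xi> (fst p)) (snd p)) \<in> borel_measurable (N \<Otimes>\<^sub>M lb d)"
    unfolding Rd_dot_def
    by (intro borel_measurable_sum borel_measurable_times measurable_compose[OF measurable_fst xi_coord]) 
      (simp_all add: measurable_compose[OF measurable_snd])
  have [measurable]: "(\<lambda>j. Rd_dot d (\<xi> j) z) \<in> borel_measurable N" for z
    unfolding Rd_dot_def by (intro borel_measurable_sum borel_measurable_times xi_coord) auto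
  have \<xi>_Rd: "\<xi> j \<in> Rd d" if "j \<in> space N" for j
    using measurable_space[OF \<open>\<xi> \<in> measurable N (lb d)\<close> that] by (simp add: space_lb)
  obtain B where B: "B \<ge> 0" "\<And>x. norm (P x) \<le> B * Rd_norm d x ^ k" using hom_poly_bound[OF P(1)] by blast
  define M where "M = real (d + k) / 2"
  define a where "a = real k / 2"
  have M: "M > 0" and a: "a > 0" using P(3) by (simp_all add: M_def a_def)
  have diff_Rd: "Rd_diff d x y \<in> Rd d" for y by (simp add: Rd_diff_affine)
  have c_wave: "integrable N (\<lambda>j. c j * plane_wave d (\<xi> j) z)" for z
    by (rule Bochner_Integration.integrable_bound[OF c(1)]) (auto simp: plane_wave_def norm_mult)
  let ?g = "\<lambda>y. f (Rd_diff d x y)"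
  define L where "L = (\<integral>j. Rd_norm d (\<xi> j) * norm (c j) \<partial>N)"
  \<comment> \<open>The finite first moment of the frequencies makes \<open>f\<close> Lipschitz,
    which tames the singularity of the kernel in \<open>harmonic_kernel_trunc_tendsto\<close>, with
    \<open>b = f x\<close>.\<close>
  have lip: "norm (?g y - f x) \<le> L * Rd_norm d y" for y
  proof -
    have "?g y - f x = (\<integral>j. c j * plane_wave d (\<xi> j) (Rd_diff d x y) - c j * plane_wave d (\<xi> j) x \<partial>N)"
      using c_wave by (simp add: f[OF diff_Rd] f[OF x] Bochner_Integration.integral_diff)
    also have "norm \<dots> \<le> (\<integral>j. Rd_norm d (\<xi> j) * norm (c j) * Rd_norm d y \<partial>N)"
    proof (rule norm_integral_le)
      show "integrable N (\<lambda>j. c j * plane_wave d (\<xi> j) (Rd_diff d x y) - c j * plane_wave d (\<xi> j) x)"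
        using c_wave by simp
      show "integrable N (\<lambda>j. Rd_norm d (\<xi> j) * norm (c j) * Rd_norm d y)"
        using c(2) by simp
      fix j
      have "norm (c j * plane_wave d (\<xi> j) (Rd_diff d x y) - c j * plane_wave d (\<xi> j) x)
         = norm (c j) * norm (plane_wave d (\<xi> j) (Rd_diff d x y) - plane_wave d (\<xi> j) x)"
        by (simp add: right_diff_distrib[symmetric] norm_mult)
      also have "\<dots> \<le> norm (c j) * (Rd_norm d (\<xi> j) * Rd_norm d y)"
        by (intro mult_left_mono plane_wave_lipschitz) simp
      finally show "norm (c j * plane_wave d (\<xi> j) (Rd_diff d x y) - c j * plane_wave d (\<xi> j) x) \<le> Rd_norm d (\<xi> j) * norm (c j) * Rd_norm d y"
        by (simp add: mult_ac)
    qed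
    finally show ?thesis by (simp add: L_def)
  qed
  let ?w = "\<lambda>s. indicator {0<..} s * s powr (M - 1)"
  let ?q = "\<lambda>j. (Rd_norm d (\<xi> j))\<^sup>2 / 4"
  let ?e = "\<lambda>s j. of_real (pi powr (d / 2) / 2 ^ k * (s powr (- (real d / 2) - k) * exp (- ?q j / s))) * ((- \<i>) ^ k * P (\<xi> j) * plane_wave d (\<xi> j) x)"
  have gauss: "(\<integral>y. exp (- s * (Rd_norm d y)\<^sup>2) *\<^sub>R (P y * ?g y) \<partial>lb d) = (\<integral>j. c j * ?e s j \<partial>N)" if s: "s > 0" for s :: real
  proof -
    let ?h = "\<lambda>j y. c j * (exp (- s * (Rd_norm d y)\<^sup>2) *\<^sub>R (P y * plane_wave d (\<xi> j) (Rd_diff d x y)))"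
    have [measurable]: "(\<lambda>(j, y). ?h j y) \<in> borel_measurable (N \<Otimes>\<^sub>M lb d)"
      unfolding plane_wave_def Rd_dot_Rd_diff split_beta' by measurable
    have intP: "integrable (lb d) (\<lambda>y. exp (- s * (Rd_norm d y)\<^sup>2) * norm (P y))"
    proof (rule Bochner_Integration.integrable_bound)
      show "integrable (lb d) (\<lambda>y. B * (Rd_norm d y ^ k * exp (- s * (Rd_norm d y)\<^sup>2)))"
        by (intro integrable_mult_right integrable_norm_power_gauss s)
      show "AE y in lb d. norm (exp (- s * (Rd_norm d y)\<^sup>2) * norm (P y)) \<le> norm (B * (Rd_norm d y ^ k * exp (- s * (Rd_norm d y)\<^sup>2)))"
        using B by (intro always_eventually allI) (simp add: abs_mult mult_ac mult_right_mono[OF B(2), simplified mult_ac])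
    qed measurable
    have norm_h: "norm (?h j y) = norm (c j) * (exp (- s * (Rd_norm d y)\<^sup>2) * norm (P y))" for j y
      by (simp add: norm_mult)
    have I: "integrable (N \<Otimes>\<^sub>M lb d) (\<lambda>(j, y). ?h j y)"
    proof (rule NL.Fubini_integrable)
      show "integrable N (\<lambda>j. \<integral>y. norm (case (j, y) of (j, y) \<Rightarrow> ?h j y) \<partial>lb d)"
        unfolding split_conv norm_h using c(1) by simp
      have "integrable (lb d) (\<lambda>y. exp (- s * (Rd_norm d y)\<^sup>2) *\<^sub>R (P y * plane_wave d (\<xi> j) (Rd_diff d x y)))" if "j \<in> space N" for j
        by (rule Bochner_Integration.integrable_bound[OF intP])
          (unfold plane_wave_Rd_diff, measurable, simp add: norm_mult plane_wave_def)
      then show "AE j in N. integrable (lb d) (\<lambda>y. case (j, y) of (j, y) \<Rightarrow> ?h j y)"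
        unfolding split_conv by (intro AE_I2 integrable_mult_right)
    qed measurable
    have "(\<integral>y. exp (- s * (Rd_norm d y)\<^sup>2) *\<^sub>R (P y * ?g y) \<partial>lb d) = (\<integral>y. (\<integral>j. ?h j y \<partial>N) \<partial>lb d)"
    proof (rule Bochner_Integration.integral_cong[OF refl])
      fix y
      have "exp (- s * (Rd_norm d y)\<^sup>2) *\<^sub>R (P y * ?g y) = (exp (- s * (Rd_norm d y)\<^sup>2) *\<^sub>R P y) * (\<integral>j. c j * plane_wave d (\<xi> j) (Rd_diff d x y) \<partial>N)"
        by (simp add: f[OF diff_Rd])
      also have "\<dots> = (\<integral>j. ?h j y \<partial>N)"
        unfolding integral_mult_right_zero[symmetric] by (simp add: scaleR_conv_of_real mult_ac)
      finally show "exp (- s * (Rd_norm d y)\<^sup>2) *\<^sub>R (P y * ?g y) = (\<integral>j. ?h j y \<partial>N)" .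
    qed
    also have "\<dots> = (\<integral>j. (\<integral>y. ?h j y \<partial>lb d) \<partial>N)"
      using NL.Fubini_integral[OF I] by simp
    also have "\<dots> = (\<integral>j. c j * ?e s j \<partial>N)"
      by (rule Bochner_Integration.integral_cong[OF refl])
        (simp only: integral_mult_right_zero plane_wave_gauss_transform[OF P(1,2) s \<xi>_Rd])
    finally show ?thesis .
  qed
  let ?u = "\<lambda>j s. (?w s * (pi powr (d / 2) / 2 ^ k * (s powr (- (real d / 2) - k) * exp (- ?q j / s)))) *\<^sub>R (c j * ((- \<i>) ^ k * P (\<xi> j) * plane_wave d (\<xi> j) x))"
  \<comment> \<open>The exponents add up to \<open>(M - 1) - d / 2 - k = - k / 2 - 1\<close>: the
    dimension drops out, and \<open>has_bochner_integral_inverse_Gamma\<close> applies with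
    \<open>a = k / 2\<close>.\<close>
  have wexp: "?w s * (pi powr (d / 2) / 2 ^ k * (s powr (- (real d / 2) - k) * exp (- q / s)))
      = pi powr (d / 2) / 2 ^ k * (indicator {0<..} s * (s powr (- a - 1) * exp (- q / s)))" for s q :: real
  proof -
    have "- a - 1 = (M - 1) + (- (real d / 2) - k)" by (simp add: M_def a_def field_simps)
    then have "s powr (- a - 1) = s powr (M - 1) * s powr (- (real d / 2) - k)" by (simp only: powr_add)
    then show ?thesis by (simp only: mult_ac times_divide_eq_left times_divide_eq_right)
  qed
  have inner: "has_bochner_integral lborel (\<lambda>s. (?w s * (pi powr (d / 2) / 2 ^ k * (s powr (- (real d / 2) - k) * exp (- ?q j / s)))) *\<^sub>R v)
      ((pi powr (d / 2) * Gamma a / Rd_norm d (\<xi> j) ^ k) *\<^sub>R v)" if "Rd_norm d (\<xi> j) > 0 \<or> v = 0"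
    for j and v :: "'v :: {banach, second_countable_topology}"
  proof (cases "v = 0")
    case False
    then have pos: "Rd_norm d (\<xi> j) > 0" using that by simp
    then have "has_bochner_integral lborel (\<lambda>s. pi powr (d / 2) / 2 ^ k * (indicator {0<..} s * (s powr (- a - 1) * exp (- ?q j / s)))) (pi powr (d / 2) / 2 ^ k * (Gamma a * ?q j powr (- a)))"
      by (intro has_bochner_integral_mult_right has_bochner_integral_inverse_Gamma a) simp
    moreover have "?q j powr (- a) = 2 ^ k / Rd_norm d (\<xi> j) ^ k"
    proof -
      have "?q j = (Rd_norm d (\<xi> j) / 2) powr 2" using pos powr_numeral[of "Rd_norm d (\<xi> j) / 2" "num.Bit0 num.One"]
        by (simp add: power_divide del: powr_numeral)
      then have "?q j powr (- a) = (Rd_norm d (\<xi> j) / 2) powr (- real k)" by (simp only: powr_powr) (simp add: a_def)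
      also have "\<dots> = 1 / (Rd_norm d (\<xi> j) / 2) ^ k" using pos by (simp add: powr_minus_divide powr_realpow)
      finally show ?thesis by (simp add: power_divide)
    qed
    ultimately have "has_bochner_integral lborel (\<lambda>s. pi powr (d / 2) / 2 ^ k * (indicator {0<..} s * (s powr (- a - 1) * exp (- ?q j / s)))) (pi powr (d / 2) * Gamma a / Rd_norm d (\<xi> j) ^ k)"
      by simp
    then show ?thesis unfolding wexp by (rule has_bochner_integral_scaleR_left)
  qed (simp add: has_bochner_integral_zero)
  \<comment> \<open>At frequency 0 the integral over \<open>s\<close> diverges, but there
    \<open>P\<close> and hence the coefficient vanish.\<close>
  have P_pos: "Rd_norm d (\<xi> j) > 0 \<or> c j * ((- \<i>) ^ k * P (\<xi> j) * plane_wave d (\<xi> j) x) = 0" for j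
  proof (cases "Rd_norm d (\<xi> j) = 0")
    case True
    then show ?thesis using Rd_norm_zero_hom_poly[OF P(1,3)] by simp
  next
    case False
    then show ?thesis using Rd_norm_nonneg[of d "\<xi> j"] by linarith
  qed
  have u_meas [measurable]: "(\<lambda>(j, s). ?u j s) \<in> borel_measurable (N \<Otimes>\<^sub>M lborel)"
    unfolding plane_wave_def by measurable
  have J: "integrable (N \<Otimes>\<^sub>M lborel) (\<lambda>(j, s). ?u j s)"
  proof (rule NR.Fubini_integrable)
    have norm_u: "(\<integral>s. norm (?u j s) \<partial>lborel) = (pi powr (d / 2) * Gamma a / Rd_norm d (\<xi> j) ^ k) * norm (c j * ((- \<i>) ^ k * P (\<xi> j) * plane_wave d (\<xi> j) x))" for j
    proof -
      have "norm (?u j s) = (?w s * (pi powr (d / 2) / 2 ^ k * (s powr (- (real d / 2) - k) * exp (- ?q j / s)))) *\<^sub>R norm (c j * ((- \<i>) ^ k * P (\<xi> j) * plane_wave d (\<xi> j) x))" for s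
        unfolding norm_scaleR by (simp add: abs_mult)
      then show ?thesis
        using has_bochner_integral_integral_eq[OF inner[of j "norm (c j * ((- \<i>) ^ k * P (\<xi> j) * plane_wave d (\<xi> j) x))"]] P_pos[of j]
        by (simp only: norm_eq_zero real_scaleR_def)
    qed
    show "integrable N (\<lambda>j. \<integral>s. norm (case (j, s) of (j, s) \<Rightarrow> ?u j s) \<partial>lborel)"
      unfolding split_conv norm_u
    proof (rule Bochner_Integration.integrable_bound)
      show "integrable N (\<lambda>j. pi powr (d / 2) * Gamma a * B * norm (c j))"
        using c(1) by (intro integrable_mult_right integrable_norm)
      show "AE j in N. norm (pi powr (d / 2) * Gamma a / Rd_norm d (\<xi> j) ^ k * norm (c j * ((- \<i>) ^ k * P (\<xi> j) * plane_wave d (\<xi> j) x))) \<le> norm (pi powr (d / 2) * Gamma a * B * norm (c j))"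
      proof (intro always_eventually allI)
        fix j
        have "norm (P (\<xi> j)) / Rd_norm d (\<xi> j) ^ k \<le> B"
        proof (cases "Rd_norm d (\<xi> j) = 0")
          case False
          then have "Rd_norm d (\<xi> j) > 0" using Rd_norm_nonneg[of d "\<xi> j"] by linarith
          then show ?thesis using B(2)[of "\<xi> j"] by (simp add: pos_divide_le_eq)
        qed (use P(3) B(1) in \<open>simp add: power_0_left\<close>)
        then have "pi powr (d / 2) * Gamma a * norm (c j) * (norm (P (\<xi> j)) / Rd_norm d (\<xi> j) ^ k) \<le> pi powr (d / 2) * Gamma a * norm (c j) * B"
          using Gamma_real_pos[OF a] by (intro mult_left_mono) auto
        then show "norm (pi powr (d / 2) * Gamma a / Rd_norm d (\<xi> j) ^ k * norm (c j * ((- \<i>) ^ k * P (\<xi> j) * plane_wave d (\<xi> j) x))) \<le> norm (pi powr (d / 2) * Gamma a * B * norm (c j))"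
          using Gamma_real_pos[OF a] B(1) by (simp add: norm_mult norm_power abs_mult mult_ac)
      qed
    qed (unfold plane_wave_def, measurable)
    show "AE j in N. integrable lborel (\<lambda>s. case (j, s) of (j, s) \<Rightarrow> ?u j s)"
      unfolding split_conv by (rule AE_I2, rule integrable.intros[OF inner[OF P_pos]])
  qed (rule u_meas)
  have "(\<integral>s. ?w s *\<^sub>R (\<integral>y. exp (- s * (Rd_norm d y)\<^sup>2) *\<^sub>R (P y * ?g y) \<partial>lb d) \<partial>lborel) = (\<integral>s. (\<integral>j. ?u j s \<partial>N) \<partial>lborel)"
  proof (rule Bochner_Integration.integral_cong[OF refl])
    fix s :: real
    show "?w s *\<^sub>R (\<integral>y. exp (- s * (Rd_norm d y)\<^sup>2) *\<^sub>R (P y * ?g y) \<partial>lb d) = (\<integral>j. ?u j s \<partial>N)"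
    proof (cases "s > 0")
      case True
      show ?thesis unfolding gauss[OF True] integral_scaleR_right[symmetric]
        by (rule Bochner_Integration.integral_cong[OF refl]) (simp only: scaleR_conv_of_real of_real_mult mult_ac)
    qed simp
  qed
  also have "\<dots> = (\<integral>j. (\<integral>s. ?u j s \<partial>lborel) \<partial>N)"
    using NR.Fubini_integral[OF J] by simp
  also have "\<dots> = (\<integral>j. of_real (pi powr (d / 2) * Gamma a) * (c j * riesz_mult d k P (\<xi> j) * plane_wave d (\<xi> j) x) \<partial>N)"
  proof (rule Bochner_Integration.integral_cong[OF refl])
    fix j
    have "(\<integral>s. ?u j s \<partial>lborel) = (pi powr (d / 2) * Gamma a / Rd_norm d (\<xi> j) ^ k) *\<^sub>R (c j * ((- \<i>) ^ k * P (\<xi> j) * plane_wave d (\<xi> j) x))"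
      by (rule has_bochner_integral_integral_eq[OF inner[OF P_pos]])
    then show "(\<integral>s. ?u j s \<partial>lborel) = of_real (pi powr (d / 2) * Gamma a) * (c j * riesz_mult d k P (\<xi> j) * plane_wave d (\<xi> j) x)"
      by (simp only: riesz_mult_def scaleR_conv_of_real of_real_divide of_real_mult) (simp only: mult_ac times_divide_eq_left times_divide_eq_right)
  qed
  finally have val: "(\<integral>s. ?w s *\<^sub>R (\<integral>y. exp (- s * (Rd_norm d y)\<^sup>2) *\<^sub>R (P y * ?g y) \<partial>lb d) \<partial>lborel)
     = of_real (pi powr (d / 2) * Gamma a) * (\<integral>j. c j * riesz_mult d k P (\<xi> j) * plane_wave d (\<xi> j) x \<partial>N)"
    unfolding integral_mult_right_zero .
  have lim: "((\<lambda>t. of_real (riesz_const k d) * (\<integral>y. indicator {y. Rd_norm d y > t} y *\<^sub>R (P y / of_real (Rd_norm d y ^ (d + k)) * ?g y) \<partial>lb d))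
     \<longlongrightarrow> of_real (riesz_const k d) * (of_real (1 / Gamma M) * (\<integral>s. ?w s *\<^sub>R (\<integral>y. exp (- s * (Rd_norm d y)\<^sup>2) *\<^sub>R (P y * ?g y) \<partial>lb d) \<partial>lborel))) (at_right 0)"
    by (intro tendsto_mult tendsto_const harmonic_kernel_trunc_tendsto[OF M_def P meas int lip])
  have "riesz d k P f x = of_real (riesz_const k d) * (of_real (1 / Gamma M) * (of_real (pi powr (d / 2) * Gamma a) * (\<integral>j. c j * riesz_mult d k P (\<xi> j) * plane_wave d (\<xi> j) x \<partial>N)))"
    unfolding riesz_def riesz_trunc_lb[OF hom_poly_measurable[OF P(1)] meas] val[symmetric]
    by (rule tendsto_Lim[OF _ lim]) simp
  also have "\<dots> = of_real (riesz_const k d * (1 / Gamma M) * (pi powr (d / 2) * Gamma a)) * (\<integral>j. c j * riesz_mult d k P (\<xi> j) * plane_wave d (\<xi> j) x \<partial>N)"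
    by (simp only: of_real_mult mult_ac)
  \<comment> \<open>This is the origin of the normalisation \<open>riesz_const\<close>: it cancels
    \<open>1 / Gamma M\<close> from the kernel and \<open>pi powr (d / 2) * Gamma (k / 2)\<close>
    from the integral over \<open>s\<close>.\<close>
  also have "riesz_const k d * (1 / Gamma M) * (pi powr (d / 2) * Gamma a) = 1"
  proof -
    have eq: "real (k + d) / 2 = M" "real k / 2 = a" by (simp_all add: M_def a_def)
    show ?thesis
      unfolding riesz_const_def eq using Gamma_real_pos[OF M] Gamma_real_pos[OF a] by simp
  qed
  finally show ?thesis by simp
qed

section \<open>Schwartz functions with a Gaussian factor\<close>

text \<open>The remainder of \<open>exp (\<i> * \<theta>)\<close> after its linear term is at most
  \<open>\<theta>\<^sup>2 / 2\<close>. As the frequencies are bounded where \<open>c\<close> is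
  nonzero, integration gives a quadratic error from the integrability of \<open>c\<close>
  alone.\<close>

lemma has_vector_derivative_fourier_integral:
  fixes c :: "'j \<Rightarrow> complex" and b :: "'j \<Rightarrow> real"
  assumes c: "integrable N c" and [measurable]: "b \<in> borel_measurable N"
    and R: "\<And>j. c j \<noteq> 0 \<Longrightarrow> \<bar>b j\<bar> \<le> R"
  shows "((\<lambda>t. \<integral>j. c j * exp (\<i> * of_real (b j * t)) \<partial>N) has_vector_derivative
     (\<integral>j. \<i> * of_real (b j) * c j * exp (\<i> * of_real (b j * t)) \<partial>N)) (at t)"
proof -
  note [measurable] = borel_measurable_integrable[OF c]
  let ?F = "\<lambda>t. \<integral>j. c j * exp (\<i> * of_real (b j * t)) \<partial>N"
  let ?D = "\<integral>j. \<i> * of_real (b j) * c j * exp (\<i> * of_real (b j * t)) \<partial>N"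
  have i1: "integrable N (\<lambda>j. c j * exp (\<i> * of_real (b j * t)))" for t
    by (rule Bochner_Integration.integrable_bound[OF c]) (auto simp: norm_mult)
  have i2: "integrable N (\<lambda>j. \<i> * of_real (b j) * c j * exp (\<i> * of_real (b j * t)))"
  proof (rule Bochner_Integration.integrable_bound)
    show "integrable N (\<lambda>j. of_real R * c j)" using c by (rule integrable_mult_right)
    show "AE j in N. norm (\<i> * of_real (b j) * c j * exp (\<i> * of_real (b j * t))) \<le> norm (of_real R * c j)"
    proof (intro always_eventually allI)
      fix j
      show "norm (\<i> * of_real (b j) * c j * exp (\<i> * of_real (b j * t))) \<le> norm (of_real R * c j)"
        using R[of j] by (cases "c j = 0") (auto simp: norm_mult intro!: mult_right_mono)
    qed
  qed measurable
  define K where "K = (\<integral>j. R\<^sup>2 / 2 * norm (c j) \<partial>N)"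
  have quad: "norm (?F y - ?F t - (y - t) *\<^sub>R ?D) \<le> K * (y - t)\<^sup>2" for y
  proof -
    have "?F y - ?F t - (y - t) *\<^sub>R ?D = (\<integral>j. c j * exp (\<i> * of_real (b j * y)) - c j * exp (\<i> * of_real (b j * t))
        - (y - t) *\<^sub>R (\<i> * of_real (b j) * c j * exp (\<i> * of_real (b j * t))) \<partial>N)"
      using i1 i2 by (simp only: Bochner_Integration.integral_diff Bochner_Integration.integrable_diff integrable_scaleR_right integral_scaleR_right)
    also have "norm \<dots> \<le> (\<integral>j. R\<^sup>2 / 2 * norm (c j) * (y - t)\<^sup>2 \<partial>N)"
    proof (rule norm_integral_le)
      show "integrable N (\<lambda>j. c j * exp (\<i> * of_real (b j * y)) - c j * exp (\<i> * of_real (b j * t))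
        - (y - t) *\<^sub>R (\<i> * of_real (b j) * c j * exp (\<i> * of_real (b j * t))))"
        using i1 i2 by (intro Bochner_Integration.integrable_diff integrable_scaleR_right)
      show "integrable N (\<lambda>j. R\<^sup>2 / 2 * norm (c j) * (y - t)\<^sup>2)"
        using c by (intro integrable_mult_left integrable_mult_right integrable_norm)
      fix j
      let ?\<theta> = "b j * (y - t)"
      have "exp (\<i> * of_real (b j * y)) = exp (\<i> * of_real (b j * t)) * exp (\<i> * of_real ?\<theta>)"
        by (simp add: exp_add[symmetric] algebra_simps)
      then have "c j * exp (\<i> * of_real (b j * y)) - c j * exp (\<i> * of_real (b j * t))
        - (y - t) *\<^sub>R (\<i> * of_real (b j) * c j * exp (\<i> * of_real (b j * t)))
        = c j * exp (\<i> * of_real (b j * t)) * (exp (\<i> * of_real ?\<theta>) - (1 + \<i> * of_real ?\<theta>))"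
        by (simp add: scaleR_conv_of_real algebra_simps)
      also have "norm \<dots> = norm (c j) * norm (exp (\<i> * of_real ?\<theta>) - (1 + \<i> * of_real ?\<theta>))"
        by (simp add: norm_mult)
      also have "\<dots> \<le> norm (c j) * (?\<theta>\<^sup>2 / 2)"
        using iexp_approx1[of ?\<theta> 1] by (intro mult_left_mono) (simp_all add: power2_eq_square)
      also have "\<dots> \<le> R\<^sup>2 / 2 * norm (c j) * (y - t)\<^sup>2"
      proof (cases "c j = 0")
        case False
        then have "\<bar>b j\<bar>\<^sup>2 \<le> R\<^sup>2" using R[of j] by (intro power_mono) auto
        from mult_right_mono[OF this, of "norm (c j) * (y - t)\<^sup>2 / 2"] show ?thesis
          by (simp add: power_mult_distrib mult_ac)
      qed simp
      finally show "norm (c j * exp (\<i> * of_real (b j * y)) - c j * exp (\<i> * of_real (b j * t))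
        - (y - t) *\<^sub>R (\<i> * of_real (b j) * c j * exp (\<i> * of_real (b j * t)))) \<le> R\<^sup>2 / 2 * norm (c j) * (y - t)\<^sup>2" .
    qed
    also have "\<dots> = K * (y - t)\<^sup>2" unfolding K_def by simp
    finally show ?thesis .
  qed
  have "((\<lambda>y. ((?F y - ?F t) - (y - t) *\<^sub>R ?D) /\<^sub>R norm (y - t)) \<longlongrightarrow> 0) (at t)"
  proof (rule Lim_null_comparison)
    have "((\<lambda>y. K * \<bar>y - t\<bar>) \<longlongrightarrow> K * \<bar>t - t\<bar>) (at t)" by (intro tendsto_intros)
    then show "((\<lambda>y. K * \<bar>y - t\<bar>) \<longlongrightarrow> 0) (at t)" by simp
    show "\<forall>\<^sub>F y in at t. norm (((?F y - ?F t) - (y - t) *\<^sub>R ?D) /\<^sub>R norm (y - t)) \<le> K * \<bar>y - t\<bar>"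
    proof (rule eventually_mono[OF eventually_at_ball'[of 1 t UNIV]])
      fix y assume "y \<in> ball t 1 \<and> y \<noteq> t \<and> y \<in> UNIV"
      then have pos: "\<bar>y - t\<bar> > 0" by simp
      have "norm (((?F y - ?F t) - (y - t) *\<^sub>R ?D) /\<^sub>R norm (y - t)) = norm (?F y - ?F t - (y - t) *\<^sub>R ?D) / \<bar>y - t\<bar>"
        by (simp add: divide_inverse mult.commute)
      also have "\<dots> \<le> K * \<bar>y - t\<bar>\<^sup>2 / \<bar>y - t\<bar>" using quad[of y] pos by (intro divide_right_mono) auto
      also have "\<dots> = K * \<bar>y - t\<bar>"
      proof -
        have "K * u\<^sup>2 / u = K * u" if "u > 0" for u :: real using that by (simp add: power2_eq_square)
        then show ?thesis using pos by blast
      qed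
      finally show "norm (((?F y - ?F t) - (y - t) *\<^sub>R ?D) /\<^sub>R norm (y - t)) \<le> K * \<bar>y - t\<bar>" .
    qed simp
  qed
  then show ?thesis
    unfolding has_vector_derivative_def has_derivative_at_within by (simp add: bounded_linear_scaleR_left)
qed

section \<open>A class of functions closed under differentiation\<close>

definition packet_term :: "nat \<Rightarrow> real \<Rightarrow> 'j measure \<Rightarrow> ('j \<Rightarrow> nat \<Rightarrow> real) \<Rightarrow> (nat \<Rightarrow> nat) \<Rightarrow> ('j \<Rightarrow> complex) \<Rightarrow> (nat \<Rightarrow> real) \<Rightarrow> complex" where
  "packet_term d \<epsilon> N \<xi> \<alpha> c x = Rd_monomial d \<alpha> x * (of_real (exp (- \<epsilon> * (Rd_norm d x)\<^sup>2)) * (\<integral>j. c j * plane_wave d (\<xi> j) x \<partial>N))"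

text \<open>The class contains the test functions and is closed under partial derivatives, since
  differentiation changes the monomial or multiplies the coefficients by a coordinate of the
  frequency. The common bound \<open>R\<close> on the frequencies keeps the new coefficients
  integrable.\<close>

inductive gauss_packet :: "nat \<Rightarrow> real \<Rightarrow> 'j measure \<Rightarrow> ('j \<Rightarrow> nat \<Rightarrow> real) \<Rightarrow> real \<Rightarrow> ((nat \<Rightarrow> real) \<Rightarrow> complex) \<Rightarrow> bool"
  for d \<epsilon> N \<xi> R where
  zero: "gauss_packet d \<epsilon> N \<xi> R (\<lambda>_. 0)"
| add: "gauss_packet d \<epsilon> N \<xi> R f \<Longrightarrow> integrable N c \<Longrightarrow> (\<And>j. c j \<noteq> 0 \<Longrightarrow> Rd_norm d (\<xi> j) \<le> R)
    \<Longrightarrow> gauss_packet d \<epsilon> N \<xi> R (\<lambda>x. f x + a * packet_term d \<epsilon> N \<xi> \<alpha> c x)"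

lemma continuous_on_Rd_norm: "continuous_on UNIV (Rd_norm d)"
  unfolding Rd_norm_def[abs_def] L2_set_def
  by (intro continuous_intros continuous_on_product_coordinates)

lemma measurable_plane_wave_fst:
  assumes "\<xi> \<in> measurable N (lb d)"
  shows "(\<lambda>j. plane_wave d (\<xi> j) z) \<in> borel_measurable N"
proof -
  have [measurable]: "(\<lambda>j. \<xi> j i) \<in> borel_measurable N" if "i < d" for i
    using measurable_compose[OF assms measurable_component_singleton[of i "{..<d}"]] that by simp
  have [measurable]: "(\<lambda>j. Rd_dot d (\<xi> j) z) \<in> borel_measurable N"
    unfolding Rd_dot_def by measurable
  show ?thesis unfolding plane_wave_def by measurable
qed

lemma integrable_plane_wave:
  assumes "integrable N c" and \<xi>: "\<xi> \<in> measurable N (lb d)"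
  shows "integrable N (\<lambda>j. c j * plane_wave d (\<xi> j) z)"
  by (rule Bochner_Integration.integrable_bound[OF assms(1)])
    (use assms measurable_plane_wave_fst[OF \<xi>] in \<open>auto simp: norm_mult\<close>)

lemma continuous_on_plane_wave_integral:
  assumes c: "integrable N c" and \<xi>: "\<xi> \<in> measurable N (lb d)"
  shows "continuous_on UNIV (\<lambda>x. \<integral>j. c j * plane_wave d (\<xi> j) x \<partial>N)"
proof -
  note [measurable] = borel_measurable_integrable[OF c] measurable_plane_wave_fst[OF \<xi>]
  have "((\<lambda>n. \<integral>j. c j * plane_wave d (\<xi> j) (X n) \<partial>N) \<longlonglongrightarrow> (\<integral>j. c j * plane_wave d (\<xi> j) x \<partial>N))"
    if X: "X \<longlonglongrightarrow> x" for X x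
  proof (rule integral_dominated_convergence[where w = "\<lambda>j. norm (c j)"])
    have Xi: "(\<lambda>n. X n i) \<longlonglongrightarrow> x i" for i
      using continuous_on_tendsto_compose[OF continuous_on_product_coordinates[of i] X] by simp
    show "AE j in N. (\<lambda>n. c j * plane_wave d (\<xi> j) (X n)) \<longlonglongrightarrow> c j * plane_wave d (\<xi> j) x"
      unfolding plane_wave_def Rd_dot_def
      by (intro always_eventually allI tendsto_intros Xi)
  qed (use c in \<open>auto simp: norm_mult\<close>)
  then show ?thesis by (auto simp: continuous_on_sequentially o_def)
qed

text \<open>The product rule: one term each from the monomial, the Gaussian and the Fourier
  integral. The factor \<open>1 *\<close> gives all three summands the shape of the rule
  \<open>gauss_packet.add\<close>. For \<open>\<alpha> i = 0\<close> the truncated exponent has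
  coefficient 0.\<close>

lemma packet_term_has_partial:
  assumes i: "i < d" and c: "integrable N c" and R: "\<And>j. c j \<noteq> 0 \<Longrightarrow> Rd_norm d (\<xi> j) \<le> R"
    and \<xi>: "\<xi> \<in> measurable N (lb d)"
  shows "has_partial i (packet_term d \<epsilon> N \<xi> \<alpha> c)
    (\<lambda>x. of_nat (\<alpha> i) * packet_term d \<epsilon> N \<xi> (\<alpha>(i := \<alpha> i - 1)) c x
       + (- 2 * of_real \<epsilon>) * packet_term d \<epsilon> N \<xi> (\<alpha>(i := Suc (\<alpha> i))) c x
       + 1 * packet_term d \<epsilon> N \<xi> \<alpha> (\<lambda>j. \<i> * of_real (\<xi> j i) * c j) x)"
  unfolding has_partial_def
proof (intro allI)
  fix x :: "nat \<Rightarrow> real" and t :: real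
  note [measurable] = borel_measurable_integrable[OF c] measurable_plane_wave_fst[OF \<xi>]
  have xi_i [measurable]: "(\<lambda>j. \<xi> j i) \<in> borel_measurable N"
    using measurable_compose[OF \<xi> measurable_component_singleton[of i "{..<d}"]] i by simp
  let ?x0 = "x(i := 0)"
  have dot: "Rd_dot d w (x(i := t)) = w i * t + Rd_dot d w ?x0" for w t
    unfolding Rd_dot_def using i by (simp add: sum.remove[of "{..<d}" i])
  define w0 where "w0 w = plane_wave d w ?x0" for w
  have wave: "plane_wave d w (x(i := t)) = w0 w * exp (\<i> * of_real (w i * t))" for w t
    unfolding w0_def plane_wave_def dot[of w t] by (simp add: exp_add[symmetric] algebra_simps)
  have b: "\<bar>\<xi> j i\<bar> \<le> R" if "c j * w0 (\<xi> j) \<noteq> 0" for j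
  proof -
    have "c j \<noteq> 0" using that by auto
    from R[OF this] abs_coord_le_Rd_norm[OF i, of "\<xi> j"] show ?thesis by linarith
  qed
  have "((\<lambda>t. \<integral>j. c j * w0 (\<xi> j) * exp (\<i> * of_real (\<xi> j i * t)) \<partial>N) has_vector_derivative
      (\<integral>j. \<i> * of_real (\<xi> j i) * (c j * w0 (\<xi> j)) * exp (\<i> * of_real (\<xi> j i * t)) \<partial>N)) (at t)"
    by (rule has_vector_derivative_fourier_integral[OF integrable_plane_wave[OF c \<xi>, of ?x0, folded w0_def] xi_i]) (rule b)
  then have 1: "((\<lambda>t. \<integral>j. c j * plane_wave d (\<xi> j) (x(i := t)) \<partial>N) has_vector_derivative
      (\<integral>j. \<i> * of_real (\<xi> j i) * c j * plane_wave d (\<xi> j) (x(i := t)) \<partial>N)) (at t)"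
    unfolding wave by (simp only: mult.assoc)
  define q where "q = (Rd_norm d ?x0)\<^sup>2"
  have sq: "(Rd_norm d (x(i := t)))\<^sup>2 = t\<^sup>2 + q" for t
    unfolding q_def Rd_norm_power2 using i by (simp add: sum.remove[of "{..<d}" i])
  have "((\<lambda>t. exp (- \<epsilon> * (t\<^sup>2 + q))) has_real_derivative exp (- \<epsilon> * (t\<^sup>2 + q)) * (- \<epsilon> * (2 * t))) (at t)"
    by (auto intro!: derivative_eq_intros)
  then have "((\<lambda>t. exp (- \<epsilon> * (Rd_norm d (x(i := t)))\<^sup>2)) has_real_derivative exp (- \<epsilon> * (Rd_norm d (x(i := t)))\<^sup>2) * (- \<epsilon> * (2 * t))) (at t)"
    unfolding sq .
  from has_vector_derivative_of_real[OF this]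
  have 2: "((\<lambda>t. of_real (exp (- \<epsilon> * (Rd_norm d (x(i := t)))\<^sup>2)) :: complex) has_vector_derivative
     of_real (exp (- \<epsilon> * (Rd_norm d (x(i := t)))\<^sup>2) * (- \<epsilon> * (2 * t)))) (at t)" .
  note 3 = Rd_monomial_has_partial[OF i, of \<alpha> x t]
  note D = has_vector_derivative_mult[OF 3 has_vector_derivative_mult[OF 2 1]]
  have mono: "Rd_monomial d (\<alpha>(i := Suc (\<alpha> i))) (x(i := t)) = of_real t * Rd_monomial d \<alpha> (x(i := t))"
    using Rd_monomial_upd[OF i, of \<alpha> "Suc (\<alpha> i)" x t] Rd_monomial_upd[OF i, of \<alpha> "\<alpha> i" x t] by simp
  show "((\<lambda>t. packet_term d \<epsilon> N \<xi> \<alpha> c (x(i := t))) has_vector_derivative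
      of_nat (\<alpha> i) * packet_term d \<epsilon> N \<xi> (\<alpha>(i := \<alpha> i - 1)) c (x(i := t))
       + (- 2 * of_real \<epsilon>) * packet_term d \<epsilon> N \<xi> (\<alpha>(i := Suc (\<alpha> i))) c (x(i := t))
       + 1 * packet_term d \<epsilon> N \<xi> \<alpha> (\<lambda>j. \<i> * of_real (\<xi> j i) * c j) (x(i := t))) (at t)"
    unfolding packet_term_def mono
    by (rule has_vector_derivative_eq_rhs[OF D]) (simp add: algebra_simps)
qed

lemma gauss_packet_has_partial:
  assumes "gauss_packet d \<epsilon> N \<xi> R f" and i: "i < d" and \<xi>: "\<xi> \<in> measurable N (lb d)"
  shows "has_partial i f (partial i f)" "gauss_packet d \<epsilon> N \<xi> R (partial i f)"
proof -
  have "\<exists>f'. has_partial i f f' \<and> gauss_packet d \<epsilon> N \<xi> R f'"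
    using assms(1)
  proof induction
    case zero
    show ?case by (rule exI[of _ "\<lambda>_. 0"]) (auto simp: has_partial_def intro: gauss_packet.zero)
  next
    case (add f c a \<alpha>)
    then obtain f' where f': "has_partial i f f'" "gauss_packet d \<epsilon> N \<xi> R f'" by blast
    have [measurable]: "(\<lambda>j. \<xi> j i) \<in> borel_measurable N"
      using measurable_compose[OF \<xi> measurable_component_singleton[of i "{..<d}"]] i by simp
    note [measurable] = borel_measurable_integrable[OF add(2)]
    let ?c = "\<lambda>j. \<i> * of_real (\<xi> j i) * c j"
    have c': "integrable N ?c"
    proof (rule Bochner_Integration.integrable_bound)
      show "integrable N (\<lambda>j. of_real R * c j)" using add(2) by (rule integrable_mult_right)
      show "AE j in N. norm (?c j) \<le> norm (of_real R * c j)"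
      proof (intro always_eventually allI)
        fix j
        show "norm (?c j) \<le> norm (of_real R * c j)"
        proof (cases "c j = 0")
          case False
          then have "\<bar>\<xi> j i\<bar> \<le> \<bar>R\<bar>" using add(3)[of j] abs_coord_le_Rd_norm[OF i, of "\<xi> j"] by linarith
          then show ?thesis by (simp add: norm_mult mult_right_mono)
        qed simp
      qed
    qed measurable
    have R': "Rd_norm d (\<xi> j) \<le> R" if "?c j \<noteq> 0" for j using add(3)[of j] that by auto
    let ?f' = "\<lambda>x. ((f' x + a * of_nat (\<alpha> i) * packet_term d \<epsilon> N \<xi> (\<alpha>(i := \<alpha> i - 1)) c x)
       + a * (- 2 * of_real \<epsilon>) * packet_term d \<epsilon> N \<xi> (\<alpha>(i := Suc (\<alpha> i))) c x)
       + a * 1 * packet_term d \<epsilon> N \<xi> \<alpha> ?c x"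
    have "gauss_packet d \<epsilon> N \<xi> R ?f'"
      by (intro gauss_packet.add f' add.hyps c' R')
    moreover have "has_partial i (\<lambda>x. f x + a * packet_term d \<epsilon> N \<xi> \<alpha> c x) ?f'"
      unfolding has_partial_def
    proof (intro allI)
      fix x t
      have "((\<lambda>t. f (x(i := t)) + a * packet_term d \<epsilon> N \<xi> \<alpha> c (x(i := t))) has_vector_derivative
        f' (x(i := t)) + a * (of_nat (\<alpha> i) * packet_term d \<epsilon> N \<xi> (\<alpha>(i := \<alpha> i - 1)) c (x(i := t))
       + (- 2 * of_real \<epsilon>) * packet_term d \<epsilon> N \<xi> (\<alpha>(i := Suc (\<alpha> i))) c (x(i := t))
       + 1 * packet_term d \<epsilon> N \<xi> \<alpha> ?c (x(i := t)))) (at t)"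
        using f'(1) packet_term_has_partial[OF i add(2,3) \<xi>, of \<epsilon> \<alpha>] unfolding has_partial_def
        by (intro has_vector_derivative_add has_vector_derivative_mult_right) blast+
      then show "((\<lambda>t. f (x(i := t)) + a * packet_term d \<epsilon> N \<xi> \<alpha> c (x(i := t))) has_vector_derivative ?f' (x(i := t))) (at t)"
        by (rule has_vector_derivative_eq_rhs) (simp only: distrib_left mult.assoc add.assoc)
    qed
    ultimately show ?case by blast
  qed
  then show "has_partial i f (partial i f)" "gauss_packet d \<epsilon> N \<xi> R (partial i f)"
    using has_partial_partial by auto
qed

lemma gauss_packet_continuous:
  assumes "gauss_packet d \<epsilon> N \<xi> R f" and \<xi>: "\<xi> \<in> measurable N (lb d)"
  shows "continuous_on UNIV f"
  using assms(1)
proof induction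
  case (add f c a \<alpha>)
  show ?case unfolding packet_term_def
    by (intro continuous_intros add.IH continuous_on_Rd_monomial continuous_on_Rd_norm continuous_on_plane_wave_integral add.hyps \<xi>)
qed simp

lemma gauss_packet_monomial_bounded:
  assumes "gauss_packet d \<epsilon> N \<xi> R f" and \<epsilon>: "\<epsilon> > 0" and \<xi>: "\<xi> \<in> measurable N (lb d)"
  shows "\<exists>B. \<forall>x. norm (Rd_monomial d \<beta> x * f x) \<le> B"
  using assms(1)
proof induction
  case (add f c a \<alpha>)
  then obtain B where B: "\<And>x. norm (Rd_monomial d \<beta> x * f x) \<le> B" by blast
  let ?n = "(\<Sum>i<d. \<beta> i) + (\<Sum>i<d. \<alpha> i)"
  let ?K = "1 + fact ?n / (\<epsilon> / 2) ^ ?n"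
  have "norm (Rd_monomial d \<beta> x * packet_term d \<epsilon> N \<xi> \<alpha> c x) \<le> ?K * (\<integral>j. norm (c j) \<partial>N)" for x
  proof -
    have "norm (Rd_monomial d \<beta> x * packet_term d \<epsilon> N \<xi> \<alpha> c x)
      = (norm (Rd_monomial d \<beta> x) * norm (Rd_monomial d \<alpha> x)) * exp (- \<epsilon> * (Rd_norm d x)\<^sup>2) * norm (\<integral>j. c j * plane_wave d (\<xi> j) x \<partial>N)"
      by (simp add: packet_term_def norm_mult)
    also have "\<dots> \<le> (Rd_norm d x ^ (\<Sum>i<d. \<beta> i) * Rd_norm d x ^ (\<Sum>i<d. \<alpha> i)) * exp (- \<epsilon> * (Rd_norm d x)\<^sup>2) * (\<integral>j. norm (c j) \<partial>N)"
    proof (intro mult_mono Rd_monomial_norm_le)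
      show "norm (\<integral>j. c j * plane_wave d (\<xi> j) x \<partial>N) \<le> (\<integral>j. norm (c j) \<partial>N)"
        by (rule norm_integral_le) (use add.hyps integrable_plane_wave[OF add.hyps(2) \<xi>] in \<open>auto simp: norm_mult\<close>)
    qed auto
    also have "\<dots> = (Rd_norm d x ^ ?n * exp (- \<epsilon> * (Rd_norm d x)\<^sup>2)) * (\<integral>j. norm (c j) \<partial>N)"
      by (simp add: power_add)
    also have "\<dots> \<le> ?K * (\<integral>j. norm (c j) \<partial>N)"
    proof (rule mult_right_mono)
      have "Rd_norm d x ^ ?n * exp (- \<epsilon> * (Rd_norm d x)\<^sup>2) \<le> ?K * exp (- (\<epsilon> / 2) * (Rd_norm d x)\<^sup>2)"
        by (rule power_gauss_bound[OF \<epsilon> Rd_norm_nonneg])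
      also have "\<dots> \<le> ?K * 1"
        using \<epsilon> by (intro mult_left_mono) (auto intro!: add_nonneg_nonneg)
      finally show "Rd_norm d x ^ ?n * exp (- \<epsilon> * (Rd_norm d x)\<^sup>2) \<le> ?K" by simp
    qed simp
    finally show ?thesis .
  qed
  note C = this
  have "norm (Rd_monomial d \<beta> x * (f x + a * packet_term d \<epsilon> N \<xi> \<alpha> c x)) \<le> B + norm a * (?K * (\<integral>j. norm (c j) \<partial>N))" for x
  proof -
    have "Rd_monomial d \<beta> x * (f x + a * packet_term d \<epsilon> N \<xi> \<alpha> c x)
      = Rd_monomial d \<beta> x * f x + a * (Rd_monomial d \<beta> x * packet_term d \<epsilon> N \<xi> \<alpha> c x)" by (simp add: algebra_simps)
    also have "norm \<dots> \<le> norm (Rd_monomial d \<beta> x * f x) + norm (a * (Rd_monomial d \<beta> x * packet_term d \<epsilon> N \<xi> \<alpha> c x))"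
      by (rule norm_triangle_ineq)
    also have "\<dots> \<le> B + norm a * (?K * (\<integral>j. norm (c j) \<partial>N))"
      unfolding norm_mult[of a] by (intro add_mono B mult_left_mono C) simp
    finally show ?thesis .
  qed
  then show ?case by blast
qed (auto intro: exI[of _ 0])

text \<open>Iterated derivatives stay in the class, so the single bound on its members times a
  monomial yields all the seminorms.\<close>

lemma gauss_packet_schwartz:
  assumes f: "gauss_packet d \<epsilon> N \<xi> R f" and \<epsilon>: "\<epsilon> > 0" and \<xi>: "\<xi> \<in> measurable N (lb d)"
  shows "f \<in> schwartz d"
proof -
  have js: "gauss_packet d \<epsilon> N \<xi> R (partials js f)" if "set js \<subseteq> {..<d}" for js
    using that
  proof (induction js)
    case (Cons i js)
    then show ?case using gauss_packet_has_partial(2)[OF _ _ \<xi>, of \<epsilon> R "partials js f" i] by (simp add: partials_def)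
  qed (simp add: partials_def f)
  have mon: "of_real (\<Prod>i<d. x i ^ \<alpha> i) = Rd_monomial d \<alpha> x" for \<alpha> x
    by (simp add: Rd_monomial_def)
  have "(\<lambda>t. partials js f (x(i := t))) differentiable at (x i)" if "set js \<subseteq> {..<d}" "i < d" for js i x
    using has_partialD[OF gauss_packet_has_partial(1)[OF js[OF that(1)] that(2) \<xi>]] by (rule differentiableI_vector)
  moreover have "continuous_on (Rd d) (partials js f)" if "set js \<subseteq> {..<d}" for js
    using gauss_packet_continuous[OF js[OF that] \<xi>] continuous_on_subset by blast
  moreover have "\<exists>B. \<forall>x\<in>Rd d. norm (of_real (\<Prod>i<d. x i ^ \<alpha> i) * partials js f x) \<le> B" if "set js \<subseteq> {..<d}" for js \<alpha>
    using gauss_packet_monomial_bounded[OF js[OF that] \<epsilon> \<xi>, of \<alpha>] unfolding mon by blast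
  ultimately show ?thesis by (auto simp: schwartz_def smooth_def)
qed

section \<open>Consequences of the pointwise bound\<close>

text \<open>The constant function 0 is not a point of \<open>Rd d\<close>, whose elements are
  \<open>undefined\<close> from the coordinate \<open>d\<close> on.\<close>

definition Rd_zero :: "nat \<Rightarrow> nat \<Rightarrow> real" where
  "Rd_zero d = (\<lambda>i\<in>{..<d}. 0)"

lemma Rd_zero_in_Rd [simp]: "Rd_zero d \<in> Rd d"
  by (simp add: Rd_zero_def Rd_def)

lemma riesz_trunc_cong:
  assumes "\<And>x. x \<in> Rd d \<Longrightarrow> P x = Q x"
  shows "riesz_trunc d k P = riesz_trunc d k Q"
  unfolding riesz_trunc_def[abs_def] set_lebesgue_integral_def
  by (intro ext arg_cong[where f = "\<lambda>x. _ * x"] Bochner_Integration.integral_cong) (auto simp: indicator_def assms)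

lemma tendsto_coordinatewise:
  fixes X :: "nat \<Rightarrow> 'a \<Rightarrow> real"
  assumes "\<And>i. (\<lambda>n. X n i) \<longlonglongrightarrow> x i"
  shows "X \<longlonglongrightarrow> x"
proof -
  have "limitin (product_topology (\<lambda>_. euclidean) UNIV) X x sequentially"
    unfolding limitin_componentwise using assms by simp
  then show ?thesis by (simp add: euclidean_product_topology)
qed

text \<open>Every cube with a corner at the origin has positive measure and so meets a set of full
  measure. Convergence in the product topology also concerns the coordinates from \<open>d\<close>
  on, where all the points are \<open>undefined\<close>.\<close>

lemma AE_lb_near_zero:
  assumes "AE x in lb d. S x"
  obtains X where "X \<longlonglongrightarrow> Rd_zero d" "\<And>n. X n \<in> Rd d" "\<And>n. S (X n)" "\<And>n i. i < d \<Longrightarrow> \<bar>X n i\<bar> \<le> 1"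
proof -
  have "\<exists>x. x \<in> Pi\<^sub>E {..<d} (\<lambda>_. {0<..<1 / real (Suc n)}) \<and> S x" for n
  proof (rule ccontr)
    let ?Q = "Pi\<^sub>E {..<d} (\<lambda>_. {0<..<1 / real (Suc n)})"
    assume no: "\<not> (\<exists>x. x \<in> ?Q \<and> S x)"
    have Q: "?Q \<in> sets (lb d)" by (intro sets_PiM_I_finite) auto
    have "AE x in lb d. x \<notin> ?Q" using assms by eventually_elim (use no in auto)
    then have "emeasure (lb d) ?Q = 0"
      using Q by (subst (asm) AE_iff_measurable[OF Q]) (use sets.sets_into_space[OF Q] in auto)
    moreover have "emeasure (lb d) ?Q = (\<Prod>i<d. emeasure lborel {0<..<1 / real (Suc n)})"
      by (subst lbp.emeasure_PiM) auto
    ultimately show False by (simp add: ennreal_power)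
  qed
  then obtain X where X: "\<And>n. X n \<in> Pi\<^sub>E {..<d} (\<lambda>_. {0<..<1 / real (Suc n)})" "\<And>n. S (X n)" by metis
  have lim: "(\<lambda>n. X n i) \<longlonglongrightarrow> Rd_zero d i" for i
  proof (cases "i < d")
    case True
    have "(\<lambda>n. X n i) \<longlonglongrightarrow> 0"
    proof (rule tendsto_sandwich[OF _ _ tendsto_const LIMSEQ_Suc[OF lim_1_over_n]])
      show "\<forall>\<^sub>F n in sequentially. 0 \<le> X n i" "\<forall>\<^sub>F n in sequentially. X n i \<le> 1 / real (Suc n)"
        using X(1) True by (auto simp: PiE_iff less_imp_le intro!: always_eventually)
    qed
    then show ?thesis using True by (simp add: Rd_zero_def)
  next
    case False
    then have "X n i = undefined" for n using X(1)[of n] by (auto simp: PiE_iff extensional_def)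
    then show ?thesis using False by (simp add: Rd_zero_def)
  qed
  show ?thesis
  proof (rule that[of X])
    show "X \<longlonglongrightarrow> Rd_zero d" by (rule tendsto_coordinatewise[OF lim])
    show "X n \<in> Rd d" "S (X n)" for n using X[of n] by (auto simp: Rd_def PiE_iff)
    fix n i assume "i < d"
    then have "0 < X n i" "X n i < 1 / real (Suc n)" using X(1)[of n] by (auto simp: PiE_iff)
    moreover have "1 / real (Suc n) \<le> 1" by simp
    ultimately show "\<bar>X n i\<bar> \<le> 1" by linarith
  qed
qed

lemma continuous_on_Rd_diff: "continuous_on UNIV (\<lambda>x. Rd_diff d x y)"
proof (rule continuous_on_coordinatewise_then_product)
  fix i
  show "continuous_on UNIV (\<lambda>x. Rd_diff d x y i)"
    by (cases "i < d") (auto simp: Rd_diff_def intro!: continuous_intros continuous_on_product_coordinates)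
qed

text \<open>The contraction property bounds the right-hand side only almost everywhere, but the
  truncated transform of a continuous function with Gaussian decay is continuous at the origin, so
  the bound is carried over along a sequence of good points.\<close>

lemma trunc_bound_at_zero:
  assumes A1: "nonneg_sublinear d A" and A2: "contraction_on_Linf d A"
    and hyp: "\<And>x. x \<in> Rd d \<Longrightarrow> norm (riesz_trunc d k P 1 f x) \<le> C * A (riesz d k P f) x"
    and P: "hom_poly d k P"
    and f: "continuous_on UNIV f" "f \<in> borel_measurable (lb d)" "\<And>x. norm (f x) \<le> K * exp (- \<epsilon> * (Rd_norm d x)\<^sup>2)" and \<epsilon>: "\<epsilon> > 0"
    and Rm: "riesz d k P f \<in> borel_measurable (leb d)" and RB: "\<And>x. x \<in> Rd d \<Longrightarrow> norm (riesz d k P f x) \<le> B"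
  shows "norm (riesz_trunc d k P 1 f (Rd_zero d)) \<le> max C 0 * B"
proof -
  note [measurable] = hom_poly_measurable[OF P] f(2)
  let ?g = "riesz d k P f"
  have B0: "0 \<le> B" using order.trans[OF norm_ge_zero RB[of "Rd_zero d"]] by simp
  have gB: "Linf_norm d ?g \<le> ereal B"
    unfolding Linf_norm_def by (rule esssup_I) (use Rm RB in \<open>auto simp: space_leb\<close>)
  then have g: "?g \<in> Linf d" using Rm by (auto simp: Linf_def)
  have "(\<lambda>_. 0) \<in> L2 d" by (simp add: L2_def)
  then have "?g \<in> L2_plus_Linf d" using g unfolding L2_plus_Linf_def by (force intro: exI[of _ "\<lambda>_. 0"])
  then have pos: "AE x in leb d. 0 \<le> A ?g x" using A1 by (auto simp: nonneg_sublinear_def)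
  have AB: "Linf_norm d (A ?g) \<le> ereal B"
    using A2 g gB order.trans by (auto simp: contraction_on_Linf_def)
  have "AE x in leb d. ereal (norm (A ?g x)) \<le> Linf_norm d (A ?g)"
    unfolding Linf_norm_def by (rule esssup_AE)
  then have le: "AE x in leb d. norm (A ?g x) \<le> B"
  proof eventually_elim
    case (elim x)
    from order.trans[OF elim AB] show ?case by simp
  qed
  have "AE x in leb d. norm (riesz_trunc d k P 1 f x) \<le> max C 0 * B"
    using pos le AE_space
  proof eventually_elim
    case (elim x)
    \<comment> \<open>\<open>C\<close> may be negative; since the operator is almost everywhere
      non-negative, it can be replaced by \<open>max C 0\<close>.\<close>
    have "C * A ?g x \<le> max C 0 * A ?g x" using elim by (intro mult_right_mono) auto
    also have "\<dots> \<le> max C 0 * B" using elim by (intro mult_left_mono) auto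
    finally show ?case using hyp[of x] elim by (auto simp: space_leb)
  qed
  then have "AE x in lb d. norm (riesz_trunc d k P 1 f x) \<le> max C 0 * B"
    unfolding leb_def AE_completion_iff .
  then obtain X where X: "X \<longlonglongrightarrow> Rd_zero d" "\<And>n. X n \<in> Rd d" "\<And>n. norm (riesz_trunc d k P 1 f (X n)) \<le> max C 0 * B"
    "\<And>n i. i < d \<Longrightarrow> \<bar>X n i\<bar> \<le> 1" by (rule AE_lb_near_zero) auto
  obtain BP where BP: "BP \<ge> 0" "\<And>x. norm (P x) \<le> BP * Rd_norm d x ^ k" using hom_poly_bound[OF P] by blast
  have K: "K \<ge> 0" using order.trans[OF norm_ge_zero f(3)[of "\<lambda>_. 0"]] by (simp add: zero_le_mult_iff)
  have meas: "(\<lambda>y. f (Rd_diff d x y)) \<in> borel_measurable (lb d)" for x by measurable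
  let ?F = "\<lambda>x y. indicator {y. Rd_norm d y > 1} y *\<^sub>R (P y / of_real (Rd_norm d y ^ (d + k)) * f (Rd_diff d x y))"
  have "(\<lambda>n. \<integral>y. ?F (X n) y \<partial>lb d) \<longlonglongrightarrow> (\<integral>y. ?F (Rd_zero d) y \<partial>lb d)"
  proof (rule integral_dominated_convergence[where w = "\<lambda>y. BP * K * exp (\<epsilon> * d) * exp (- (\<epsilon> / 2) * (Rd_norm d y)\<^sup>2)"])
    show "integrable (lb d) (\<lambda>y. BP * K * exp (\<epsilon> * d) * exp (- (\<epsilon> / 2) * (Rd_norm d y)\<^sup>2))"
      using has_bochner_integral_gauss_lb[of "\<epsilon> / 2" d] \<epsilon> by (intro integrable_mult_right) (simp add: has_bochner_integral_iff)
    have "(\<lambda>n. f (Rd_diff d (X n) y)) \<longlonglongrightarrow> f (Rd_diff d (Rd_zero d) y)" for y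
      using continuous_on_tendsto_compose[OF f(1) continuous_on_tendsto_compose[OF continuous_on_Rd_diff X(1)]] by simp
    then show "AE y in lb d. (\<lambda>n. ?F (X n) y) \<longlonglongrightarrow> ?F (Rd_zero d) y"
      by (intro always_eventually allI tendsto_intros)
    fix n
    show "AE y in lb d. norm (?F (X n) y) \<le> BP * K * exp (\<epsilon> * d) * exp (- (\<epsilon> / 2) * (Rd_norm d y)\<^sup>2)"
    proof (intro always_eventually allI)
      fix y
      show "norm (?F (X n) y) \<le> BP * K * exp (\<epsilon> * d) * exp (- (\<epsilon> / 2) * (Rd_norm d y)\<^sup>2)"
      proof (cases "Rd_norm d y > 1")
        case True
        have "norm (P y) / Rd_norm d y ^ (d + k) \<le> BP * Rd_norm d y ^ k / Rd_norm d y ^ (d + k)"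
          using BP by (intro divide_right_mono) auto
        also have "\<dots> = BP / Rd_norm d y ^ d" using True by (simp add: power_add)
        also have "\<dots> \<le> BP / 1" using True BP(1) by (intro divide_left_mono) auto
        finally have 1: "norm (P y) / Rd_norm d y ^ (d + k) \<le> BP" by simp
        \<comment> \<open>Coordinatewise,
          \<open>(x - y)\<^sup>2 \<ge> y\<^sup>2 / 2 - x\<^sup>2\<close> follows from
          \<open>(2 * x - y)\<^sup>2 \<ge> 0\<close>. Since the coordinates of \<open>X n\<close>
          are at most 1 in absolute value, the loss is at most \<open>d\<close>, whence the factor
          \<open>exp (\<epsilon> * d)\<close>.\<close>
        have "(\<Sum>i<d. (y i)\<^sup>2 / 2 - 1) \<le> (\<Sum>i<d. (X n i - y i)\<^sup>2)"
        proof (rule sum_mono)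
          fix i assume "i \<in> {..<d}"
          then have "\<bar>X n i\<bar>\<^sup>2 \<le> 1\<^sup>2" using X(4)[of i n] by (intro power_mono) auto
          moreover have "0 \<le> (2 * X n i - y i)\<^sup>2" by simp
          ultimately show "(y i)\<^sup>2 / 2 - 1 \<le> (X n i - y i)\<^sup>2"
            by (simp add: power2_eq_square algebra_simps)
        qed
        then have "(Rd_norm d y)\<^sup>2 / 2 - d \<le> (Rd_norm d (Rd_diff d (X n) y))\<^sup>2"
          by (simp add: Rd_norm_power2 Rd_diff_def sum_subtractf sum_divide_distrib)
        from mult_left_mono[OF this, of \<epsilon>] \<epsilon> have "- \<epsilon> * (Rd_norm d (Rd_diff d (X n) y))\<^sup>2 \<le> \<epsilon> * d + - (\<epsilon> / 2) * (Rd_norm d y)\<^sup>2"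
          by (simp add: algebra_simps)
        then have "K * exp (- \<epsilon> * (Rd_norm d (Rd_diff d (X n) y))\<^sup>2) \<le> K * exp (\<epsilon> * d + - (\<epsilon> / 2) * (Rd_norm d y)\<^sup>2)"
          using K by (intro mult_left_mono) auto
        with f(3) have 2: "norm (f (Rd_diff d (X n) y)) \<le> K * (exp (\<epsilon> * d) * exp (- (\<epsilon> / 2) * (Rd_norm d y)\<^sup>2))"
          unfolding exp_add[symmetric] by (rule order.trans)
        have "norm (?F (X n) y) = (norm (P y) / Rd_norm d y ^ (d + k)) * norm (f (Rd_diff d (X n) y))"
          using True by (simp add: norm_mult norm_divide norm_power)
        also have "\<dots> \<le> BP * (K * (exp (\<epsilon> * d) * exp (- (\<epsilon> / 2) * (Rd_norm d y)\<^sup>2)))"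
          by (intro mult_mono 1 2) (use BP in auto)
        finally show ?thesis by (simp only: mult.assoc)
      qed (use BP K in simp)
    qed
  qed (use meas in measurable)
  then have "(\<lambda>n. norm (riesz_trunc d k P 1 f (X n))) \<longlonglongrightarrow> norm (riesz_trunc d k P 1 f (Rd_zero d))"
    unfolding riesz_trunc_lb[OF hom_poly_measurable[OF P] meas] by (intro tendsto_intros)
  then show ?thesis by (rule LIMSEQ_le_const2) (use X(3) in auto)
qed

text \<open>The kernel is homogeneous of degree \<open>- d\<close>, so the Jacobian of the dilation
  cancels: the truncation at 1 of a dilated function becomes the truncation at \<open>t\<close> of
  the function itself, at the origin.\<close>

lemma riesz_trunc_dilate:
  assumes P: "hom_poly d k P" and [measurable]: "f \<in> borel_measurable (lb d)" and t: "t > 0"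
  shows "riesz_trunc d k P 1 (\<lambda>x. f (affine_map d (\<lambda>_. 0) t x)) (Rd_zero d) = of_real (riesz_const k d) *
    (\<integral>y. indicator {y. Rd_norm d y > t} y *\<^sub>R (P y / of_real (Rd_norm d y ^ (d + k)) * f (affine_map d (\<lambda>_. 0) (- 1) y)) \<partial>lb d)"
proof -
  note [measurable] = hom_poly_measurable[OF P]
  let ?F = "\<lambda>y. indicator {y. Rd_norm d y > t} y *\<^sub>R (P y / of_real (Rd_norm d y ^ (d + k)) * f (affine_map d (\<lambda>_. 0) (- 1) y))"
  let ?S = "affine_map d (\<lambda>_. 0) t"
  have "(\<integral>y. ?F y \<partial>lb d) = \<bar>t\<bar> ^ d *\<^sub>R (\<integral>y. ?F (?S y) \<partial>lb d)"
    using t by (intro integral_lb_affine) auto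
  also have "\<dots> = (\<integral>y. \<bar>t\<bar> ^ d *\<^sub>R ?F (?S y) \<partial>lb d)" by (rule integral_scaleR_right[symmetric])
  also have "\<dots> = (\<integral>y. indicator {y. Rd_norm d y > 1} y *\<^sub>R (P y / of_real (Rd_norm d y ^ (d + k)) * f (?S (Rd_diff d (Rd_zero d) y))) \<partial>lb d)"
  proof (rule Bochner_Integration.integral_cong[OF refl])
    fix y
    have arg: "affine_map d (\<lambda>_. 0) (- 1) (?S y) = ?S (Rd_diff d (Rd_zero d) y)"
      by (auto simp: affine_map_def Rd_diff_def Rd_zero_def fun_eq_iff)
    have ind: "indicator {y. Rd_norm d y > t} (?S y) = (indicator {y. Rd_norm d y > 1} y :: real)"
      using t by (simp add: indicator_def Rd_norm_affine_map)
    have "\<bar>t\<bar> ^ d *\<^sub>R (P (?S y) / of_real (Rd_norm d (?S y) ^ (d + k))) = P y / of_real (Rd_norm d y ^ (d + k))"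
      using t by (simp add: hom_poly_scale[OF P] Rd_norm_affine_map scaleR_conv_of_real power_mult_distrib power_add)
    moreover have "\<bar>t\<bar> ^ d *\<^sub>R (c *\<^sub>R (X * F)) = c *\<^sub>R ((\<bar>t\<bar> ^ d *\<^sub>R X) * F)" for c and X F :: complex
      by (simp add: scaleR_conv_of_real mult_ac)
    ultimately show "\<bar>t\<bar> ^ d *\<^sub>R ?F (?S y) = indicator {y. Rd_norm d y > 1} y *\<^sub>R (P y / of_real (Rd_norm d y ^ (d + k)) * f (?S (Rd_diff d (Rd_zero d) y)))"
      unfolding arg ind by (simp only:)
  qed
  finally have eq: "(\<integral>y. ?F y \<partial>lb d) = \<dots>" .
  have meas: "(\<lambda>y. f (?S (Rd_diff d (Rd_zero d) y))) \<in> borel_measurable (lb d)" by measurable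
  show ?thesis unfolding eq by (rule riesz_trunc_lb[OF hom_poly_measurable[OF P] meas])
qed

section \<open>Averaging over the truncation\<close>

text \<open>For \<open>v > 0\<close> this is the derivative of
  \<open>v powr M * exp (- \<zeta> * v)\<close>.\<close>

definition avg_weight :: "real \<Rightarrow> complex \<Rightarrow> real \<Rightarrow> complex" where
  "avg_weight M \<zeta> v = (of_real M - \<zeta> * of_real v) * of_real (v powr (M - 1)) * exp (- \<zeta> * of_real v)"

lemma measurable_avg_weight [measurable]: "avg_weight M \<zeta> \<in> borel_measurable borel"
  unfolding avg_weight_def[abs_def] by measurable

lemma norm_avg_weight_le:
  assumes "v > 0" "M > 0"
  shows "norm (avg_weight M \<zeta> v) \<le> (M + norm \<zeta> * v) * (v powr (M - 1) * exp (- Re \<zeta> * v))"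
proof -
  have "norm (of_real M - \<zeta> * of_real v) \<le> M + norm \<zeta> * v"
    using assms norm_triangle_ineq4[of "of_real M :: complex" "\<zeta> * of_real v"] by (simp add: norm_mult)
  from mult_right_mono[OF this, of "v powr (M - 1) * exp (- Re \<zeta> * v)"] show ?thesis
    by (simp add: avg_weight_def norm_mult mult.assoc)
qed

text \<open>The triangle inequality in the first factor leaves two Gamma integrals. The factor
  \<open>M\<close> in the bound is the price of averaging, which lowers the final growth from
  \<open>d powr (k / 2)\<close> to \<open>d powr (k / 2 - 1)\<close>.\<close>

lemma integrable_avg_weight:
  assumes \<zeta>: "Re \<zeta> > 0" and M: "M > 0"
  shows "integrable lborel (\<lambda>v. indicator {0<..} v *\<^sub>R avg_weight M \<zeta> v)"
    "(\<integral>v. norm (indicator {0<..} v *\<^sub>R avg_weight M \<zeta> v) \<partial>lborel)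
      \<le> M * (1 + norm \<zeta> / Re \<zeta>) * Gamma M / Re \<zeta> powr M"
proof -
  let ?B = "\<lambda>v. M * (indicator {0<..} v * (v powr (M - 1) * exp (- Re \<zeta> * v)))
    + norm \<zeta> * (indicator {0<..} v * (v powr (M + 1 - 1) * exp (- Re \<zeta> * v)))"
  have B: "has_bochner_integral lborel ?B (M * (Gamma M / Re \<zeta> powr M) + norm \<zeta> * (Gamma (M + 1) / Re \<zeta> powr (M + 1)))"
    by (intro has_bochner_integral_add has_bochner_integral_mult_right has_bochner_integral_Gamma) (use \<zeta> M in auto)
  have le: "norm (indicator {0<..} v *\<^sub>R avg_weight M \<zeta> v) \<le> ?B v" for v
  proof (cases "v > 0")
    case True
    then have "v powr (M + 1 - 1) = v * v powr (M - 1)" by (simp add: powr_diff)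
    then show ?thesis using True norm_avg_weight_le[OF True M, of \<zeta>] by (simp add: algebra_simps)
  qed simp
  show 1: "integrable lborel (\<lambda>v. indicator {0<..} v *\<^sub>R avg_weight M \<zeta> v)"
    by (rule Bochner_Integration.integrable_bound[OF integrable.intros[OF B]])
      (measurable, use le in \<open>auto intro: order.trans[OF _ abs_ge_self]\<close>)
  have "(\<integral>v. norm (indicator {0<..} v *\<^sub>R avg_weight M \<zeta> v) \<partial>lborel) \<le> (\<integral>v. ?B v \<partial>lborel)"
    by (intro integral_mono integrable_norm 1 integrable.intros[OF B] le)
  also have "\<dots> = M * (Gamma M / Re \<zeta> powr M) + norm \<zeta> * (Gamma (M + 1) / Re \<zeta> powr (M + 1))"
    by (rule has_bochner_integral_integral_eq[OF B])
  also have "Gamma (M + 1) = M * Gamma M"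
    using M nonpos_Ints_nonpos[of M] by (intro Gamma_plus1) (meson not_le)
  also have "Re \<zeta> powr (M + 1) = Re \<zeta> powr M * Re \<zeta>" using \<zeta> by (simp add: powr_add)
  finally show "(\<integral>v. norm (indicator {0<..} v *\<^sub>R avg_weight M \<zeta> v) \<partial>lborel)
      \<le> M * (1 + norm \<zeta> / Re \<zeta>) * Gamma M / Re \<zeta> powr M"
    using \<zeta> by (simp add: field_simps)
qed

lemma integral_avg_weight:
  assumes \<zeta>: "Re \<zeta> > 0" and M: "M > 0" and q: "q > 0"
  shows "(\<integral>v. indicator {0<..<q} v *\<^sub>R avg_weight M \<zeta> v \<partial>lborel) = of_real (q powr M) * exp (- \<zeta> * of_real q)"
proof -
  let ?F = "\<lambda>v. of_real (v powr M) * exp (- \<zeta> * of_real v)"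
  have e: "einterval (ereal 0) (ereal q) = {0<..<q}" by (auto simp: einterval_def)
  have "integrable lborel (\<lambda>v. indicator {0<..<q} v *\<^sub>R (indicator {0<..} v *\<^sub>R avg_weight M \<zeta> v))"
    by (rule integrable_mult_indicator[OF _ integrable_avg_weight(1)[OF \<zeta> M]]) simp
  also have "(\<lambda>v. indicator {0<..<q} v *\<^sub>R (indicator {0<..} v *\<^sub>R avg_weight M \<zeta> v)) = (\<lambda>v. indicator {0<..<q} v *\<^sub>R avg_weight M \<zeta> v)"
    by (auto simp: indicator_def)
  finally have int: "set_integrable lborel (einterval (ereal 0) (ereal q)) (avg_weight M \<zeta>)"
    unfolding set_integrable_def e by simp
  have "continuous_on {0..} ?F"
    using M by (intro continuous_intros continuous_on_powr') auto
  then have lim: "(?F \<longlongrightarrow> ?F x) (at x within {0..})" if "x \<in> {0..}" for x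
    using that unfolding continuous_on_def by blast
  have "(LBINT v=ereal 0..ereal q. avg_weight M \<zeta> v) = ?F q - ?F 0"
  proof (rule interval_integral_FTC_integrable[where F = ?F, OF _ _ _ int])
    show "ereal 0 < ereal q" using q by simp
    fix v assume "ereal 0 < ereal v"
    then have v: "v > 0" by simp
    have "((\<lambda>v. v powr M) has_real_derivative M * v powr (M - 1)) (at v)"
      using v by (auto intro!: derivative_eq_intros)
    from has_vector_derivative_of_real[OF this]
    have 1: "((\<lambda>v. of_real (v powr M) :: complex) has_vector_derivative of_real (M * v powr (M - 1))) (at v)" .
    have "((\<lambda>z. exp (- \<zeta> * z)) has_field_derivative exp (- \<zeta> * of_real v) * (- \<zeta>)) (at (of_real v))"
      by (auto intro!: derivative_eq_intros)
    from has_vector_derivative_real_field[OF this]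
    have 2: "((\<lambda>v. exp (- \<zeta> * of_real v)) has_vector_derivative exp (- \<zeta> * of_real v) * (- \<zeta>)) (at v)" .
    have p: "v powr M = v * v powr (M - 1)" using v by (simp add: powr_diff)
    show "(?F has_vector_derivative avg_weight M \<zeta> v) (at v)"
      by (rule has_vector_derivative_eq_rhs[OF has_vector_derivative_mult[OF 1 2]])
        (simp add: avg_weight_def p algebra_simps)
    show "isCont (avg_weight M \<zeta>) v"
      unfolding avg_weight_def using v by (intro continuous_intros) auto
  next
    \<comment> \<open>At 0 one argues by a one-sided limit, as \<open>v powr M\<close> need not be
      differentiable there; the boundary term is 0 because \<open>M > 0\<close>.\<close>
    have "(?F \<longlongrightarrow> ?F 0) (at 0 within {0<..})"
      by (rule tendsto_within_subset[OF lim]) auto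
    then show "((?F \<circ> real_of_ereal) \<longlongrightarrow> ?F 0) (at_right (ereal 0))" by (simp only: ereal_tendsto_simps)
    have "(?F \<longlongrightarrow> ?F q) (at q within {..<q} \<inter> {0..})"
      by (rule tendsto_within_subset[OF lim]) (use q in auto)
    moreover have "at q within {..<q} \<inter> {0..} = at_left q"
      using q by (intro at_within_nhd[where S = "{0<..}"]) auto
    ultimately show "((?F \<circ> real_of_ereal) \<longlongrightarrow> ?F q) (at_left (ereal q))" by (simp only: ereal_tendsto_simps)
  qed
  then show ?thesis
    using q by (simp add: interval_lebesgue_integral_def set_lebesgue_integral_def e)
qed

text \<open>By Fubini the Gaussian kernel is an average, with complex weight, of the kernels
  truncated at \<open>sqrt v\<close>. Each truncated integral is at most \<open>H\<close>, so the
  average is at most \<open>H\<close> times the total mass of the weight.\<close>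

lemma gauss_average_bound:
  fixes g :: "(nat \<Rightarrow> real) \<Rightarrow> complex"
  assumes P: "hom_poly d k P" "k \<ge> 1" and \<zeta>: "Re \<zeta> > 0" and M_def: "M = real (d + k) / 2"
    and [measurable]: "g \<in> borel_measurable (lb d)" and int: "integrable (lb d) (\<lambda>y. P y * g y)"
    and H: "\<And>v. v > 0 \<Longrightarrow> norm (\<integral>y. indicator {y. Rd_norm d y > sqrt v} y *\<^sub>R (P y / of_real (Rd_norm d y ^ (d + k)) * g y) \<partial>lb d) \<le> H"
  shows "norm (\<integral>y. P y * exp (- \<zeta> * of_real ((Rd_norm d y)\<^sup>2)) * g y \<partial>lb d) \<le> M * (1 + norm \<zeta> / Re \<zeta>) * Gamma M / Re \<zeta> powr M * H"
proof -
  interpret lb: sigma_finite_measure "lb d" by (rule sigma_finite_lb)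
  interpret pair_sigma_finite "lb d" lborel ..
  note [measurable] = hom_poly_measurable[OF P(1)]
  have M: "M > 0" using P(2) by (simp add: M_def)
  let ?\<kappa> = "avg_weight M \<zeta>"
  let ?G = "\<lambda>y. P y / of_real (Rd_norm d y ^ (d + k)) * g y"
  let ?h = "\<lambda>y v. (indicator {0<..} v * indicator {y. Rd_norm d y > sqrt v} y) *\<^sub>R (?\<kappa> v * ?G y)"
  have ind: "(indicator {0<..} v * indicator {y. Rd_norm d y > sqrt v} y :: real) = indicator {0<..<(Rd_norm d y)\<^sup>2} v" for v y
  proof -
    have "sqrt v < Rd_norm d y \<longleftrightarrow> v < (Rd_norm d y)\<^sup>2"
      using real_sqrt_less_iff[of v "(Rd_norm d y)\<^sup>2"] by simp
    then show ?thesis by (auto simp: indicator_def)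
  qed
  have rM: "((Rd_norm d y)\<^sup>2) powr M = Rd_norm d y ^ (d + k)" if "Rd_norm d y > 0" for y
    by (rule Rd_norm_power2_powr[OF that]) (simp add: M_def)
  \<comment> \<open>This crude pointwise bound on the weight serves only to justify Fubini; the
    constant in the claim comes from the integral of its norm.\<close>
  define K where "K = M + norm \<zeta> / Re \<zeta>"
  have K: "K > 0" using M \<zeta> by (simp add: K_def add_pos_nonneg)
  have \<kappa>_le: "norm (?\<kappa> v) \<le> K * v powr (M - 1)" if v: "v > 0" for v
  proof -
    have "Re \<zeta> * v \<le> exp (Re \<zeta> * v)" using exp_ge_add_one_self[of "Re \<zeta> * v"] by linarith
    then have "v * exp (- Re \<zeta> * v) \<le> 1 / Re \<zeta>" using \<zeta> by (simp add: exp_minus field_simps)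
    from mult_left_mono[OF this, of "norm \<zeta>"]
    have 1: "norm \<zeta> * v * exp (- Re \<zeta> * v) \<le> norm \<zeta> / Re \<zeta>" by (simp add: mult.assoc)
    have 2: "M * exp (- Re \<zeta> * v) \<le> M * 1" using v \<zeta> M by (intro mult_left_mono) auto
    have "(M + norm \<zeta> * v) * exp (- Re \<zeta> * v) \<le> K"
      using 1 2 by (simp add: K_def distrib_right)
    from mult_right_mono[OF this, of "v powr (M - 1)"] norm_avg_weight_le[OF v M, of \<zeta>] show ?thesis
      by (simp add: mult_ac)
  qed
  have pw: "has_bochner_integral lborel (\<lambda>v. indicator {0<..<q} v * v powr (M - 1)) (q powr M / M)" if q: "q > 0" for q
  proof (rule has_bochner_integral_nn_integral)
    have "(\<integral>\<^sup>+v. ennreal (indicator {0..q} v * v powr (M - 1)) \<partial>lborel) = ennreal (q powr M / M)"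
      using has_integral_powr_from_0[of "M - 1" q] M q by (intro nn_integral_has_integral_lebesgue) auto
    moreover have "(\<integral>\<^sup>+v. ennreal (indicator {0<..<q} v * v powr (M - 1)) \<partial>lborel) = (\<integral>\<^sup>+v. ennreal (indicator {0..q} v * v powr (M - 1)) \<partial>lborel)"
      by (intro nn_integral_cong_AE AE_I[where N = "{0, q}"]) (auto simp: indicator_def emeasure_lborel_countable)
    ultimately show "(\<integral>\<^sup>+v. ennreal (indicator {0<..<q} v * v powr (M - 1)) \<partial>lborel) = ennreal (q powr M / M)"
      using M by simp
  qed (use M in auto)
  have h_int: "integrable lborel (?h y)" for y
    unfolding ind
    by (rule Bochner_Integration.integrable_bound[OF integrable_norm[OF integrable_mult_left[OF integrable_avg_weight(1)[OF \<zeta> M], of "?G y"]]])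
      (auto simp: indicator_def)
  have h_norm: "(\<integral>v. norm (?h y v) \<partial>lborel) \<le> K / M * norm (P y * g y)" for y
  proof (cases "Rd_norm d y = 0")
    case False
    then have r: "Rd_norm d y > 0" using Rd_norm_nonneg[of d y] by linarith
    then have q: "(Rd_norm d y)\<^sup>2 > 0" by simp
    have "(\<integral>v. norm (?h y v) \<partial>lborel) \<le> (\<integral>v. K * norm (?G y) * (indicator {0<..<(Rd_norm d y)\<^sup>2} v * v powr (M - 1)) \<partial>lborel)"
    proof (rule integral_mono)
      show "integrable lborel (\<lambda>v. K * norm (?G y) * (indicator {0<..<(Rd_norm d y)\<^sup>2} v * v powr (M - 1)))"
        by (intro integrable_mult_right integrable.intros[OF pw[OF q]])
      show "norm (?h y v) \<le> K * norm (?G y) * (indicator {0<..<(Rd_norm d y)\<^sup>2} v * v powr (M - 1))" for v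
        unfolding ind norm_scaleR norm_mult[of "?\<kappa> v"] using mult_right_mono[OF \<kappa>_le[of v], of "norm (?G y)"]
        by (cases "v \<in> {0<..<(Rd_norm d y)\<^sup>2}") (auto simp: mult_ac)
    qed (intro integrable_norm h_int)
    also have "\<dots> = K * norm (?G y) * (Rd_norm d y ^ (d + k) / M)"
      using has_bochner_integral_integral_eq[OF pw[OF q]] rM[OF r] by simp
    also have "\<dots> = K / M * norm (P y * g y)"
      using r by (simp add: norm_mult norm_divide norm_power)
    finally show ?thesis .
  qed (use Rd_norm_zero_hom_poly[OF P, of y] in simp)
  have I: "integrable (lb d \<Otimes>\<^sub>M lborel) (\<lambda>(y, v). ?h y v)"
  proof (rule Fubini_integrable)
    show "integrable (lb d) (\<lambda>y. \<integral>v. norm (case (y, v) of (y, v) \<Rightarrow> ?h y v) \<partial>lborel)"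
      unfolding split_conv
    proof (rule Bochner_Integration.integrable_bound)
      show "integrable (lb d) (\<lambda>y. K / M * norm (P y * g y))" using int by (intro integrable_mult_right integrable_norm)
      show "(\<lambda>y. \<integral>v. norm (?h y v) \<partial>lborel) \<in> borel_measurable (lb d)"
        by (rule lborel.borel_measurable_lebesgue_integral) measurable
      show "AE y in lb d. norm (\<integral>v. norm (?h y v) \<partial>lborel) \<le> norm (K / M * norm (P y * g y))"
      proof (intro always_eventually allI)
        fix y
        have "0 \<le> (\<integral>v. norm (?h y v) \<partial>lborel)" by (intro Bochner_Integration.integral_nonneg) simp
        then have "norm (\<integral>v. norm (?h y v) \<partial>lborel) = (\<integral>v. norm (?h y v) \<partial>lborel)"
          unfolding real_norm_def by (rule abs_of_nonneg)
        also have "\<dots> \<le> norm (K / M * norm (P y * g y))"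
          unfolding real_norm_def by (rule order.trans[OF h_norm abs_ge_self])
        finally show "norm (\<integral>v. norm (?h y v) \<partial>lborel) \<le> norm (K / M * norm (P y * g y))" .
      qed
    qed
    show "AE y in lb d. integrable lborel (\<lambda>v. case (y, v) of (y, v) \<Rightarrow> ?h y v)"
      unfolding split_conv by (intro always_eventually allI h_int)
  qed measurable
  \<comment> \<open>Integrating the weight up to \<open>(Rd_norm d y)\<^sup>2\<close> yields the
    factor \<open>Rd_norm d y ^ (d + k)\<close>, which cancels the denominator of the kernel: this
    fixes the exponent \<open>M = (d + k) / 2\<close>.\<close>
  have inner: "(\<integral>v. ?h y v \<partial>lborel) = P y * exp (- \<zeta> * of_real ((Rd_norm d y)\<^sup>2)) * g y" for y
  proof (cases "Rd_norm d y = 0")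
    case False
    then have r: "Rd_norm d y > 0" using Rd_norm_nonneg[of d y] by linarith
    have "(\<integral>v. ?h y v \<partial>lborel) = (\<integral>v. (indicator {0<..<(Rd_norm d y)\<^sup>2} v *\<^sub>R ?\<kappa> v) * ?G y \<partial>lborel)"
      unfolding ind by (simp only: mult_scaleR_left)
    also have "\<dots> = of_real (Rd_norm d y ^ (d + k)) * exp (- \<zeta> * of_real ((Rd_norm d y)\<^sup>2)) * ?G y"
      unfolding integral_mult_left_zero integral_avg_weight[OF \<zeta> M zero_less_power[OF r]] rM[OF r] ..
    also have "\<dots> = P y * exp (- \<zeta> * of_real ((Rd_norm d y)\<^sup>2)) * g y" using r by simp
    finally show ?thesis .
  qed (use Rd_norm_zero_hom_poly[OF P, of y] in simp)
  let ?T = "\<lambda>v. \<integral>y. indicator {y. Rd_norm d y > sqrt v} y *\<^sub>R ?G y \<partial>lb d"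
  have hT: "(\<integral>y. ?h y v \<partial>lb d) = (indicator {0<..} v *\<^sub>R ?\<kappa> v) * ?T v" for v
  proof -
    have "(\<integral>y. ?h y v \<partial>lb d) = (\<integral>y. (indicator {0<..} v *\<^sub>R ?\<kappa> v) * (indicator {y. Rd_norm d y > sqrt v} y *\<^sub>R ?G y) \<partial>lb d)"
      by (intro Bochner_Integration.integral_cong refl) (simp only: mult_scaleR_left mult_scaleR_right scaleR_scaleR mult_ac)
    then show ?thesis by (simp only: integral_mult_right_zero)
  qed
  have "(\<integral>y. P y * exp (- \<zeta> * of_real ((Rd_norm d y)\<^sup>2)) * g y \<partial>lb d) = (\<integral>v. (indicator {0<..} v *\<^sub>R ?\<kappa> v) * ?T v \<partial>lborel)"
    using Fubini_integral[OF I] unfolding hT inner by simp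
  also have "norm \<dots> \<le> (\<integral>v. norm (indicator {0<..} v *\<^sub>R ?\<kappa> v) * H \<partial>lborel)"
  proof (rule norm_integral_le)
    have "integrable lborel (\<lambda>v. \<integral>y. ?h y v \<partial>lb d)"
      using integrable_snd[OF I] by simp
    then show "integrable lborel (\<lambda>v. (indicator {0<..} v *\<^sub>R ?\<kappa> v) * ?T v)" unfolding hT .
    show "integrable lborel (\<lambda>v. norm (indicator {0<..} v *\<^sub>R ?\<kappa> v) * H)"
      by (intro integrable_mult_left integrable_norm integrable_avg_weight[OF \<zeta> M])
    show "norm ((indicator {0<..} v *\<^sub>R ?\<kappa> v) * ?T v) \<le> norm (indicator {0<..} v *\<^sub>R ?\<kappa> v) * H" for v
    proof (cases "v > 0")
      case True
      show ?thesis unfolding norm_mult[of "indicator {0<..} v *\<^sub>R ?\<kappa> v"] by (intro mult_left_mono H[OF True]) simp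
    qed simp
  qed
  also have "\<dots> = (\<integral>v. norm (indicator {0<..} v *\<^sub>R ?\<kappa> v) \<partial>lborel) * H" by (rule integral_mult_left_zero)
  also have "\<dots> \<le> M * (1 + norm \<zeta> / Re \<zeta>) * Gamma M / Re \<zeta> powr M * H"
    using order.trans[OF norm_ge_zero H[OF zero_less_one]] by (intro mult_right_mono integrable_avg_weight(2)[OF \<zeta> M])
  finally show ?thesis .
qed

section \<open>Test functions\<close>

lemma integrable_pair_mult:
  fixes f :: "'a \<Rightarrow> complex" and g :: "'b \<Rightarrow> complex"
  assumes M: "sigma_finite_measure M" and N: "sigma_finite_measure N" and f: "integrable M f" and g: "integrable N g"
  shows "integrable (M \<Otimes>\<^sub>M N) (\<lambda>p. f (fst p) * g (snd p))"
proof -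
  interpret M: sigma_finite_measure M by (rule M)
  interpret N: sigma_finite_measure N by (rule N)
  interpret pair_sigma_finite M N ..
  note [measurable] = borel_measurable_integrable[OF f] borel_measurable_integrable[OF g]
  have "integrable (M \<Otimes>\<^sub>M N) (\<lambda>(x, y). f x * g y)"
  proof (rule Fubini_integrable)
    show "integrable M (\<lambda>x. \<integral>y. norm (case (x, y) of (x, y) \<Rightarrow> f x * g y) \<partial>N)"
      using f by (simp add: norm_mult)
    show "AE x in M. integrable N (\<lambda>y. case (x, y) of (x, y) \<Rightarrow> f x * g y)"
      using g by simp
  qed measurable
  then show ?thesis by (simp add: split_beta')
qed

lemma integral_pair_eq:
  fixes h :: "'a \<times> 'b \<Rightarrow> complex"
  assumes M: "sigma_finite_measure M" and N: "sigma_finite_measure N" and h: "integrable (M \<Otimes>\<^sub>M N) h"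
  shows "(\<integral>p. h p \<partial>(M \<Otimes>\<^sub>M N)) = (\<integral>x. (\<integral>y. h (x, y) \<partial>N) \<partial>M)"
proof -
  interpret M: sigma_finite_measure M by (rule M)
  interpret N: sigma_finite_measure N by (rule N)
  interpret pair_sigma_finite M N ..
  show ?thesis by (rule integral_fst'[OF h, symmetric])
qed

lemma sigma_finite_lb_pair: "sigma_finite_measure (lb d \<Otimes>\<^sub>M lb d)"
proof -
  interpret lb: sigma_finite_measure "lb d" by (rule sigma_finite_lb)
  interpret pair_sigma_finite "lb d" "lb d" ..
  show ?thesis by unfold_locales
qed

lemma hom_poly_one: "hom_poly d 0 (\<lambda>_. 1)"
  using hom_poly.add[OF hom_poly.zero[of d 0], of "\<lambda>_. 0" 1] by (simp add: Rd_monomial_def)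

lemma harmonic_const: "harmonic d (\<lambda>_. c)"
proof -
  have "partial i (\<lambda>_. c) = (\<lambda>_. 0)" for i c by (rule has_partial_partial) (simp add: has_partial_def)
  then show ?thesis by (simp add: harmonic_def)
qed

section \<open>Packets as superpositions of plane waves\<close>

lemma gauss_wave_integral:
  assumes "Re s > 0" "w \<in> Rd d"
  shows "has_bochner_integral (lb d) (gauss_wave d s w) (gauss_const s ^ d * exp (- of_real ((Rd_norm d w)\<^sup>2) / (4 * s)))"
  using Hecke[OF hom_poly_one harmonic_const assms] hom_poly_gauss_integrable[OF hom_poly_one assms(1), of d w]
  by (simp add: has_bochner_integral_iff)

text \<open>The normal density with variance 1/2 in each coordinate, scaled so that its
  characteristic function at \<open>2 * \<delta> * x\<close> is
  \<open>exp (- \<delta>\<^sup>2 * \<bar>x\<bar>\<^sup>2)\<close>. It is complex-valued because it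
  multiplies Fourier coefficients.\<close>

definition gauss_density :: "nat \<Rightarrow> (nat \<Rightarrow> real) \<Rightarrow> complex" where
  "gauss_density d \<eta> = of_real (exp (- 1 * (Rd_norm d \<eta>)\<^sup>2) / pi powr (d / 2))"

lemma measurable_gauss_density [measurable]: "gauss_density d \<in> borel_measurable (lb d)"
  unfolding gauss_density_def[abs_def] by measurable

lemma integrable_gauss_density: "integrable (lb d) (gauss_density d)"
  unfolding gauss_density_def[abs_def]
  using has_bochner_integral_gauss_lb[of 1 d]
  by (intro integrable_of_real integrable_divide) (simp add: has_bochner_integral_iff)

text \<open>The Gaussian factor provides decay; the Fourier integral is smooth once \<open>W\<close>
  has bounded support.\<close>

definition packet :: "nat \<Rightarrow> real \<Rightarrow> ((nat \<Rightarrow> real) \<Rightarrow> complex) \<Rightarrow> (nat \<Rightarrow> real) \<Rightarrow> complex" where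
  "packet d \<epsilon> W x = of_real (exp (- \<epsilon> * (Rd_norm d x)\<^sup>2)) * (\<integral>w. W w * plane_wave d w x \<partial>lb d)"

abbreviation dilate :: "nat \<Rightarrow> real \<Rightarrow> (nat \<Rightarrow> real) \<Rightarrow> nat \<Rightarrow> real" where
  "dilate d t \<equiv> affine_map d (\<lambda>_. 0) t"

text \<open>The Gaussian factor \<open>exp (- \<delta>\<^sup>2 |x|\<^sup>2)\<close> smears the frequency \<open>w\<close> of a plane wave into
  \<open>w + 2 \<delta> \<eta>\<close> with a Gaussian \<open>\<eta>\<close>; \<open>smear\<close> also contains the dilation by \<open>t\<close>.\<close>

definition smear :: "nat \<Rightarrow> real \<Rightarrow> real \<Rightarrow> (nat \<Rightarrow> real) \<times> (nat \<Rightarrow> real) \<Rightarrow> nat \<Rightarrow> real" where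
  "smear d t \<delta> p = affine_map d (\<lambda>i. t * fst p i) (t * (2 * \<delta>)) (snd p)"

lemma smear_dilate: "smear d t \<delta> p = dilate d t (smear d 1 \<delta> p)"
  by (auto simp: smear_def affine_map_def fun_eq_iff algebra_simps)

lemma measurable_smear [measurable]: "smear d t \<delta> \<in> measurable (lb d \<Otimes>\<^sub>M lb d) (lb d)"
  unfolding smear_def[abs_def] affine_map_def
proof (rule measurable_restrict)
  fix i assume i: "i \<in> {..<d}"
  have [measurable]: "(\<lambda>p. fst p i) \<in> borel_measurable (lb d \<Otimes>\<^sub>M lb d)" "(\<lambda>p. snd p i) \<in> borel_measurable (lb d \<Otimes>\<^sub>M lb d)"
    using i by (simp_all add: measurable_compose[OF measurable_fst] measurable_compose[OF measurable_snd])
  show "(\<lambda>p. t * fst p i + t * (2 * \<delta>) * snd p i) \<in> measurable (lb d \<Otimes>\<^sub>M lb d) lborel" by measurable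
qed

lemma Rd_norm_affine_map_le: "Rd_norm d (affine_map d a t y) \<le> Rd_norm d a + \<bar>t\<bar> * Rd_norm d y"
proof -
  have "Rd_norm d (affine_map d a t y) = L2_set (\<lambda>i. a i + t * y i) {..<d}"
    unfolding Rd_norm_def by (intro L2_set_cong) (auto simp: affine_map_def)
  also have "\<dots> \<le> L2_set a {..<d} + L2_set (\<lambda>i. t * y i) {..<d}" by (rule L2_set_triangle_ineq)
  also have "L2_set (\<lambda>i. t * y i) {..<d} = Rd_norm d (dilate d t y)"
    unfolding Rd_norm_def by (intro L2_set_cong) (auto simp: affine_map_def)
  finally show ?thesis by (simp add: Rd_norm_affine_map Rd_norm_def[symmetric])
qed

lemma Rd_dot_affine_map: "Rd_dot d (affine_map d a t y) x = Rd_dot d a x + t * Rd_dot d y x"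
  by (simp add: Rd_dot_def affine_map_def sum.distrib sum_distrib_left algebra_simps)

lemma plane_wave_dilate: "plane_wave d (dilate d t w) x = plane_wave d w (dilate d t x)"
proof -
  have "Rd_dot d (dilate d t w) x = Rd_dot d w (dilate d t x)"
    by (simp add: Rd_dot_def affine_map_def mult_ac)
  then show ?thesis by (simp add: plane_wave_def)
qed

text \<open>The Gaussian factor is replaced by the characteristic function of
  \<open>gauss_density\<close>, which turns the packet into a superposition of plane waves alone,
  the form on which the Riesz transform acts by its multiplier.\<close>

lemma packet_superposition:
  assumes W: "integrable (lb d) W"
  shows "integrable (lb d \<Otimes>\<^sub>M lb d) (\<lambda>p. W (fst p) * gauss_density d (snd p))"
    and "(\<integral>p. W (fst p) * gauss_density d (snd p) * plane_wave d (smear d t \<delta> p) x \<partial>(lb d \<Otimes>\<^sub>M lb d)) = packet d (\<delta>\<^sup>2) W (dilate d t x)"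
proof -
  show 1: "integrable (lb d \<Otimes>\<^sub>M lb d) (\<lambda>p. W (fst p) * gauss_density d (snd p))"
    by (rule integrable_pair_mult[OF sigma_finite_lb sigma_finite_lb W integrable_gauss_density])
  define u where "u = dilate d (- (t * (2 * \<delta>))) x"
  have u: "u \<in> Rd d" by (simp add: u_def)
  have split: "gauss_density d \<eta> * plane_wave d (smear d t \<delta> (w, \<eta>)) x
      = plane_wave d w (dilate d t x) * (of_real (1 / pi powr (d / 2)) * gauss_wave d 1 u \<eta>)" for w \<eta>
  proof -
    have 1: "Rd_dot d (smear d t \<delta> (w, \<eta>)) x = Rd_dot d w (dilate d t x) - Rd_dot d u \<eta>"
    proof -
      have "Rd_dot d u \<eta> = - (t * (2 * \<delta>)) * Rd_dot d \<eta> x"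
        unfolding u_def Rd_dot_affine_map by (simp add: Rd_dot_def mult.commute)
      moreover have "Rd_dot d (\<lambda>i. t * w i) x = Rd_dot d w (dilate d t x)"
        by (simp add: Rd_dot_def affine_map_def mult_ac)
      ultimately show ?thesis by (simp add: smear_def Rd_dot_affine_map)
    qed
    have "exp (\<i> * of_real (Rd_dot d (smear d t \<delta> (w, \<eta>)) x)) = exp (\<i> * of_real (Rd_dot d w (dilate d t x))) * exp (- \<i> * of_real (Rd_dot d u \<eta>))"
      unfolding 1 by (simp add: exp_add[symmetric] algebra_simps)
    moreover have "gauss_wave d 1 u \<eta> = of_real (exp (- 1 * (Rd_norm d \<eta>)\<^sup>2)) * exp (- \<i> * of_real (Rd_dot d u \<eta>))"
      unfolding gauss_wave_def exp_of_real[symmetric] exp_add[symmetric] by simp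
    ultimately show ?thesis
      unfolding gauss_density_def plane_wave_def by (simp add: mult_ac)
  qed
  have G: "(\<integral>\<eta>. gauss_density d \<eta> * plane_wave d (smear d t \<delta> (w, \<eta>)) x \<partial>lb d)
     = plane_wave d w (dilate d t x) * of_real (exp (- (\<delta>\<^sup>2) * (Rd_norm d (dilate d t x))\<^sup>2))" for w
  proof -
    have r1: "Re 1 > 0" by simp
    have "gauss_const 1 ^ d = of_real (pi powr (d / 2))"
      using gauss_const_of_real[of 1] by (simp add: powr_half_sqrt[symmetric] powr_power flip: of_real_power)
    moreover have "exp (- of_real ((Rd_norm d u)\<^sup>2) / (4 * 1)) = (of_real (exp (- (\<delta>\<^sup>2) * (Rd_norm d (dilate d t x))\<^sup>2)) :: complex)"
    proof -
      have "(Rd_norm d u)\<^sup>2 / 4 = \<delta>\<^sup>2 * (Rd_norm d (dilate d t x))\<^sup>2"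
        by (simp add: u_def Rd_norm_affine_map power_mult_distrib)
      moreover have "- of_real A / (4 * 1) = (of_real (- (A / 4)) :: complex)" for A by simp
      ultimately show ?thesis by (simp only: exp_of_real mult_minus_left)
    qed
    ultimately have "(\<integral>\<eta>. gauss_wave d 1 u \<eta> \<partial>lb d) = of_real (pi powr (d / 2)) * of_real (exp (- (\<delta>\<^sup>2) * (Rd_norm d (dilate d t x))\<^sup>2))"
      using has_bochner_integral_integral_eq[OF gauss_wave_integral[OF r1 u]] by (simp only:)
    then show ?thesis unfolding split integral_mult_right_zero by simp
  qed
  have 2: "integrable (lb d \<Otimes>\<^sub>M lb d) (\<lambda>p. W (fst p) * gauss_density d (snd p) * plane_wave d (smear d t \<delta> p) x)"
    by (rule integrable_plane_wave[OF 1 measurable_smear])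
  have "(\<integral>p. W (fst p) * gauss_density d (snd p) * plane_wave d (smear d t \<delta> p) x \<partial>(lb d \<Otimes>\<^sub>M lb d))
     = (\<integral>w. W w * (\<integral>\<eta>. gauss_density d \<eta> * plane_wave d (smear d t \<delta> (w, \<eta>)) x \<partial>lb d) \<partial>lb d)"
    using integral_pair_eq[OF sigma_finite_lb sigma_finite_lb 2]
    by (simp only: fst_conv snd_conv mult.assoc integral_mult_right_zero)
  also have "\<dots> = (\<integral>w. of_real (exp (- (\<delta>\<^sup>2) * (Rd_norm d (dilate d t x))\<^sup>2)) * (W w * plane_wave d w (dilate d t x)) \<partial>lb d)"
    unfolding G by (simp only: mult_ac)
  also have "\<dots> = packet d (\<delta>\<^sup>2) W (dilate d t x)"
    unfolding packet_def by (rule integral_mult_right_zero)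
  finally show "(\<integral>p. W (fst p) * gauss_density d (snd p) * plane_wave d (smear d t \<delta> p) x \<partial>(lb d \<Otimes>\<^sub>M lb d)) = packet d (\<delta>\<^sup>2) W (dilate d t x)" .
qed

lemma packet_continuous:
  assumes "integrable (lb d) W"
  shows "continuous_on UNIV (packet d \<epsilon> W)"
  unfolding packet_def[abs_def]
  by (intro continuous_intros continuous_on_Rd_norm continuous_on_plane_wave_integral[OF assms measurable_ident_sets[OF refl]])

lemma measurable_plane_wave_pair: "(\<lambda>p. plane_wave d (fst p) (snd p)) \<in> borel_measurable (lb d \<Otimes>\<^sub>M lb d)"
proof -
  have [measurable]: "(\<lambda>p. Rd_dot d (fst p) (snd p)) \<in> borel_measurable (lb d \<Otimes>\<^sub>M lb d)"
    unfolding Rd_dot_def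
    by (intro borel_measurable_sum borel_measurable_times) (simp_all add: measurable_compose[OF measurable_snd] measurable_compose[OF measurable_fst])
  show ?thesis unfolding plane_wave_def by measurable
qed

lemma measurable_plane_wave_integral:
  assumes "\<xi> \<in> measurable N (lb d)" and N: "sigma_finite_measure N" and c: "c \<in> borel_measurable N"
  shows "(\<lambda>x. \<integral>j. c j * plane_wave d (\<xi> j) x \<partial>N) \<in> borel_measurable (lb d)"
proof -
  interpret N: sigma_finite_measure N by (rule N)
  have [measurable]: "(\<lambda>p. plane_wave d (\<xi> (snd p)) (fst p)) \<in> borel_measurable (lb d \<Otimes>\<^sub>M N)"
  proof -
    have "(\<lambda>p. (\<xi> (snd p), fst p)) \<in> measurable (lb d \<Otimes>\<^sub>M N) (lb d \<Otimes>\<^sub>M lb d)"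
      using assms(1) by (intro measurable_Pair) (auto intro: measurable_compose[OF measurable_snd])
    from measurable_compose[OF this measurable_plane_wave_pair] show ?thesis by simp
  qed
  note [measurable] = c
  have "(\<lambda>p. c (snd p) * plane_wave d (\<xi> (snd p)) (fst p)) \<in> borel_measurable (lb d \<Otimes>\<^sub>M N)" by measurable
  then show ?thesis by (intro N.borel_measurable_lebesgue_integral) (simp add: split_beta')
qed

lemma packet_measurable:
  assumes "integrable (lb d) W"
  shows "packet d \<epsilon> W \<in> borel_measurable (lb d)"
proof -
  have [measurable]: "(\<lambda>x. \<integral>w. W w * plane_wave d w x \<partial>lb d) \<in> borel_measurable (lb d)"
    by (rule measurable_plane_wave_integral[OF measurable_ident_sets[OF refl] sigma_finite_lb borel_measurable_integrable[OF assms]])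
  show ?thesis unfolding packet_def[abs_def] by measurable
qed

lemma norm_plane_wave_integral_le:
  assumes c: "integrable N c" and \<xi>: "\<xi> \<in> measurable N (lb d)"
  shows "norm (\<integral>j. c j * plane_wave d (\<xi> j) x \<partial>N) \<le> (\<integral>j. norm (c j) \<partial>N)"
  by (rule norm_integral_le[OF integrable_plane_wave[OF c \<xi>] integrable_norm[OF c]]) (simp add: norm_mult)

lemma packet_decay:
  assumes "integrable (lb d) W"
  shows "norm (packet d \<epsilon> W x) \<le> (\<integral>w. norm (W w) \<partial>lb d) * exp (- \<epsilon> * (Rd_norm d x)\<^sup>2)"
  using norm_plane_wave_integral_le[OF assms measurable_ident_sets[OF refl], of x]
  by (simp add: packet_def norm_mult)

lemma packet_dilate_schwartz:
  assumes W: "integrable (lb d) W" and supp: "\<And>w. W w \<noteq> 0 \<Longrightarrow> Rd_norm d w \<le> R" and \<epsilon>: "\<epsilon> > 0" and t: "t > 0"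
  shows "(\<lambda>x. packet d \<epsilon> W (dilate d t x)) \<in> schwartz d"
proof (rule gauss_packet_schwartz)
  \<comment> \<open>The dilated packet is a single term with trivial monomial, Gaussian parameter
    \<open>\<epsilon> * t\<^sup>2\<close> and frequencies dilated by \<open>t\<close>;
    \<open>0 +\<close> and \<open>1 *\<close> are the shape of the introduction rule.\<close>
  have "gauss_packet d (\<epsilon> * t\<^sup>2) (lb d) (dilate d t) (t * R) (\<lambda>x. 0 + 1 * packet_term d (\<epsilon> * t\<^sup>2) (lb d) (dilate d t) (\<lambda>_. 0) W x)"
    by (rule gauss_packet.add[OF gauss_packet.zero W]) (use supp t in \<open>simp add: Rd_norm_affine_map\<close>)
  also have "(\<lambda>x. 0 + 1 * packet_term d (\<epsilon> * t\<^sup>2) (lb d) (dilate d t) (\<lambda>_. 0) W x) = (\<lambda>x. packet d \<epsilon> W (dilate d t x))"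
    by (simp add: packet_term_def packet_def Rd_monomial_def plane_wave_dilate Rd_norm_affine_map power_mult_distrib mult_ac)
  finally show "gauss_packet d (\<epsilon> * t\<^sup>2) (lb d) (dilate d t) (t * R) (\<lambda>x. packet d \<epsilon> W (dilate d t x))" .
qed (use \<epsilon> t in auto)

lemma integrable_hom_poly_decay:
  assumes P: "hom_poly d k P" and [measurable]: "g \<in> borel_measurable (lb d)"
    and g: "\<And>y. norm (g y) \<le> K * exp (- \<epsilon> * (Rd_norm d y)\<^sup>2)" and \<epsilon>: "\<epsilon> > 0"
  shows "integrable (lb d) (\<lambda>y. P y * g y)"
proof -
  note [measurable] = hom_poly_measurable[OF P]
  obtain B where B: "B \<ge> 0" "\<And>x. norm (P x) \<le> B * Rd_norm d x ^ k" using hom_poly_bound[OF P] by blast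
  show ?thesis
  proof (rule Bochner_Integration.integrable_bound)
    show "integrable (lb d) (\<lambda>y. B * K * (Rd_norm d y ^ k * exp (- \<epsilon> * (Rd_norm d y)\<^sup>2)))"
      by (intro integrable_mult_right integrable_norm_power_gauss \<epsilon>)
    show "AE y in lb d. norm (P y * g y) \<le> norm (B * K * (Rd_norm d y ^ k * exp (- \<epsilon> * (Rd_norm d y)\<^sup>2)))"
    proof (intro always_eventually allI)
      fix y
      have "norm (P y * g y) \<le> (B * Rd_norm d y ^ k) * (K * exp (- \<epsilon> * (Rd_norm d y)\<^sup>2))"
        unfolding norm_mult by (intro mult_mono B g) (use B in auto)
      also have "\<dots> = B * K * (Rd_norm d y ^ k * exp (- \<epsilon> * (Rd_norm d y)\<^sup>2))" by (simp only: mult_ac)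
      also have "\<dots> \<le> norm \<dots>" unfolding real_norm_def by (rule abs_ge_self)
      finally show "norm (P y * g y) \<le> norm (B * K * (Rd_norm d y ^ k * exp (- \<epsilon> * (Rd_norm d y)\<^sup>2)))" .
    qed
  qed measurable
qed

section \<open>The multiplier at smeared frequencies\<close>

lemma riesz_mult_measurable:
  assumes "hom_poly d k P"
  shows "riesz_mult d k P \<in> borel_measurable (lb d)"
proof -
  note [measurable] = hom_poly_measurable[OF assms]
  show ?thesis unfolding riesz_mult_def[abs_def] by measurable
qed

lemma riesz_mult_bound:
  assumes P: "hom_poly d k P"
  obtains B where "B \<ge> 0" "\<And>x. norm (riesz_mult d k P x) \<le> B"
proof -
  obtain B where B: "B \<ge> 0" "\<And>x. norm (P x) \<le> B * Rd_norm d x ^ k" using hom_poly_bound[OF P] by blast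
  have "norm (riesz_mult d k P x) \<le> B" for x
  proof (cases "Rd_norm d x ^ k = 0")
    case True
    then have "riesz_mult d k P x = 0" unfolding riesz_mult_def by (simp only: of_real_0 div_by_0)
    then show ?thesis using B(1) by simp
  next
    case False
    moreover have "0 \<le> Rd_norm d x ^ k" by simp
    ultimately have "0 < Rd_norm d x ^ k" by linarith
    moreover have "norm (riesz_mult d k P x) = norm (P x) / Rd_norm d x ^ k"
      by (simp add: riesz_mult_def norm_mult norm_divide norm_power)
    ultimately show ?thesis using B(2)[of x] by (simp add: pos_divide_le_eq)
  qed
  with B(1) that show ?thesis by blast
qed

lemma riesz_mult_dilate:
  assumes "hom_poly d k P" "t > 0"
  shows "riesz_mult d k P (dilate d t x) = riesz_mult d k P x"
  using assms(2) by (simp add: riesz_mult_def hom_poly_scale[OF assms(1)] Rd_norm_affine_map power_mult_distrib)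

text \<open>An integrated norm of the change of the multiplier caused by smearing. The dilation
  parameter is set to 1: the multiplier is homogeneous of degree 0, so the same error serves for
  every \<open>t\<close>.\<close>

definition smear_error :: "nat \<Rightarrow> nat \<Rightarrow> ((nat \<Rightarrow> real) \<Rightarrow> complex) \<Rightarrow> ((nat \<Rightarrow> real) \<Rightarrow> complex) \<Rightarrow> real \<Rightarrow> real" where
  "smear_error d k P W \<delta> = (\<integral>p. norm (W (fst p) * gauss_density d (snd p) * (riesz_mult d k P (smear d 1 \<delta> p) - riesz_mult d k P (fst p))) \<partial>(lb d \<Otimes>\<^sub>M lb d))"

text \<open>The multiplier at a smeared frequency is split into its value at the original frequency
  and a difference. The first part recombines to a packet whose Gaussian factor is at most 1, so
  that \<open>S\<close> bounds it; the second is at most \<open>smear_error\<close>, whatever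
  \<open>t\<close> is.\<close>

lemma packet_riesz_bound:
  assumes P: "hom_poly d k P" "harmonic d P" "k \<ge> 1" and d: "d > 0"
    and W: "integrable (lb d) W" and supp: "\<And>w. W w \<noteq> 0 \<Longrightarrow> Rd_norm d w \<le> R" and \<delta>: "\<delta> > 0" and t: "t > 0"
    and S: "\<And>x. norm (\<integral>w. W w * riesz_mult d k P w * plane_wave d w x \<partial>lb d) \<le> S"
  shows "riesz d k P (\<lambda>x. packet d (\<delta>\<^sup>2) W (dilate d t x)) \<in> borel_measurable (leb d)"
    "\<And>x. x \<in> Rd d \<Longrightarrow> norm (riesz d k P (\<lambda>x. packet d (\<delta>\<^sup>2) W (dilate d t x)) x) \<le> S + smear_error d k P W \<delta>"
proof -
  let ?N = "lb d \<Otimes>\<^sub>M lb d"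
  let ?\<sigma> = "riesz_mult d k P"
  let ?f = "\<lambda>x. packet d (\<delta>\<^sup>2) W (dilate d t x)"
  let ?c = "\<lambda>p. W (fst p) * gauss_density d (snd p)"
  note [measurable] = riesz_mult_measurable[OF P(1)] borel_measurable_integrable[OF W] packet_measurable[OF W]
  obtain B where B: "B \<ge> 0" "\<And>x. norm (?\<sigma> x) \<le> B" using riesz_mult_bound[OF P(1)] by blast
  note c = packet_superposition(1)[OF W]
  \<comment> \<open>The first moment of the smeared frequencies, required by
    \<open>riesz_plane_waves\<close>: it is finite because \<open>W\<close> has bounded support and
    the Gaussian density has a finite first moment.\<close>
  have c2: "integrable ?N (\<lambda>p. Rd_norm d (smear d t \<delta> p) * norm (?c p))"
  proof (rule Bochner_Integration.integrable_bound)
    have "integrable (lb d) (\<lambda>\<eta>. of_real (Rd_norm d \<eta>) * gauss_density d \<eta>)"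
    proof -
      have "integrable (lb d) (\<lambda>\<eta>. of_real (1 / pi powr (d / 2) * (Rd_norm d \<eta> ^ 1 * exp (- 1 * (Rd_norm d \<eta>)\<^sup>2))) :: complex)"
        by (intro integrable_of_real integrable_mult_right integrable_norm_power_gauss) simp
      then show ?thesis by (simp add: gauss_density_def mult_ac)
    qed
    note I = integrable_norm[OF integrable_pair_mult[OF sigma_finite_lb sigma_finite_lb W this]]
    show "integrable ?N (\<lambda>p. t * R * norm (?c p) + t * (2 * \<delta>) * norm (W (fst p) * (of_real (Rd_norm d (snd p)) * gauss_density d (snd p))))"
      by (rule Bochner_Integration.integrable_add[OF integrable_mult_right[OF integrable_norm[OF c]] integrable_mult_right[OF I]])
    show "AE p in ?N. norm (Rd_norm d (smear d t \<delta> p) * norm (?c p)) \<le> norm (t * R * norm (?c p) + t * (2 * \<delta>) * norm (W (fst p) * (of_real (Rd_norm d (snd p)) * gauss_density d (snd p))))"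
    proof (intro always_eventually allI)
      fix p
      show "norm (Rd_norm d (smear d t \<delta> p) * norm (?c p)) \<le> norm (t * R * norm (?c p) + t * (2 * \<delta>) * norm (W (fst p) * (of_real (Rd_norm d (snd p)) * gauss_density d (snd p))))"
      proof (cases "W (fst p) = 0")
        case False
        have eq: "Rd_norm d (\<lambda>i. t * fst p i) = t * Rd_norm d (fst p)"
        proof -
          have "Rd_norm d (\<lambda>i. t * fst p i) = Rd_norm d (dilate d t (fst p))"
            unfolding Rd_norm_def by (intro L2_set_cong) (auto simp: affine_map_def)
          then show ?thesis using t by (simp add: Rd_norm_affine_map)
        qed
        have "Rd_norm d (smear d t \<delta> p) \<le> t * Rd_norm d (fst p) + t * (2 * \<delta>) * Rd_norm d (snd p)"
          using Rd_norm_affine_map_le[of d "\<lambda>i. t * fst p i" "t * (2 * \<delta>)" "snd p"] t \<delta> unfolding eq smear_def by simp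
        also have "\<dots> \<le> t * R + t * (2 * \<delta>) * Rd_norm d (snd p)" using supp[OF False] t by simp
        finally have "Rd_norm d (smear d t \<delta> p) * norm (?c p) \<le> (t * R + t * (2 * \<delta>) * Rd_norm d (snd p)) * norm (?c p)"
          by (intro mult_right_mono) auto
        also have "\<dots> = t * R * norm (?c p) + t * (2 * \<delta>) * norm (W (fst p) * (of_real (Rd_norm d (snd p)) * gauss_density d (snd p)))"
          by (simp add: norm_mult algebra_simps)
        finally show ?thesis by simp
      qed simp
    qed
  qed measurable
  have f_rep: "?f z = (\<integral>p. ?c p * plane_wave d (smear d t \<delta> p) z \<partial>?N)" for z
    by (rule packet_superposition(2)[OF W, symmetric])
  have f_meas: "(\<lambda>y. ?f (Rd_diff d x y)) \<in> borel_measurable (lb d)" for x by measurable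
  have f_int: "integrable (lb d) (\<lambda>y. P y * ?f (Rd_diff d x y))" for x
  proof (rule integrable_hom_poly_decay[OF P(1) f_meas])
    let ?K = "\<integral>w. norm (W w) \<partial>lb d"
    let ?e = "(\<delta> * t)\<^sup>2"
    show "?e / 2 > 0" using \<delta> t by simp
    fix y
    have "(\<Sum>i<d. (y i)\<^sup>2 / 2 - (x i)\<^sup>2) \<le> (\<Sum>i<d. (x i - y i)\<^sup>2)"
    proof (rule sum_mono)
      fix i
      have "0 \<le> (2 * x i - y i)\<^sup>2" by simp
      then show "(y i)\<^sup>2 / 2 - (x i)\<^sup>2 \<le> (x i - y i)\<^sup>2" by (simp add: power2_eq_square algebra_simps)
    qed
    then have "(Rd_norm d y)\<^sup>2 / 2 - (Rd_norm d x)\<^sup>2 \<le> (Rd_norm d (Rd_diff d x y))\<^sup>2"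
      by (simp add: Rd_norm_power2 Rd_diff_def sum_subtractf sum_divide_distrib)
    from mult_left_mono[OF this, of ?e]
    have le: "- ?e * (Rd_norm d (Rd_diff d x y))\<^sup>2 \<le> ?e * (Rd_norm d x)\<^sup>2 + - (?e / 2) * (Rd_norm d y)\<^sup>2"
      by (simp add: algebra_simps)
    have "norm (?f (Rd_diff d x y)) \<le> ?K * exp (- (\<delta>\<^sup>2) * (Rd_norm d (dilate d t (Rd_diff d x y)))\<^sup>2)"
      by (rule packet_decay[OF W])
    also have "\<dots> = ?K * exp (- ?e * (Rd_norm d (Rd_diff d x y))\<^sup>2)"
      using t by (simp add: Rd_norm_affine_map power_mult_distrib mult_ac)
    also have "\<dots> \<le> ?K * exp (?e * (Rd_norm d x)\<^sup>2 + - (?e / 2) * (Rd_norm d y)\<^sup>2)"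
      using le by (intro mult_left_mono Bochner_Integration.integral_nonneg) auto
    finally show "norm (?f (Rd_diff d x y)) \<le> ?K * exp (?e * (Rd_norm d x)\<^sup>2) * exp (- (?e / 2) * (Rd_norm d y)\<^sup>2)"
      by (simp only: exp_add mult.assoc)
  qed
  have rep: "riesz d k P ?f x = (\<integral>p. ?c p * ?\<sigma> (smear d t \<delta> p) * plane_wave d (smear d t \<delta> p) x \<partial>?N)" if x: "x \<in> Rd d" for x
    by (rule riesz_plane_waves[OF P d sigma_finite_lb_pair measurable_smear c c2 f_rep x f_int f_meas])
  have "(\<lambda>x. \<integral>p. ?c p * ?\<sigma> (smear d t \<delta> p) * plane_wave d (smear d t \<delta> p) x \<partial>?N) \<in> borel_measurable (lb d)"
    by (rule measurable_plane_wave_integral[OF measurable_smear sigma_finite_lb_pair]) measurable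
  then have "(\<lambda>x. \<integral>p. ?c p * ?\<sigma> (smear d t \<delta> p) * plane_wave d (smear d t \<delta> p) x \<partial>?N) \<in> borel_measurable (leb d)"
    unfolding leb_def by (rule measurable_completion)
  then show "riesz d k P ?f \<in> borel_measurable (leb d)"
    by (rule measurable_cong[THEN iffD2, rotated]) (simp add: rep space_leb)
  have W\<sigma>: "integrable (lb d) (\<lambda>w. W w * ?\<sigma> w)"
  proof (rule Bochner_Integration.integrable_bound)
    show "integrable (lb d) (\<lambda>w. of_real B * W w)" using W by (rule integrable_mult_right)
    show "AE w in lb d. norm (W w * ?\<sigma> w) \<le> norm (of_real B * W w)"
    proof (intro always_eventually allI)
      fix w
      have "norm (?\<sigma> w) * norm (W w) \<le> B * norm (W w)" by (intro mult_right_mono B(2)) simp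
      then show "norm (W w * ?\<sigma> w) \<le> norm (of_real B * W w)" using B(1) by (simp add: norm_mult mult.commute)
    qed
  qed measurable
  fix x assume x: "x \<in> Rd d"
  let ?c1 = "\<lambda>p. W (fst p) * ?\<sigma> (fst p) * gauss_density d (snd p)"
  let ?c2 = "\<lambda>p. ?c p * (?\<sigma> (smear d 1 \<delta> p) - ?\<sigma> (fst p))"
  have i1: "integrable ?N ?c1" by (rule packet_superposition(1)[OF W\<sigma>])
  have i2: "integrable ?N ?c2"
  proof (rule Bochner_Integration.integrable_bound)
    show "integrable ?N (\<lambda>p. of_real (2 * B) * ?c p)" using c by (rule integrable_mult_right)
    have le: "norm (?\<sigma> (smear d 1 \<delta> p) - ?\<sigma> (fst p)) \<le> 2 * B" for p
      using B(2)[of "smear d 1 \<delta> p"] B(2)[of "fst p"] norm_triangle_ineq4[of "?\<sigma> (smear d 1 \<delta> p)" "?\<sigma> (fst p)"] by linarith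
    show "AE p in ?N. norm (?c2 p) \<le> norm (of_real (2 * B) * ?c p)"
    proof (intro always_eventually allI)
      fix p
      have "norm (?c2 p) \<le> norm (?c p) * (2 * B)"
        unfolding norm_mult[of "?c p"] by (intro mult_left_mono le) simp
      also have "\<dots> = norm (of_real (2 * B) * ?c p)"
        unfolding norm_mult[of "of_real (2 * B)"] using B(1) by (simp add: mult.commute)
      finally show "norm (?c2 p) \<le> norm (of_real (2 * B) * ?c p)" .
    qed
  qed measurable
  have "riesz d k P ?f x = (\<integral>p. ?c1 p * plane_wave d (smear d t \<delta> p) x + ?c2 p * plane_wave d (smear d t \<delta> p) x \<partial>?N)"
    unfolding rep[OF x] smear_dilate[of d t \<delta>] riesz_mult_dilate[OF P(1) t]
    by (intro Bochner_Integration.integral_cong refl) (simp add: algebra_simps)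
  also have "\<dots> = packet d (\<delta>\<^sup>2) (\<lambda>w. W w * ?\<sigma> w) (dilate d t x) + (\<integral>p. ?c2 p * plane_wave d (smear d t \<delta> p) x \<partial>?N)"
    unfolding packet_superposition(2)[OF W\<sigma>, symmetric]
    by (intro Bochner_Integration.integral_add integrable_plane_wave i1 i2 measurable_smear)
  also have "norm \<dots> \<le> S + smear_error d k P W \<delta>"
  proof (intro norm_triangle_le add_mono)
    have "norm (packet d (\<delta>\<^sup>2) (\<lambda>w. W w * ?\<sigma> w) (dilate d t x)) \<le> 1 * S"
      unfolding packet_def norm_mult by (intro mult_mono S) auto
    then show "norm (packet d (\<delta>\<^sup>2) (\<lambda>w. W w * ?\<sigma> w) (dilate d t x)) \<le> S" by simp
    show "norm (\<integral>p. ?c2 p * plane_wave d (smear d t \<delta> p) x \<partial>?N) \<le> smear_error d k P W \<delta>"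
      unfolding smear_error_def by (rule norm_plane_wave_integral_le[OF i2 measurable_smear])
  qed
  finally show "norm (riesz d k P ?f x) \<le> S + smear_error d k P W \<delta>" .
qed

lemma Rd_norm_tendsto:
  assumes "X \<longlonglongrightarrow> x"
  shows "(\<lambda>n. Rd_norm d (X n)) \<longlonglongrightarrow> Rd_norm d x"
  using continuous_on_tendsto_compose[OF continuous_on_Rd_norm assms] by simp

lemma smear_tendsto:
  assumes "\<delta> \<longlonglongrightarrow> 0" "w \<in> Rd d"
  shows "(\<lambda>n. smear d 1 (\<delta> n) (w, \<eta>)) \<longlonglongrightarrow> w"
proof (rule tendsto_coordinatewise)
  fix i
  show "(\<lambda>n. smear d 1 (\<delta> n) (w, \<eta>) i) \<longlonglongrightarrow> w i"
  proof (cases "i < d")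
    case True
    have "(\<lambda>n. 1 * w i + 1 * (2 * \<delta> n) * \<eta> i) \<longlonglongrightarrow> 1 * w i + 1 * (2 * 0) * \<eta> i"
      by (intro tendsto_intros assms)
    then show ?thesis using True by (simp add: smear_def affine_map_def)
  next
    case False
    then have "smear d 1 (\<delta> n) (w, \<eta>) i = w i" for n
      using assms(2) by (auto simp: smear_def affine_map_def Rd_def PiE_iff extensional_def)
    then show ?thesis by simp
  qed
qed

text \<open>Dominated convergence: the multiplier is bounded everywhere and continuous away from the
  origin, so \<open>W\<close> is required to vanish where the norm of the frequency is 0.\<close>

lemma smear_error_tendsto:
  assumes P: "hom_poly d k P" and W: "integrable (lb d) W" and supp: "\<And>w. W w \<noteq> 0 \<Longrightarrow> Rd_norm d w > 0"
    and \<delta>: "\<delta> \<longlonglongrightarrow> 0"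
  shows "(\<lambda>n. smear_error d k P W (\<delta> n)) \<longlonglongrightarrow> 0"
proof -
  let ?N = "lb d \<Otimes>\<^sub>M lb d"
  let ?\<sigma> = "riesz_mult d k P"
  let ?c = "\<lambda>p. W (fst p) * gauss_density d (snd p)"
  note [measurable] = riesz_mult_measurable[OF P] borel_measurable_integrable[OF W]
  obtain B where B: "B \<ge> 0" "\<And>x. norm (?\<sigma> x) \<le> B" using riesz_mult_bound[OF P] by blast
  note c = packet_superposition(1)[OF W]
  have "(\<lambda>n. smear_error d k P W (\<delta> n)) \<longlonglongrightarrow> (\<integral>p. 0 \<partial>?N)"
    unfolding smear_error_def
  proof (rule integral_dominated_convergence[where w = "\<lambda>p. 2 * B * norm (?c p)"])
    show "integrable ?N (\<lambda>p. 2 * B * norm (?c p))" using c by (intro integrable_mult_right integrable_norm)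
    show "AE p in ?N. (\<lambda>n. norm (?c p * (?\<sigma> (smear d 1 (\<delta> n) p) - ?\<sigma> (fst p)))) \<longlonglongrightarrow> 0"
    proof (rule AE_I2)
      fix p assume "p \<in> space ?N"
      then obtain w \<eta> where p: "p = (w, \<eta>)" "w \<in> Rd d" by (auto simp: space_pair_measure space_lb)
      show "(\<lambda>n. norm (?c p * (?\<sigma> (smear d 1 (\<delta> n) p) - ?\<sigma> (fst p)))) \<longlonglongrightarrow> 0"
      proof (cases "W w = 0")
        case False
        note lim = smear_tendsto[OF \<delta> p(2), of \<eta>]
        have 1: "(\<lambda>n. P (smear d 1 (\<delta> n) (w, \<eta>))) \<longlonglongrightarrow> P w"
          using continuous_on_tendsto_compose[OF hom_poly_continuous[OF P] lim] by simp
        have 2: "(\<lambda>n. complex_of_real (Rd_norm d (smear d 1 (\<delta> n) (w, \<eta>)) ^ k)) \<longlonglongrightarrow> of_real (Rd_norm d w ^ k)"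
          by (intro tendsto_intros Rd_norm_tendsto lim)
        have "(\<lambda>n. ?\<sigma> (smear d 1 (\<delta> n) (w, \<eta>))) \<longlonglongrightarrow> ?\<sigma> w"
          unfolding riesz_mult_def
          by (rule tendsto_divide[OF tendsto_mult[OF tendsto_const 1] 2]) (use supp[OF False] in simp)
        then have "(\<lambda>n. norm (?c p * (?\<sigma> (smear d 1 (\<delta> n) p) - ?\<sigma> (fst p)))) \<longlonglongrightarrow> norm (?c p * (?\<sigma> w - ?\<sigma> w))"
          unfolding p(1) fst_conv by (intro tendsto_intros)
        then show ?thesis by simp
      qed (simp add: p)
    qed
    fix n
    show "AE p in ?N. norm (norm (?c p * (?\<sigma> (smear d 1 (\<delta> n) p) - ?\<sigma> (fst p)))) \<le> 2 * B * norm (?c p)"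
    proof (intro always_eventually allI)
      fix p
      have "norm (?\<sigma> (smear d 1 (\<delta> n) p) - ?\<sigma> (fst p)) \<le> 2 * B"
        using B(2)[of "smear d 1 (\<delta> n) p"] B(2)[of "fst p"] norm_triangle_ineq4[of "?\<sigma> (smear d 1 (\<delta> n) p)" "?\<sigma> (fst p)"] by linarith
      then have "norm (?c p) * norm (?\<sigma> (smear d 1 (\<delta> n) p) - ?\<sigma> (fst p)) \<le> norm (?c p) * (2 * B)"
        by (intro mult_left_mono) auto
      then show "norm (norm (?c p * (?\<sigma> (smear d 1 (\<delta> n) p) - ?\<sigma> (fst p)))) \<le> 2 * B * norm (?c p)"
        unfolding real_norm_def abs_norm_cancel unfolding norm_mult[of "?c p"] by (simp only: mult.commute)
    qed
  qed measurable
  then show ?thesis by simp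
qed

section \<open>From the pointwise bound to an inequality between Gaussian integrals\<close>

definition pointwise_riesz_bound :: "nat \<Rightarrow> nat \<Rightarrow> ((nat \<Rightarrow> real) \<Rightarrow> complex) \<Rightarrow> (((nat \<Rightarrow> real) \<Rightarrow> complex) \<Rightarrow> (nat \<Rightarrow> real) \<Rightarrow> real) \<Rightarrow> real \<Rightarrow> bool" where
  "pointwise_riesz_bound d k P A C \<longleftrightarrow> nonneg_sublinear d A \<and> contraction_on_Linf d A \<and>
     (\<forall>f\<in>schwartz d. \<forall>x\<in>Rd d. norm (riesz_trunc d k P 1 f x) \<le> C * A (riesz d k P f) x)"

text \<open>All dilates of the packet have the same bound on their Riesz transforms. Hence the
  hypothesis for the truncation at 1 controls all truncations of one fixed function, and these can
  be averaged.\<close>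

lemma packet_gauss_bound:
  assumes P: "hom_poly d k P" "harmonic d P" "k \<ge> 1" and d: "d > 0"
    and A: "pointwise_riesz_bound d k P A C"
    and W: "integrable (lb d) W" and supp: "\<And>w. W w \<noteq> 0 \<Longrightarrow> Rd_norm d w \<le> R" and \<delta>: "\<delta> > 0"
    and S: "\<And>x. norm (\<integral>w. W w * riesz_mult d k P w * plane_wave d w x \<partial>lb d) \<le> S"
    and \<zeta>: "Re \<zeta> > 0" and M_def: "M = real (d + k) / 2"
  shows "riesz_const k d * norm (\<integral>y. P y * exp (- \<zeta> * of_real ((Rd_norm d y)\<^sup>2)) * packet d (\<delta>\<^sup>2) W (dilate d (- 1) y) \<partial>lb d)
    \<le> M * (1 + norm \<zeta> / Re \<zeta>) * Gamma M / Re \<zeta> powr M * (max C 0 * (S + smear_error d k P W \<delta>))"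
proof -
  note [measurable] = hom_poly_measurable[OF P(1)] packet_measurable[OF W]
  let ?f = "packet d (\<delta>\<^sup>2) W"
  let ?H = "max C 0 * (S + smear_error d k P W \<delta>)"
  \<comment> \<open>At the origin a convolution sees \<open>f\<close> at \<open>- y\<close>, hence
    the dilation by \<open>- 1\<close>. The constant is absorbed so that \<open>trunc\<close> bounds
    exactly the truncated transform.\<close>
  let ?g = "\<lambda>y. of_real (riesz_const k d) * ?f (dilate d (- 1) y)"
  have \<gamma>: "riesz_const k d \<ge> 0"
    using P(3) by (auto simp: riesz_const_def intro!: divide_nonneg_nonneg mult_nonneg_nonneg Gamma_real_nonneg)
  have trunc: "norm (\<integral>y. indicator {y. Rd_norm d y > t} y *\<^sub>R (P y / of_real (Rd_norm d y ^ (d + k)) * ?g y) \<partial>lb d) \<le> ?H" if t: "t > 0" for t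
  proof -
    let ?ft = "\<lambda>x. ?f (dilate d t x)"
    have sch: "?ft \<in> schwartz d" by (rule packet_dilate_schwartz[OF W supp]) (use \<delta> t in auto)
    have "norm (riesz_trunc d k P 1 ?ft (Rd_zero d)) \<le> ?H"
    proof (rule trunc_bound_at_zero[where A = A and \<epsilon> = "\<delta>\<^sup>2 * t\<^sup>2" and K = "\<integral>w. norm (W w) \<partial>lb d"])
      show "nonneg_sublinear d A" "contraction_on_Linf d A" using A by (auto simp: pointwise_riesz_bound_def)
      show "\<And>x. x \<in> Rd d \<Longrightarrow> norm (riesz_trunc d k P 1 ?ft x) \<le> C * A (riesz d k P ?ft) x"
        using A sch by (auto simp: pointwise_riesz_bound_def)
      show "continuous_on UNIV ?ft"
      proof (rule continuous_on_compose2[OF packet_continuous[OF W]])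
        show "continuous_on UNIV (dilate d t)"
        proof (rule continuous_on_coordinatewise_then_product)
          fix i
          show "continuous_on UNIV (\<lambda>x. dilate d t x i)"
            by (cases "i < d") (auto simp: affine_map_def intro!: continuous_intros continuous_on_product_coordinates)
        qed
      qed simp
      show "?ft \<in> borel_measurable (lb d)" by measurable
      show "norm (?ft x) \<le> (\<integral>w. norm (W w) \<partial>lb d) * exp (- (\<delta>\<^sup>2 * t\<^sup>2) * (Rd_norm d x)\<^sup>2)" for x
        using packet_decay[OF W, of "\<delta>\<^sup>2" "dilate d t x"] by (simp add: Rd_norm_affine_map power_mult_distrib mult_ac)
      show "0 < \<delta>\<^sup>2 * t\<^sup>2" using \<delta> t by simp
      show "riesz d k P ?ft \<in> borel_measurable (leb d)" "\<And>x. x \<in> Rd d \<Longrightarrow> norm (riesz d k P ?ft x) \<le> S + smear_error d k P W \<delta>"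
        by (rule packet_riesz_bound[OF P d W supp \<delta> t S]; assumption)+
    qed (rule P)
    also have "riesz_trunc d k P 1 ?ft (Rd_zero d) = of_real (riesz_const k d) *
        (\<integral>y. indicator {y. Rd_norm d y > t} y *\<^sub>R (P y / of_real (Rd_norm d y ^ (d + k)) * ?f (dilate d (- 1) y)) \<partial>lb d)"
      by (rule riesz_trunc_dilate[OF P(1) packet_measurable[OF W] t])
    also have "\<dots> = (\<integral>y. indicator {y. Rd_norm d y > t} y *\<^sub>R (P y / of_real (Rd_norm d y ^ (d + k)) * ?g y) \<partial>lb d)"
      unfolding integral_mult_right_zero[symmetric]
      by (intro Bochner_Integration.integral_cong refl) (simp only: scaleR_conv_of_real mult_ac)
    finally show ?thesis .
  qed
  have "norm (\<integral>y. P y * exp (- \<zeta> * of_real ((Rd_norm d y)\<^sup>2)) * ?g y \<partial>lb d) \<le> M * (1 + norm \<zeta> / Re \<zeta>) * Gamma M / Re \<zeta> powr M * ?H"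
  proof (rule gauss_average_bound[OF P(1,3) \<zeta> M_def])
    show "?g \<in> borel_measurable (lb d)" by measurable
    show "integrable (lb d) (\<lambda>y. P y * ?g y)"
    proof (rule integrable_hom_poly_decay[OF P(1)])
      show "norm (?g y) \<le> riesz_const k d * (\<integral>w. norm (W w) \<partial>lb d) * exp (- (\<delta>\<^sup>2) * (Rd_norm d y)\<^sup>2)" for y
        using mult_left_mono[OF packet_decay[OF W, of "\<delta>\<^sup>2" "dilate d (- 1) y"] \<gamma>] \<gamma>
        by (simp add: norm_mult Rd_norm_affine_map mult.assoc)
    qed (use \<delta> in \<open>measurable, simp\<close>)
    show "norm (\<integral>y. indicator {y. Rd_norm d y > sqrt v} y *\<^sub>R (P y / of_real (Rd_norm d y ^ (d + k)) * ?g y) \<partial>lb d) \<le> ?H" if "v > 0" for v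
      using that by (intro trunc) simp
  qed
  also have "(\<integral>y. P y * exp (- \<zeta> * of_real ((Rd_norm d y)\<^sup>2)) * ?g y \<partial>lb d)
    = of_real (riesz_const k d) * (\<integral>y. P y * exp (- \<zeta> * of_real ((Rd_norm d y)\<^sup>2)) * ?f (dilate d (- 1) y) \<partial>lb d)"
    unfolding integral_mult_right_zero[symmetric]
    by (intro Bochner_Integration.integral_cong refl) (simp only: mult_ac)
  also have "norm \<dots> = riesz_const k d * norm (\<integral>y. P y * exp (- \<zeta> * of_real ((Rd_norm d y)\<^sup>2)) * ?f (dilate d (- 1) y) \<partial>lb d)"
    using \<gamma> by (simp add: norm_mult)
  finally show ?thesis .
qed

text \<open>The limit \<delta> to 0 removes the Gaussian factor and the smearing error; Hecke's
  formula then moves the averaged kernel to the frequency side. The two support conditions on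
  \<open>W\<close> serve different ends: the upper one makes the packets Schwartz, the lower one
  makes the error vanish.\<close>

lemma multiplier_gauss_bound:
  assumes P: "hom_poly d k P" "harmonic d P" "k \<ge> 1" and d: "d > 0"
    and A: "pointwise_riesz_bound d k P A C"
    and W: "integrable (lb d) W" and supp: "\<And>w. W w \<noteq> 0 \<Longrightarrow> Rd_norm d w \<le> R" "\<And>w. W w \<noteq> 0 \<Longrightarrow> Rd_norm d w > 0"
    and S: "\<And>x. norm (\<integral>w. W w * riesz_mult d k P w * plane_wave d w x \<partial>lb d) \<le> S"
    and \<zeta>: "Re \<zeta> > 0" and M_def: "M = real (d + k) / 2"
  shows "riesz_const k d * (norm (gauss_const \<zeta> ^ d * (- \<i> / (2 * \<zeta>)) ^ k) *
      norm (\<integral>w. W w * P w * exp (- of_real ((Rd_norm d w)\<^sup>2) / (4 * \<zeta>)) \<partial>lb d))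
    \<le> M * (1 + norm \<zeta> / Re \<zeta>) * Gamma M / Re \<zeta> powr M * (max C 0 * S)"
proof -
  interpret lb: sigma_finite_measure "lb d" by (rule sigma_finite_lb)
  interpret pair_sigma_finite "lb d" "lb d" ..
  note [measurable] = hom_poly_measurable[OF P(1)] packet_measurable[OF W] borel_measurable_integrable[OF W]
  let ?E = "\<lambda>y. P y * exp (- \<zeta> * of_real ((Rd_norm d y)\<^sup>2))"
  let ?\<delta> = "\<lambda>n. 1 / real (Suc n)"
  let ?f0 = "\<lambda>y. \<integral>w. W w * plane_wave d w y \<partial>lb d"
  have \<delta>: "?\<delta> \<longlonglongrightarrow> 0" by (rule LIMSEQ_Suc[OF lim_1_over_n])
  have E_int: "integrable (lb d) ?E"
    using integrable_hom_poly_decay[OF P(1), of "\<lambda>y. exp (- \<zeta> * of_real ((Rd_norm d y)\<^sup>2))" 1 "Re \<zeta>"] \<zeta> by simp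
  have f0_le: "norm (?f0 y) \<le> (\<integral>w. norm (W w) \<partial>lb d)" for y
    by (rule norm_plane_wave_integral_le[OF W measurable_ident_sets[OF refl]])
  have [measurable]: "?f0 \<in> borel_measurable (lb d)"
    by (rule measurable_plane_wave_integral[OF measurable_ident_sets[OF refl] sigma_finite_lb borel_measurable_integrable[OF W]])
  have lhs: "(\<lambda>n. \<integral>y. ?E y * packet d ((?\<delta> n)\<^sup>2) W (dilate d (- 1) y) \<partial>lb d) \<longlonglongrightarrow> (\<integral>y. ?E y * ?f0 (dilate d (- 1) y) \<partial>lb d)"
  proof (rule integral_dominated_convergence[where w = "\<lambda>y. norm (?E y) * (\<integral>w. norm (W w) \<partial>lb d)"])
    show "integrable (lb d) (\<lambda>y. norm (?E y) * (\<integral>w. norm (W w) \<partial>lb d))"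
      using E_int by (intro integrable_mult_left integrable_norm)
    show "AE y in lb d. (\<lambda>n. ?E y * packet d ((?\<delta> n)\<^sup>2) W (dilate d (- 1) y)) \<longlonglongrightarrow> ?E y * ?f0 (dilate d (- 1) y)"
    proof (intro always_eventually allI)
      fix y
      let ?r = "(Rd_norm d (dilate d (- 1) y))\<^sup>2"
      have "(\<lambda>n. ?E y * (of_real (exp (- ((?\<delta> n)\<^sup>2) * ?r)) * ?f0 (dilate d (- 1) y))) \<longlonglongrightarrow> ?E y * (of_real (exp (- (0\<^sup>2) * ?r)) * ?f0 (dilate d (- 1) y))"
        by (intro tendsto_intros \<delta>)
      then show "(\<lambda>n. ?E y * packet d ((?\<delta> n)\<^sup>2) W (dilate d (- 1) y)) \<longlonglongrightarrow> ?E y * ?f0 (dilate d (- 1) y)"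
        unfolding packet_def by simp
    qed
    fix n
    show "AE y in lb d. norm (?E y * packet d ((?\<delta> n)\<^sup>2) W (dilate d (- 1) y)) \<le> norm (?E y) * (\<integral>w. norm (W w) \<partial>lb d)"
    proof (intro always_eventually allI)
      fix y
      have "norm (packet d ((?\<delta> n)\<^sup>2) W (dilate d (- 1) y)) \<le> 1 * (\<integral>w. norm (W w) \<partial>lb d)"
        unfolding packet_def norm_mult by (intro mult_mono f0_le) auto
      then show "norm (?E y * packet d ((?\<delta> n)\<^sup>2) W (dilate d (- 1) y)) \<le> norm (?E y) * (\<integral>w. norm (W w) \<partial>lb d)"
        unfolding norm_mult[of "?E y"] by (intro mult_left_mono) auto
    qed
  qed measurable
  have rhs: "(\<lambda>n. M * (1 + norm \<zeta> / Re \<zeta>) * Gamma M / Re \<zeta> powr M * (max C 0 * (S + smear_error d k P W (?\<delta> n))))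
      \<longlonglongrightarrow> M * (1 + norm \<zeta> / Re \<zeta>) * Gamma M / Re \<zeta> powr M * (max C 0 * (S + 0))"
    by (intro tendsto_mult tendsto_add tendsto_const smear_error_tendsto[OF P(1) W supp(2) \<delta>])
  have lhs': "(\<lambda>n. riesz_const k d * norm (\<integral>y. ?E y * packet d ((?\<delta> n)\<^sup>2) W (dilate d (- 1) y) \<partial>lb d))
      \<longlonglongrightarrow> riesz_const k d * norm (\<integral>y. ?E y * ?f0 (dilate d (- 1) y) \<partial>lb d)"
    by (intro tendsto_intros lhs)
  have main: "riesz_const k d * norm (\<integral>y. ?E y * ?f0 (dilate d (- 1) y) \<partial>lb d)
      \<le> M * (1 + norm \<zeta> / Re \<zeta>) * Gamma M / Re \<zeta> powr M * (max C 0 * (S + 0))"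
  proof (rule LIMSEQ_le[OF lhs' rhs], intro exI allI impI)
    fix n
    show "riesz_const k d * norm (\<integral>y. ?E y * packet d ((?\<delta> n)\<^sup>2) W (dilate d (- 1) y) \<partial>lb d)
      \<le> M * (1 + norm \<zeta> / Re \<zeta>) * Gamma M / Re \<zeta> powr M * (max C 0 * (S + smear_error d k P W (?\<delta> n)))"
      by (rule packet_gauss_bound[OF P d A W supp(1) _ S \<zeta> M_def]) auto
  qed
  \<comment> \<open>Fubini brings each wave next to \<open>P\<close>, so that the inner integral is
    the one in Hecke's formula at the frequency \<open>w\<close>.\<close>
  let ?h = "\<lambda>y w. ?E y * (W w * plane_wave d w (dilate d (- 1) y))"
  have pw: "(\<lambda>p. plane_wave d (snd p) (dilate d (- 1) (fst p))) \<in> borel_measurable (lb d \<Otimes>\<^sub>M lb d)"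
    by (rule measurable_compose[OF _ measurable_plane_wave_pair, of "\<lambda>p. (snd p, dilate d (- 1) (fst p))", simplified]) measurable
  have I: "integrable (lb d \<Otimes>\<^sub>M lb d) (\<lambda>(y, w). ?h y w)"
  proof (rule Bochner_Integration.integrable_bound[OF integrable_pair_mult[OF sigma_finite_lb sigma_finite_lb E_int W]])
    show "(\<lambda>(y, w). ?h y w) \<in> borel_measurable (lb d \<Otimes>\<^sub>M lb d)"
      unfolding split_beta' using pw by measurable
  qed (auto simp: norm_mult)
  have "(\<integral>y. ?E y * ?f0 (dilate d (- 1) y) \<partial>lb d) = (\<integral>y. (\<integral>w. ?h y w \<partial>lb d) \<partial>lb d)"
    by (simp only: integral_mult_right_zero)
  also have "\<dots> = (\<integral>w. (\<integral>y. ?h y w \<partial>lb d) \<partial>lb d)"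
    using Fubini_integral[OF I] by simp
  also have "\<dots> = (\<integral>w. (gauss_const \<zeta> ^ d * (- \<i> / (2 * \<zeta>)) ^ k) * (W w * P w * exp (- of_real ((Rd_norm d w)\<^sup>2) / (4 * \<zeta>))) \<partial>lb d)"
  proof (rule Bochner_Integration.integral_cong[OF refl])
    fix w assume "w \<in> space (lb d)"
    then have w: "w \<in> Rd d" by (simp add: space_lb)
    have "?h y w = W w * (P y * gauss_wave d \<zeta> w y)" for y
    proof -
      have "Rd_dot d w (dilate d (- 1) y) = - Rd_dot d w y"
        by (simp add: Rd_dot_def affine_map_def sum_negf)
      then have "gauss_wave d \<zeta> w y = exp (- \<zeta> * of_real ((Rd_norm d y)\<^sup>2)) * plane_wave d w (dilate d (- 1) y)"
        unfolding gauss_wave_def plane_wave_def exp_add[symmetric] by simp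
      then show ?thesis by (simp only: mult_ac)
    qed
    then have "(\<integral>y. ?h y w \<partial>lb d) = W w * (\<integral>y. P y * gauss_wave d \<zeta> w y \<partial>lb d)"
      by (simp only: integral_mult_right_zero)
    then show "(\<integral>y. ?h y w \<partial>lb d) = (gauss_const \<zeta> ^ d * (- \<i> / (2 * \<zeta>)) ^ k) * (W w * P w * exp (- of_real ((Rd_norm d w)\<^sup>2) / (4 * \<zeta>)))"
      unfolding Hecke[OF P(1,2) \<zeta> w] by (simp only: mult_ac)
  qed
  also have "\<dots> = (gauss_const \<zeta> ^ d * (- \<i> / (2 * \<zeta>)) ^ k) * (\<integral>w. W w * P w * exp (- of_real ((Rd_norm d w)\<^sup>2) / (4 * \<zeta>)) \<partial>lb d)"
    by (rule integral_mult_right_zero)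
  finally have "(\<integral>y. ?E y * ?f0 (dilate d (- 1) y) \<partial>lb d) = \<dots>" .
  with main show ?thesis by (simp only: norm_mult[of "gauss_const \<zeta> ^ d * (- \<i> / (2 * \<zeta>)) ^ k"] add_0_right)
qed

section \<open>Dividing by the multiplier\<close>

text \<open>\<open>1 / (4 * z)\<close> is the parameter of the Fourier transform of the Gaussian
  with parameter \<open>z\<close>.\<close>

lemma Re_inverse_pos:
  fixes z :: complex
  assumes "Re z > 0"
  shows "Re (1 / (4 * z)) > 0"
proof -
  have "z \<noteq> 0" using assms by auto
  then have "1 / (4 * z) = of_real (1 / 4) * inverse z" by (simp add: field_simps)
  moreover have "Re (inverse z) > 0" using assms by (simp add: add_pos_nonneg)
  moreover have "Re (of_real (1 / 4) * v) > 0" if "Re v > 0" for v :: complex using that by simp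
  ultimately show ?thesis by (simp only:)
qed

text \<open>The test function has the Gaussian \<open>G\<close> divided by the Riesz multiplier as its Fourier transform,
  truncated to the set \<open>D n\<close> where this quotient is bounded; \<open>D n\<close> exhausts the space up to the null
  set of zeros of \<open>P\<close>.\<close>

lemma gauss_quotient_bound:
  assumes P: "hom_poly d k P" "harmonic d P" "k \<ge> 1" and d: "d > 0" and z: "z \<in> Rd d" "P z \<noteq> 0"
    and A: "pointwise_riesz_bound d k P A C"
    and s: "Re s > 0" and \<zeta>: "Re \<zeta> > 0" and M_def: "M = real (d + k) / 2"
  shows "riesz_const k d * (norm (gauss_const \<zeta>) ^ d / norm (2 * \<zeta>) ^ k) *
      (pi powr (d / 2) * Gamma M / Gamma (d / 2) * norm (s + 1 / (4 * \<zeta>)) powr (- M) / norm (gauss_const s) ^ d)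
    \<le> M * (1 + norm \<zeta> / Re \<zeta>) * Gamma M / Re \<zeta> powr M * max C 0"
proof -
  note [measurable] = hom_poly_measurable[OF P(1)] riesz_mult_measurable[OF P(1)]
  let ?\<sigma> = "riesz_mult d k P"
  \<comment> \<open>Dividing by \<open>gauss_const s ^ d\<close> makes
    \<open>exp (- \<bar>x\<bar>\<^sup>2 / (4 * s))\<close> the inverse transform of
    \<open>G\<close>, a function bounded by 1.\<close>
  define G where "G w = exp (- s * of_real ((Rd_norm d w)\<^sup>2)) / gauss_const s ^ d" for w
  \<comment> \<open>The lower bound on \<open>P\<close> and the upper bound on the frequency
    together bound the reciprocal of the multiplier; the latter also gives the bounded support that
    makes packets Schwartz.\<close>
  define D where "D n = {w. 1 / real (Suc n) \<le> norm (P w) \<and> Rd_norm d w \<le> real (Suc n)}" for n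
  define W where "W n w = (if w \<in> D n then G w / ?\<sigma> w else 0)" for n w
  have s0: "s \<noteq> 0" using s by auto
  have "norm (gauss_const s) > 0" unfolding norm_gauss_const[OF s] using s0 by simp
  then have gc: "gauss_const s \<noteq> 0" by auto
  have [measurable]: "G \<in> borel_measurable (lb d)" unfolding G_def[abs_def] by measurable
  have [measurable]: "Measurable.pred (lb d) (\<lambda>w. w \<in> D n)" for n
    unfolding D_def mem_Collect_eq by measurable
  have [measurable]: "W n \<in> borel_measurable (lb d)" for n unfolding W_def[abs_def] by measurable
  have G_norm: "norm (G w) = exp (- Re s * (Rd_norm d w)\<^sup>2) / norm (gauss_const s) ^ d" for w
    by (simp add: G_def norm_divide norm_power)
  have G_int: "integrable (lb d) G"
  proof (rule Bochner_Integration.integrable_bound)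
    show "integrable (lb d) (\<lambda>w. exp (- Re s * (Rd_norm d w)\<^sup>2) / norm (gauss_const s) ^ d)"
      using has_bochner_integral_gauss_lb[OF s] by (intro integrable_divide) (simp add: has_bochner_integral_iff)
  qed (measurable, simp add: G_norm)
  have \<sigma>: "Rd_norm d w > 0" "?\<sigma> w \<noteq> 0" if "P w \<noteq> 0" for w
  proof -
    show "Rd_norm d w > 0"
      using Rd_norm_zero_hom_poly[OF P(1,3), of w] Rd_norm_nonneg[of d w] that by (metis less_eq_real_def)
    then show "?\<sigma> w \<noteq> 0" using that by (simp add: riesz_mult_def)
  qed
  have PD: "P w \<noteq> 0" if "w \<in> D n" for n w
  proof
    assume "P w = 0"
    moreover have "0 < 1 / real (Suc n)" by simp
    ultimately show False using that by (simp add: D_def)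
  qed
  have W\<sigma>: "W n w * ?\<sigma> w = (if w \<in> D n then G w else 0)" for n w
    using \<sigma>(2)[OF PD] by (simp add: W_def)
  \<comment> \<open>The \<open>P\<close> from Hecke's formula cancels the one in the multiplier.
    What remains is radial and, apart from the set \<open>D n\<close>, does not depend on the choice
    of \<open>P\<close>.\<close>
  have WP: "W n w * P w = (if w \<in> D n then \<i> ^ k * of_real (Rd_norm d w ^ k) * G w else 0)" for n w
  proof (cases "w \<in> D n")
    case True
    have "P w \<noteq> 0" "Rd_norm d w \<noteq> 0" using PD[OF True] \<sigma>(1) by force+
    moreover have "\<i> ^ k * (- \<i>) ^ k = (1 :: complex)" by (simp add: power_mult_distrib[symmetric])
    ultimately show ?thesis using True by (simp add: W_def riesz_mult_def field_simps)
  qed (simp add: W_def)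
  have supp: "Rd_norm d w \<le> real (Suc n)" "Rd_norm d w > 0" if "W n w \<noteq> 0" for n w
  proof -
    have "w \<in> D n" using that by (auto simp: W_def split: if_splits)
    then show "Rd_norm d w \<le> real (Suc n)" "Rd_norm d w > 0" using \<sigma>(1)[OF PD] by (auto simp: D_def)
  qed
  have W_int: "integrable (lb d) (W n)" for n
  proof (rule Bochner_Integration.integrable_bound)
    show "integrable (lb d) (\<lambda>w. of_real (real (Suc n) ^ k * real (Suc n)) * G w)" using G_int by (rule integrable_mult_right)
    show "AE w in lb d. norm (W n w) \<le> norm (of_real (real (Suc n) ^ k * real (Suc n)) * G w)"
    proof (intro always_eventually allI)
      fix w
      show "norm (W n w) \<le> norm (of_real (real (Suc n) ^ k * real (Suc n)) * G w)"
      proof (cases "w \<in> D n")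
        case True
        have p: "norm (P w) > 0" using PD[OF True] by simp
        have "Rd_norm d w ^ k / norm (P w) \<le> real (Suc n) ^ k * real (Suc n)"
        proof -
          have "1 / norm (P w) \<le> real (Suc n)"
            using True p by (simp add: D_def field_simps)
          moreover have "Rd_norm d w ^ k \<le> real (Suc n) ^ k" using True by (intro power_mono) (auto simp: D_def)
          ultimately have "Rd_norm d w ^ k * (1 / norm (P w)) \<le> real (Suc n) ^ k * real (Suc n)"
            by (intro mult_mono) auto
          then show ?thesis by simp
        qed
        from mult_left_mono[OF this, of "norm (G w)"]
        have "norm (G w) * (Rd_norm d w ^ k / norm (P w)) \<le> norm (G w) * (real (Suc n) ^ k * real (Suc n))" by simp
        moreover have "norm (W n w) = norm (G w) * (Rd_norm d w ^ k / norm (P w))"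
          using True by (simp add: W_def riesz_mult_def norm_mult norm_divide norm_power)
        moreover have "norm (of_real (real (Suc n) ^ k * real (Suc n)) * G w) = norm (G w) * (real (Suc n) ^ k * real (Suc n))"
          unfolding norm_mult norm_of_real by simp
        ultimately show ?thesis by simp
      qed (simp add: W_def)
    qed
  qed measurable
  have G_wave: "norm (\<integral>w. G w * plane_wave d w x \<partial>lb d) \<le> 1" for x
  proof -
    let ?u = "dilate d (- 1) x"
    have "G w * plane_wave d w x = 1 / gauss_const s ^ d * gauss_wave d s ?u w" for w
    proof -
      have "Rd_dot d ?u w = - Rd_dot d w x" by (simp add: Rd_dot_def affine_map_def sum_negf mult.commute)
      then have "gauss_wave d s ?u w = exp (- s * of_real ((Rd_norm d w)\<^sup>2)) * plane_wave d w x"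
        unfolding gauss_wave_def plane_wave_def exp_add[symmetric] by simp
      then show ?thesis by (simp add: G_def)
    qed
    then have "(\<integral>w. G w * plane_wave d w x \<partial>lb d) = 1 / gauss_const s ^ d * (gauss_const s ^ d * exp (- of_real ((Rd_norm d ?u)\<^sup>2) / (4 * s)))"
      using has_bochner_integral_integral_eq[OF gauss_wave_integral[OF s affine_map_in_Rd]] by (simp only: integral_mult_right_zero)
    also have "\<dots> = exp (- of_real ((Rd_norm d ?u)\<^sup>2) / (4 * s))" using gc by simp
    also have "norm \<dots> \<le> 1"
    proof -
      have "- x / (4 * s) = - (x / 4) * inverse s" for x using s0 by (simp add: field_simps)
      then have "- of_real ((Rd_norm d ?u)\<^sup>2) / (4 * s) = of_real (- ((Rd_norm d ?u)\<^sup>2 / 4)) * inverse s" by simp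
      moreover have "Re (inverse s) \<ge> 0" using s by simp
      moreover have "Re (of_real (- (r\<^sup>2 / 4)) * v) \<le> 0" if "Re v \<ge> 0" for r and v :: complex
        using that by simp
      ultimately have "Re (- of_real ((Rd_norm d ?u)\<^sup>2) / (4 * s)) \<le> 0" by (simp only:)
      then show ?thesis unfolding norm_exp_eq_Re by simp
    qed
    finally show ?thesis .
  qed
  \<comment> \<open>Truncation changes the inverse transform of \<open>G\<close> by at most the
    integral of the part cut off, which tends to 0 because the zeros of \<open>P\<close> form a null
    set.\<close>
  define S where "S n = 1 + (\<integral>w. norm (if w \<in> D n then 0 else G w) \<partial>lb d)" for n
  have S: "norm (\<integral>w. W n w * ?\<sigma> w * plane_wave d w x \<partial>lb d) \<le> S n" for n x
  proof -
    have i: "integrable (lb d) (\<lambda>w. if w \<in> D n then 0 else G w)"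
      by (rule Bochner_Integration.integrable_bound[OF G_int]) auto
    note id = measurable_ident_sets[OF refl]
    have "(\<integral>w. W n w * ?\<sigma> w * plane_wave d w x \<partial>lb d)
      = (\<integral>w. G w * plane_wave d w x - (if w \<in> D n then 0 else G w) * plane_wave d w x \<partial>lb d)"
      unfolding W\<sigma> by (intro Bochner_Integration.integral_cong) auto
    also have "\<dots> = (\<integral>w. G w * plane_wave d w x \<partial>lb d) - (\<integral>w. (if w \<in> D n then 0 else G w) * plane_wave d w x \<partial>lb d)"
      by (rule Bochner_Integration.integral_diff[OF integrable_plane_wave[OF G_int id] integrable_plane_wave[OF i id]])
    also have "norm \<dots> \<le> S n"
      unfolding S_def using G_wave[of x] norm_plane_wave_integral_le[OF i id, of x]
      by (intro norm_triangle_le_diff) simp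
    finally show ?thesis .
  qed
  have in_D: "\<forall>\<^sub>F n in sequentially. w \<in> D n" if "P w \<noteq> 0" for w
  proof -
    have "(\<lambda>n. 1 / real (Suc n)) \<longlonglongrightarrow> 0" by (rule LIMSEQ_Suc[OF lim_1_over_n])
    then have "\<forall>\<^sub>F n in sequentially. 1 / real (Suc n) < norm (P w)" using that by (intro order_tendstoD(2)) auto
    moreover have "\<forall>\<^sub>F n in sequentially. Rd_norm d w \<le> real (Suc n)"
    proof -
      obtain N where "Rd_norm d w \<le> real N" using real_arch_simple by blast
      then show ?thesis by (intro eventually_sequentiallyI[of N]) simp
    qed
    ultimately show ?thesis by eventually_elim (simp add: D_def)
  qed
  have AE_P: "AE w in lb d. P w \<noteq> 0" by (rule hom_poly_AE_nonzero[OF P(1) z])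
  have S_lim: "S \<longlonglongrightarrow> 1"
  proof -
    have "(\<lambda>n. \<integral>w. norm (if w \<in> D n then 0 else G w) \<partial>lb d) \<longlonglongrightarrow> (\<integral>w. 0 \<partial>lb d)"
    proof (rule integral_dominated_convergence[where w = "\<lambda>w. norm (G w)"])
      show "integrable (lb d) (\<lambda>w. norm (G w))" using G_int by simp
      show "AE w in lb d. (\<lambda>n. norm (if w \<in> D n then 0 else G w)) \<longlonglongrightarrow> 0"
        using AE_P
      proof eventually_elim
        case (elim w)
        show ?case by (rule tendsto_eventually, rule eventually_mono[OF in_D[OF elim]]) simp
      qed
      show "AE w in lb d. norm (norm (if w \<in> D n then 0 else G w)) \<le> norm (G w)" for n
        by (intro always_eventually allI) simp
    qed measurable
    from tendsto_add[OF tendsto_const[of 1] this] show ?thesis unfolding S_def[abs_def] by simp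
  qed
  let ?e = "\<lambda>w. exp (- of_real ((Rd_norm d w)\<^sup>2) / (4 * \<zeta>))"
  let ?T = "\<lambda>w. \<i> ^ k * of_real (Rd_norm d w ^ k) * G w * ?e w"
  \<comment> \<open>The test function and the averaged kernel each contribute a Gaussian on the
    frequency side; in the sum of their parameters the phases can cancel.\<close>
  let ?\<tau> = "s + 1 / (4 * \<zeta>)"
  have \<zeta>': "Re (1 / (4 * \<zeta>)) > 0" by (rule Re_inverse_pos[OF \<zeta>])
  have \<tau>: "Re ?\<tau> > 0" using s \<zeta>' by simp
  have T_eq: "?T w = \<i> ^ k / gauss_const s ^ d * (of_real (Rd_norm d w ^ k) * exp (- ?\<tau> * of_real ((Rd_norm d w)\<^sup>2)))" for w
  proof -
    have "exp (- s * of_real ((Rd_norm d w)\<^sup>2)) * ?e w = exp (- ?\<tau> * of_real ((Rd_norm d w)\<^sup>2))"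
      unfolding exp_add[symmetric] by (simp add: algebra_simps)
    then show ?thesis by (simp add: G_def)
  qed
  have T_norm: "norm (?T w) = 1 / norm (gauss_const s) ^ d * (Rd_norm d w ^ k * exp (- Re ?\<tau> * (Rd_norm d w)\<^sup>2))" for w
    unfolding T_eq by (simp add: norm_mult norm_divide norm_power)
  have T_lim: "(\<lambda>n. \<integral>w. W n w * P w * ?e w \<partial>lb d) \<longlonglongrightarrow> (\<integral>w. ?T w \<partial>lb d)"
  proof (rule integral_dominated_convergence[where w = "\<lambda>w. norm (?T w)"])
    show "integrable (lb d) (\<lambda>w. norm (?T w))"
      unfolding T_norm by (intro integrable_mult_right integrable_norm_power_gauss \<tau>)
    show "AE w in lb d. (\<lambda>n. W n w * P w * ?e w) \<longlonglongrightarrow> ?T w"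
      using AE_P
    proof eventually_elim
      case (elim w)
      show ?case by (rule tendsto_eventually, rule eventually_mono[OF in_D[OF elim]]) (simp add: WP)
    qed
    show "AE w in lb d. norm (W n w * P w * ?e w) \<le> norm (?T w)" for n
      by (intro always_eventually allI) (simp add: WP)
  qed measurable
  let ?\<kappa> = "norm (gauss_const \<zeta> ^ d * (- \<i> / (2 * \<zeta>)) ^ k)"
  let ?V = "M * (1 + norm \<zeta> / Re \<zeta>) * Gamma M / Re \<zeta> powr M"
  have l: "(\<lambda>n. riesz_const k d * (?\<kappa> * norm (\<integral>w. W n w * P w * ?e w \<partial>lb d))) \<longlonglongrightarrow> riesz_const k d * (?\<kappa> * norm (\<integral>w. ?T w \<partial>lb d))"
    by (intro tendsto_intros T_lim)
  have r: "(\<lambda>n. ?V * (max C 0 * S n)) \<longlonglongrightarrow> ?V * (max C 0 * 1)"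
    by (intro tendsto_mult tendsto_const S_lim)
  have "riesz_const k d * (?\<kappa> * norm (\<integral>w. ?T w \<partial>lb d)) \<le> ?V * (max C 0 * 1)"
  proof (rule LIMSEQ_le[OF l r], intro exI allI impI)
    fix n
    show "riesz_const k d * (?\<kappa> * norm (\<integral>w. W n w * P w * ?e w \<partial>lb d)) \<le> ?V * (max C 0 * S n)"
      by (rule multiplier_gauss_bound[OF P d A W_int supp(1) supp(2) S \<zeta> M_def])
  qed
  moreover have "norm (\<integral>w. ?T w \<partial>lb d) = pi powr (d / 2) * Gamma M / Gamma (d / 2) * norm ?\<tau> powr (- M) / norm (gauss_const s) ^ d"
    unfolding T_eq integral_mult_right_zero norm_mult[of "\<i> ^ k / gauss_const s ^ d"]
      norm_integral_norm_power_gauss_complex[OF d \<tau>] M_def[symmetric]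
    by (simp add: norm_divide norm_power)
  moreover have "?\<kappa> = norm (gauss_const \<zeta>) ^ d / norm (2 * \<zeta>) ^ k"
    by (simp add: norm_mult norm_power norm_divide power_divide)
  ultimately show ?thesis by (simp only: mult.assoc mult_1_right)
qed

section \<open>Growth of the constant\<close>

text \<open>Log-convexity at the midpoint \<open>m\<close> of \<open>m - 1 / 2\<close> and
  \<open>m + 1 / 2\<close> gives \<open>(Gamma m)\<^sup>2 \<le> Gamma (m - 1 / 2) * Gamma (m + 1 /
  2)\<close>, and the functional equation expresses \<open>Gamma (m - 1 / 2)\<close> by
  \<open>Gamma (m + 1 / 2)\<close>.\<close>

lemma Gamma_half_step:
  fixes m :: real
  assumes m: "m > 1 / 2"
  shows "(m - 1 / 2) powr (1 / 2) * Gamma m \<le> Gamma (m + 1 / 2)"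
proof -
  have pos: "Gamma (m - 1 / 2) > 0" "Gamma m > 0" "Gamma (m + 1 / 2) > 0" using m by (auto intro: Gamma_real_pos)
  have "(ln \<circ> Gamma) ((1 - 1 / 2) *\<^sub>R (m - 1 / 2) + (1 / 2) *\<^sub>R (m + 1 / 2))
      \<le> (1 - 1 / 2) * (ln \<circ> Gamma) (m - 1 / 2) + (1 / 2) * (ln \<circ> Gamma) (m + 1 / 2)"
    by (rule convex_onD[OF log_convex_Gamma_real]) (use m in auto)
  moreover have "(1 - 1 / 2) *\<^sub>R (m - 1 / 2) + (1 / 2) *\<^sub>R (m + 1 / 2) = m" by (simp add: field_simps)
  ultimately have conv: "ln (Gamma m) \<le> 1 / 2 * ln (Gamma (m - 1 / 2)) + 1 / 2 * ln (Gamma (m + 1 / 2))" by simp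
  have "Gamma (m - 1 / 2 + 1) = (m - 1 / 2) * Gamma (m - 1 / 2)"
    using m nonpos_Ints_nonpos[of "m - 1 / 2"] by (intro Gamma_plus1) (auto simp: not_le)
  then have "Gamma (m + 1 / 2) = (m - 1 / 2) * Gamma (m - 1 / 2)" by (simp add: algebra_simps)
  then have "ln (Gamma (m + 1 / 2)) = ln (m - 1 / 2) + ln (Gamma (m - 1 / 2))"
    using m less_imp_neq[OF pos(1), symmetric] by (simp add: ln_mult)
  with conv have "1 / 2 * ln (m - 1 / 2) + ln (Gamma m) \<le> ln (Gamma (m + 1 / 2))" by linarith
  then have "exp (1 / 2 * ln (m - 1 / 2) + ln (Gamma m)) \<le> exp (ln (Gamma (m + 1 / 2)))" by simp
  then show ?thesis using m pos by (simp add: exp_add powr_def)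
qed

text \<open>Half steps reach \<open>m + k / 2\<close> for every parity of \<open>k\<close>. The
  bases grow along the way and are all replaced by the smallest one,
  \<open>m - 1 / 2\<close>.\<close>

lemma Gamma_half_steps:
  fixes m :: real
  assumes m: "m > 1 / 2"
  shows "(m - 1 / 2) powr (real j / 2) * Gamma m \<le> Gamma (m + real j / 2)"
proof (induction j)
  case 0
  then show ?case using m by simp
next
  case (Suc j)
  have "(m - 1 / 2) powr (real (Suc j) / 2) * Gamma m = (m - 1 / 2) powr (1 / 2) * ((m - 1 / 2) powr (real j / 2) * Gamma m)"
    by (simp add: powr_add[symmetric] add_divide_distrib mult.assoc[symmetric] add.commute)
  also have "\<dots> \<le> (m - 1 / 2) powr (1 / 2) * Gamma (m + real j / 2)"
    by (intro mult_left_mono Suc) simp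
  also have "\<dots> \<le> (m + real j / 2 - 1 / 2) powr (1 / 2) * Gamma (m + real j / 2)"
    using m by (intro mult_right_mono powr_mono2 Gamma_real_nonneg) auto
  also have "\<dots> \<le> Gamma (m + real j / 2 + 1 / 2)"
    by (rule Gamma_half_step) (use m in \<open>simp add: add_strict_increasing\<close>)
  finally show ?case by (simp add: add_divide_distrib algebra_simps)
qed

text \<open>For \<open>x\<close> and \<open>y\<close> the norms of the parameters of test function
  and average, and \<open>u\<close> that of their sum: all powers of 2 and of \<open>pi\<close>
  cancel, and the exponent \<open>m\<close> survives only on \<open>u\<close>.\<close>

lemma powr_identity:
  fixes x y u m a :: real
  assumes "x > 0" "y > 0" "u > 0"
  shows "(pi / y) powr m * (2 * y) powr (- (2 * a)) * (2 * 2 * pi * x) powr (- m) * (2 * 2 * x * y / u) powr (m + a)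
    = (x / y) powr a * u powr (- (m + a))"
proof -
  have "ln (4 :: real) = 2 * ln 2" using ln_realpow[of "2 :: real" 2] by simp
  then show ?thesis using assms by (simp add: powr_def ln_mult ln_div exp_add[symmetric] algebra_simps)
qed

section \<open>Choice of the complex parameters\<close>

lemma riesz_constant_lower_bound:
  assumes P: "hom_poly d k P" "harmonic d P" "k \<ge> 1" and d: "d \<ge> 2" and z: "z \<in> Rd d" "P z \<noteq> 0"
    and A: "pointwise_riesz_bound d k P A C"
  shows "(1 / sqrt 2) powr (k / 2) / (Gamma (k / 2) * exp 1 * (1 + sqrt 2)) * ((d / 2 - 1 / 2) powr (k / 2) / (real (d + k) / 2)) \<le> max C 0"
proof -
  define m where "m = real d / 2"
  define a where "a = real k / 2"
  define M where "M = real (d + k) / 2"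
  have Mma: "M = m + a" by (simp add: M_def m_def a_def add_divide_distrib)
  have m: "m \<ge> 1" and a: "a > 0" using d P(3) by (auto simp: m_def a_def)
  have M: "M > 0" using m a Mma by simp
  have pos: "Gamma m > 0" "Gamma a > 0" "Gamma M > 0" using m a M by (auto intro: Gamma_real_pos)
  define \<zeta> where "\<zeta> = Complex M (- M)"
  \<comment> \<open>The parameter of the chirped Gaussian that approximates the Riesz transform of
    the test function. The imaginary part makes \<open>norm y\<close> comparable to
    \<open>norm \<zeta>\<close>, and the real part is small against \<open>M\<close>.\<close>
  define y where "y = Complex 1 M"
  \<comment> \<open>The parameter on the frequency side, so that
    \<open>exp (- \<bar>x\<bar>\<^sup>2 / (4 * s))\<close> is the Gaussian with parameter
    \<open>y\<close>.\<close>
  define s where "s = 1 / (4 * y)"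
  have y0: "y \<noteq> 0" and \<zeta>0: "\<zeta> \<noteq> 0" using M by (auto simp: y_def \<zeta>_def complex_eq_iff)
  have Re\<zeta>: "Re \<zeta> = M" by (simp add: \<zeta>_def)
  have norm\<zeta>: "norm \<zeta> = sqrt 2 * M"
    using M by (simp add: \<zeta>_def cmod_def real_sqrt_mult power2_eq_square flip: mult_2)
  have normy: "M \<le> norm y" using abs_Im_le_cmod[of y] M by (simp add: y_def)
  have norms: "norm s = 1 / (4 * norm y)" by (simp add: s_def norm_divide norm_mult)
  have Res: "Re s > 0" unfolding s_def by (rule Re_inverse_pos) (simp add: y_def)
  have "s + 1 / (4 * \<zeta>) = (y + \<zeta>) / (4 * y * \<zeta>)"
    using y0 \<zeta>0 by (simp add: s_def field_simps)
  \<comment> \<open>The imaginary parts are opposite: although both summands have norm at least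
    \<open>M\<close>, the sum is only \<open>M + 1\<close>.\<close>
  moreover have "y + \<zeta> = of_real (M + 1)" by (simp add: y_def \<zeta>_def complex_eq_iff)
  ultimately have \<tau>: "norm (s + 1 / (4 * \<zeta>)) = (M + 1) / (4 * norm y * norm \<zeta>)"
    using M by (simp add: norm_divide norm_mult del: of_real_add)
  have y: "norm y > 0" and z': "norm \<zeta> > 0" using y0 \<zeta>0 by auto
  have d0: "d > 0" using d by simp
  have "riesz_const k d * (norm (gauss_const \<zeta>) ^ d / norm (2 * \<zeta>) ^ k) *
      (pi powr (d / 2) * Gamma M / Gamma (d / 2) * norm (s + 1 / (4 * \<zeta>)) powr (- M) / norm (gauss_const s) ^ d)
    \<le> M * (1 + norm \<zeta> / Re \<zeta>) * Gamma M / Re \<zeta> powr M * max C 0"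
    by (rule gauss_quotient_bound[OF P d0 z A Res _ M_def]) (simp add: Re\<zeta> M)
  also have "riesz_const k d = Gamma M / (pi powr m * Gamma a)"
    by (simp add: riesz_const_def M_def m_def a_def add.commute)
  also have "norm (gauss_const \<zeta>) ^ d = (pi / norm \<zeta>) powr m"
    using M z' by (subst norm_gauss_const) (simp_all add: Re\<zeta> powr_half_sqrt[symmetric] powr_power m_def)
  also have "norm (gauss_const s) ^ d = (2 * 2 * pi * norm y) powr m"
    using y by (subst norm_gauss_const[OF Res]) (simp add: norms powr_half_sqrt[symmetric] powr_power m_def mult_ac)
  also have "norm (2 * \<zeta>) ^ k = (2 * norm \<zeta>) powr (2 * a)"
    using z' by (simp add: norm_mult a_def powr_realpow)
  also have "norm (s + 1 / (4 * \<zeta>)) powr (- M) = (2 * 2 * norm y * norm \<zeta> / (M + 1)) powr (m + a)"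
    unfolding \<tau> Mma[symmetric] using y z' M by (simp add: powr_minus powr_divide)
  finally have "Gamma M / (pi powr m * Gamma a) * ((pi / norm \<zeta>) powr m / (2 * norm \<zeta>) powr (2 * a)) *
      (pi powr m * Gamma M / Gamma m * (2 * 2 * norm y * norm \<zeta> / (M + 1)) powr (m + a) / (2 * 2 * pi * norm y) powr m)
      \<le> M * (1 + norm \<zeta> / Re \<zeta>) * Gamma M / Re \<zeta> powr M * max C 0" by (simp add: m_def)
  also have "Gamma M / (pi powr m * Gamma a) * ((pi / norm \<zeta>) powr m / (2 * norm \<zeta>) powr (2 * a)) *
      (pi powr m * Gamma M / Gamma m * (2 * 2 * norm y * norm \<zeta> / (M + 1)) powr (m + a) / (2 * 2 * pi * norm y) powr m)
     = Gamma M * Gamma M / (Gamma m * Gamma a) * ((pi / norm \<zeta>) powr m * (2 * norm \<zeta>) powr (- (2 * a)) * (2 * 2 * pi * norm y) powr (- m) * (2 * 2 * norm y * norm \<zeta> / (M + 1)) powr (m + a))"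
    by (simp add: powr_minus divide_inverse mult_ac)
  also have "\<dots> = Gamma M * Gamma M / (Gamma m * Gamma a) * ((norm y / norm \<zeta>) powr a * (M + 1) powr (- M))"
    using M by (subst powr_identity) (auto simp: y0 \<zeta>0 Mma)
  also have "norm \<zeta> / Re \<zeta> = sqrt 2" using M by (simp add: norm\<zeta> Re\<zeta>)
  finally have main: "Gamma M * Gamma M / (Gamma m * Gamma a) * ((norm y / norm \<zeta>) powr a * (M + 1) powr (- M))
      \<le> M * (1 + sqrt 2) * Gamma M / M powr M * max C 0" unfolding Re\<zeta> .
  \<comment> \<open>Here the chirp pays off: \<open>norm y \<ge> M\<close> and
    \<open>norm \<zeta> = sqrt 2 * M\<close>, so the quotient is bounded below independently of the
    dimension.\<close>
  have q: "(1 / sqrt 2) powr a \<le> (norm y / norm \<zeta>) powr a"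
    using normy M a by (intro powr_mono2) (auto simp: norm\<zeta> field_simps)
  \<comment> \<open>This is \<open>(1 + 1 / M) powr M \<le> exp 1\<close>: the real part of
    \<open>y\<close> costs only a constant factor.\<close>
  have e: "M powr (- M) / exp 1 \<le> (M + 1) powr (- M)"
  proof -
    have "M * ln ((M + 1) / M) \<le> M * (1 / M)"
    proof (rule mult_left_mono)
      have "ln (1 + 1 / M) \<le> 1 / M" using M by (intro ln_add_one_self_le_self) simp
      then show "ln ((M + 1) / M) \<le> 1 / M" using M by (simp add: add_divide_distrib)
    qed (use M in simp)
    then have "- M * ln M - 1 \<le> - M * ln (M + 1)" using M by (simp add: ln_div algebra_simps)
    then have "exp (- M * ln M - 1) \<le> exp (- M * ln (M + 1))" by simp
    then show ?thesis using M by (simp add: powr_def exp_diff)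
  qed
  have "Gamma M * Gamma M / (Gamma m * Gamma a) * ((1 / sqrt 2) powr a * (M powr (- M) / exp 1))
      \<le> Gamma M * Gamma M / (Gamma m * Gamma a) * ((norm y / norm \<zeta>) powr a * (M + 1) powr (- M))"
    using pos q e by (intro mult_left_mono mult_mono) auto
  also note main
  finally have main2: "Gamma M * Gamma M / (Gamma m * Gamma a) * ((1 / sqrt 2) powr a * (M powr (- M) / exp 1))
      \<le> M * (1 + sqrt 2) * Gamma M / M powr M * max C 0" .
  \<comment> \<open>The bound on the mass of the averaging weight. Dividing by it removes one
    \<open>Gamma M\<close> and leaves the growing quotient \<open>Gamma M / Gamma m\<close>, divided
    by \<open>M\<close>.\<close>
  let ?K = "M * (1 + sqrt 2) * Gamma M / M powr M"
  have K: "?K > 0" using M pos by (simp add: add_pos_nonneg)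
  have G: "(m - 1 / 2) powr a \<le> Gamma M / Gamma m"
    using Gamma_half_steps[of m k] m pos by (simp add: Mma a_def pos_le_divide_eq)
  have "(1 / sqrt 2) powr a / (Gamma a * exp 1 * (1 + sqrt 2)) * ((m - 1 / 2) powr a / M)
    \<le> (1 / sqrt 2) powr a / (Gamma a * exp 1 * (1 + sqrt 2)) * ((Gamma M / Gamma m) / M)"
    using G M pos by (intro mult_left_mono divide_right_mono) (auto intro!: divide_nonneg_nonneg mult_nonneg_nonneg)
  also have "\<dots> = Gamma M * Gamma M / (Gamma m * Gamma a) * ((1 / sqrt 2) powr a * (M powr (- M) / exp 1)) / ?K"
  proof -
    have id: "q / (ga * e * t) * ((G / gm) / M) = G * G / (gm * ga) * (q * (inverse p / e)) / (M * t * G / p)"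
      if "G \<noteq> 0" "gm \<noteq> 0" "ga \<noteq> 0" "p \<noteq> 0" "e \<noteq> 0" "t \<noteq> 0" "M \<noteq> 0" for q ga e t G gm p M :: real
      using that by (simp add: field_simps)
    have "1 + sqrt 2 > 0" by (simp add: add_pos_nonneg)
    then show ?thesis unfolding powr_minus by (intro id) (use M pos[THEN less_imp_neq, symmetric] in auto)
  qed
  also have "\<dots> \<le> max C 0"
    unfolding pos_divide_le_eq[OF K] mult.commute[of "max C 0"] by (rule main2)
  finally show ?thesis by (simp add: m_def a_def M_def)
qed

text \<open>The expression grows like \<open>d powr (k / 2 - 1)\<close>, which diverges for
  \<open>k \<ge> 3\<close>. Replacing \<open>k / 2\<close> by \<open>3 / 2\<close> in the power of
  \<open>d\<close> reduces the claim to a concrete exponent.\<close>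

lemma riesz_constant_lower_bound_at_top:
  assumes "k \<ge> 3"
  shows "filterlim (\<lambda>d. (1 / sqrt 2) powr (k / 2) / (Gamma (k / 2) * exp 1 * (1 + sqrt 2)) * ((d / 2 - 1 / 2) powr (k / 2) / (real (d + k) / 2))) at_top sequentially"
proof -
  define c where "c = (1 / sqrt 2) powr (k / 2) / (Gamma (k / 2) * exp 1 * (1 + sqrt 2))"
  have "c > 0" unfolding c_def using assms
    by (intro divide_pos_pos mult_pos_pos Gamma_real_pos) (auto simp: add_pos_nonneg)
  then have "filterlim (\<lambda>d::nat. c * ((d / 2 - 1 / 2) powr (3 / 2) / ((real d + real k) / 2))) at_top sequentially"
    by real_asymp
  then show ?thesis
    unfolding c_def[symmetric]
  proof (rule filterlim_at_top_mono)
    show "\<forall>\<^sub>F d in sequentially. c * ((d / 2 - 1 / 2) powr (3 / 2) / ((real d + real k) / 2)) \<le> c * ((d / 2 - 1 / 2) powr (k / 2) / (real (d + k) / 2))"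
    \<comment> \<open>From \<open>d = 3\<close> on the base \<open>d / 2 - 1 / 2\<close> is at least
      1, so a larger exponent gives a larger power.\<close>
    proof (rule eventually_sequentiallyI[of 3])
      fix d :: nat assume "3 \<le> d"
      then have "(d / 2 - 1 / 2) powr (3 / 2) \<le> (d / 2 - 1 / 2) powr (k / 2)"
        using assms by (intro powr_mono) auto
      then show "c * ((d / 2 - 1 / 2) powr (3 / 2) / ((real d + real k) / 2)) \<le> c * ((d / 2 - 1 / 2) powr (k / 2) / (real (d + k) / 2))"
        using \<open>c > 0\<close> by (intro mult_left_mono) (auto intro!: divide_right_mono)
    qed
  qed
qed

text \<open>\<open>P\<close> is prescribed only on \<open>Rd d\<close>, whereas
  \<open>hom_poly\<close> concerns all arguments. Harmonicity carries over because derivatives along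
  coordinates below \<open>d\<close> at points of \<open>Rd d\<close> see only values on
  \<open>Rd d\<close>.\<close>

lemma spherical_harmonic_representative:
  assumes "P \<in> spherical_harmonics d k"
  obtains Q where "hom_poly d k Q" "harmonic d Q" "\<And>x. x \<in> Rd d \<Longrightarrow> P x = Q x"
proof -
  from assms have "homogeneous_polynomial d k P" and harm: "harmonic d P" by (auto simp: spherical_harmonics_def)
  then obtain Q where Q: "hom_poly d k Q" "\<And>x. x \<in> Rd d \<Longrightarrow> P x = Q x" using homogeneous_polynomial_hom_poly by blast
  have "partial i (partial i P) x = partial i (partial i Q) x" if "x \<in> Rd d" "i < d" for i x
    using Q(2) that by (intro partial_cong_Rd[OF partial_cong_Rd])
  then have "harmonic d Q" using harm by (simp add: harmonic_def)
  with Q that show ?thesis by blast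
qed

theorem corollary1p2:
  fixes A :: "nat \<Rightarrow> ((nat \<Rightarrow> real) \<Rightarrow> complex) \<Rightarrow> (nat \<Rightarrow> real) \<Rightarrow> real"
    and P :: "nat \<Rightarrow> (nat \<Rightarrow> real) \<Rightarrow> complex"
    and C :: "nat \<Rightarrow> nat \<Rightarrow> real"
    and k :: nat
  assumes "\<And>d. d \<ge> 1 \<Longrightarrow> nonneg_sublinear d (A d)"
    and "\<And>d. d \<ge> 1 \<Longrightarrow> bounded_on_L2 d (A d)"
    and "\<And>d. d \<ge> 1 \<Longrightarrow> contraction_on_Linf d (A d)"
    and "k \<ge> 3"
    and "\<And>d. d \<ge> 1 \<Longrightarrow> P d \<in> spherical_harmonics d k"
    \<comment> \<open>for \<open>d = 1\<close> there is no nonzero spherical harmonic of degree \<open>k \<ge> 3\<close>\<close>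
    and "\<And>d. d \<ge> 2 \<Longrightarrow> \<exists>x \<in> Rd d. P d x \<noteq> 0"
    and "\<And>d f x. d \<ge> 1 \<Longrightarrow> f \<in> schwartz d \<Longrightarrow> x \<in> Rd d \<Longrightarrow>
           norm (riesz_trunc d k (P d) 1 f x) \<le> C k d * A d (riesz d k (P d) f) x"
  shows "filterlim (\<lambda>d. C k d) at_top sequentially"
proof -
  define L where "L d = (1 / sqrt 2) powr (k / 2) / (Gamma (k / 2) * exp 1 * (1 + sqrt 2))
    * ((d / 2 - 1 / 2) powr (k / 2) / (real (d + k) / 2))" for d :: nat
  have lower: "L d \<le> max (C k d) 0" if d: "d \<ge> 2" for d
  proof -
    have d1: "d \<ge> 1" using d by simp
    obtain Q where Q: "hom_poly d k Q" "harmonic d Q" "\<And>x. x \<in> Rd d \<Longrightarrow> P d x = Q x"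
      using spherical_harmonic_representative[OF assms(5)[OF d1]] by blast
    obtain z where z: "z \<in> Rd d" "Q z \<noteq> 0" using assms(6)[OF d] Q(3) by auto
    have trunc: "riesz_trunc d k (P d) = riesz_trunc d k Q" by (rule riesz_trunc_cong[OF Q(3)])
    then have "riesz d k (P d) = riesz d k Q" by (simp add: riesz_def[abs_def])
    then have "pointwise_riesz_bound d k Q (A d) (C k d)"
      using assms(1,3,7)[OF d1] by (simp add: pointwise_riesz_bound_def trunc)
    from riesz_constant_lower_bound[OF Q(1,2) _ d z this] assms(4) show ?thesis by (simp add: L_def)
  qed
  have L: "filterlim L at_top sequentially"
    unfolding L_def using riesz_constant_lower_bound_at_top[OF assms(4)] .
  show ?thesis
  \<comment> \<open>Wherever \<open>L d\<close> is positive, the maximum of \<open>C k d\<close> and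
    0 can only be \<open>C k d\<close> itself.\<close>
  proof (rule filterlim_at_top_mono[OF L])
    have "\<forall>\<^sub>F d in sequentially. L d > 0" using L by (simp add: filterlim_at_top_dense)
    then show "\<forall>\<^sub>F d in sequentially. L d \<le> C k d"
      using eventually_ge_at_top[of 2] by eventually_elim (use lower in fastforce)
  qed
qed

end
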